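(* There is a faithful action of the KLR iYangian $\mathcal Y=\mathcal Y(\mathbf R)$ on $\mathrm{Pol}=\bigoplus_{m\ge0}\bigoplus_{\mathbf i\in Q_0^m}\mathrm{Pol}_{\mathbf i}$, $\mathrm{Pol}_{\mathbf i}=\mathbb C[\hbar][X_1(\mathbf i),\dots,X_m(\mathbf i)]$, such that for $\mathbf i=(i_1,\dots,i_m)$: - $e(\mathbf i)$ acts as the projection onto $\mathrm{Pol}_{\mathbf i}$; - $y_k(\mathbf i)$ acts as multiplication by $X_k(\mathbf i)$ on $\mathrm{Pol}_{\mathbf i}$; - $\sigma_k(\mathbf i)$ acts as $\partial_k=\frac{1}{X_{k+1}(\mathbf i)-X_k(\mathbf i)}(s_k-1)$ if $i_k=i_{k+1}$ and as $s_k\circ\overline X_{i_k,i_{k+1}}(X_k(\mathbf i),X_{k+1}(\mathbf i))$ if $i_k\ne i_{k+1}$; - $\rho_L(\mathbf i)$ acts as $p_{\tau i_1}(X_1(s_0\mathbf i))\,s_0$; - $\rho_R(\mathbf i)$ acts as $s_m$.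
   Context: $Q=(Q_0,Q_1,s,t)$ is a loop-free quiver with at most one arrow (both directions counted) between two distinct vertices; $\tau$ is an involution of $Q_0$ and $Q_1$ with $s(\tau h)=\tau(t(h))$, $t(\tau h)=\tau(s(h))$, with $\tau(s(h))=t(h)$ iff $\tau(h)=h$, and without fixed vertices. $\mathbf R=(\mathbf R_i)_{i\in Q_0}$, where $\mathbf R_i$ is a multiset of $\lambda_i$ complex numbers for a fixed dominant weight $\lambda=\sum\lambda_i\varpi_i$. Set $p_i(u)=\prod_{c\in\mathbf R_i}(u-c\hbar)$, $f_i(u)=p_i(u)p_{\tau i}(-u+\hbar)$; $\overline X_{ij}(u,v)=u-v-\frac\hbar2$ if there is an arrow $j\to i$ and $1$ otherwise; $\overline f_{ij}(u,v)=\overline X_{ij}(u,v)\overline X_{ji}(v,u)$. For $\mathbf i\in Q_0^m$: $s_0\mathbf i=(\tau i_1,i_2,\dots,i_m)$, $s_m\mathbf i=(i_1,\dots,i_{m-1},\tau i_m)$, and $s_k\mathbf i$ exchanges $i_k,i_{k+1}$ ($1\le k<m$). These extend to $\mathbb C[\hbar]$-algebra isomorphisms $\mathrm{Pol}_{\mathbf i}\to\mathrm{Pol}_{s_k\mathbf i}$: $s_0$: $X_1(\mathbf i)\mapsto-X_1(s_0\mathbf i)+\hbar$, $X_j(\mathbf i)\mapsto X_j(s_0\mathbf i)$ for $j>1$; $s_m$: $X_m(\mathbf i)\mapsto-X_m(s_m\mathbf i)$, $X_j(\mathbf i)\mapsto X_j(s_m\mathbf i)$ for $j<m$; $s_k$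 ($1\le k<m$): $X_k(\mathbf i)\mapsto X_{k+1}(s_k\mathbf i)$, $X_{k+1}(\mathbf i)\mapsto X_k(s_k\mathbf i)$, $X_j(\mathbf i)\mapsto X_j(s_k\mathbf i)$ otherwise. **KLR iYangian $\mathcal Y(\mathbf R)$.** The $\mathbb C[\hbar]$-algebra spanned by diagrams (up to isotopy) of dotted black strands labelled by $Q_0$ drawn between a left and a right mirror, where a strand meeting a mirror changes its label from $i$ to $\tau i$, modulo local relations; product is vertical stacking. Equivalently it is generated by orthogonal idempotents $e(\mathbf i)$ (all words $\mathbf i$ of all lengths $m\ge0$), dots $y_k(\mathbf i)\in e(\mathbf i)\mathcal Ye(\mathbf i)$, crossings $\sigma_k(\mathbf i)\in e(s_k\mathbf i)\mathcal Ye(\mathbf i)$ ($1\le k<m$), reflections $\rho_L(\mathbf i)\in e(s_0\mathbf i)\mathcal Ye(\mathbf i)$, $\rho_R(\mathbf i)\in e(s_m\mathbf i)\mathcal Ye(\mathbf i)$ ($m\ge1$) (reflecting the first strand at the left mirror, resp. the last strand at the right mirror), subject, for words of length $m$, to: (a) generators acting on disjoint sets of strands commute: the $y$'s commute; $\sigma_k\sigma_l=\sigma_l\sigma_k$ if $|k-l|>1$; $\sigma_ky_l=y_l\sigma_k$ if $l\ne k,k+1$; $\rho_L$ commutes with $y_l$ and $\sigma_l$ for $l\ge2$; $\rho_R$ commutes with $y_l$ for $l<m$ and $\sigma_l$ for $l<m-1$; $\rho_L\rho_R=\rho_R\rho_L$ if $m\ge2$; (b) $y_k\sigma_ke(\mathbf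 i)=(\sigma_ky_{k+1}+\delta_{i_k,i_{k+1}})e(\mathbf i)$, $\sigma_ky_ke(\mathbf i)=(y_{k+1}\sigma_k+\delta_{i_k,i_{k+1}})e(\mathbf i)$; $\sigma_k^2e(\mathbf i)=0$ if $i_k=i_{k+1}$, and $=\overline f_{i_k,i_{k+1}}(y_k,y_{k+1})e(\mathbf i)$ otherwise; $(\sigma_k\sigma_{k+1}\sigma_k-\sigma_{k+1}\sigma_k\sigma_{k+1})e(\mathbf i)=\delta_{i_k=i_{k+2}\ne i_{k+1}}\frac{\overline f_{i_k,i_{k+1}}(y_{k+2},y_{k+1})-\overline f_{i_k,i_{k+1}}(y_k,y_{k+1})}{y_{k+2}-y_k}e(\mathbf i)$; (c) right mirror: $\rho_R^2=1$, $\rho_Ry_m=-y_m\rho_R$, $\sigma_{m-1}\rho_R\sigma_{m-1}\rho_R=\rho_R\sigma_{m-1}\rho_R\sigma_{m-1}$; (d) left mirror: $\rho_L^2e(\mathbf i)=f_{i_1}(y_1)e(\mathbf i)$, $\rho_Ly_1=(-y_1+\hbar)\rho_L$, and $(\sigma_1\rho_L\sigma_1\rho_L-\rho_L\sigma_1\rho_L\sigma_1)e(\mathbf i)=\delta_{\tau i_1,i_2}\frac{f_{i_2}(y_1)-f_{i_1}(y_2)}{y_1+y_2-\hbar}\sigma_1e(\mathbf i)$. *)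

theory Defs
  imports
    "HOL-Computational_Algebra.Polynomial"
    "HOL-Library.Poly_Mapping"
    "HOL-Library.Multiset"
    "HOL-Algebra.QuotRing"
    "Graph_Theory.Digraph"
begin

section \<open>The quiver with involution\<close>

text \<open>
  A quiver is a digraph with named arcs; \<open>tail\<close> is the source \<open>s\<close>, \<open>head\<close> is the target \<open>t\<close>, and
  \<open>j \<rightarrow>\<^bsub>Q\<^esub> i\<close> says that there is an arrow from \<open>j\<close> to \<open>i\<close>.  The involution acts on the vertices
  by \<open>\<tau>\<close> and on the arrows by \<open>\<tau>\<^sub>1\<close>.
\<close>

locale quiver_with_involution = loopfree_digraph Q
  for Q :: "('q, 'h) pre_digraph" +
  fixes \<tau> :: "'q \<Rightarrow> 'q" and \<tau>\<^sub>1 :: "'h \<Rightarrow> 'h"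
  assumes at_most_one_arrow:
      "\<lbrakk>h \<in> arcs Q; h' \<in> arcs Q; {tail Q h, head Q h} = {tail Q h', head Q h'}\<rbrakk> \<Longrightarrow> h = h'"
    and tau_verts: "i \<in> verts Q \<Longrightarrow> \<tau> i \<in> verts Q"
    and tau_tau: "i \<in> verts Q \<Longrightarrow> \<tau> (\<tau> i) = i"
    and tau_arcs: "h \<in> arcs Q \<Longrightarrow> \<tau>\<^sub>1 h \<in> arcs Q"
    and tau_tau_arcs: "h \<in> arcs Q \<Longrightarrow> \<tau>\<^sub>1 (\<tau>\<^sub>1 h) = h"
    and tail_tau: "h \<in> arcs Q \<Longrightarrow> tail Q (\<tau>\<^sub>1 h) = \<tau> (head Q h)"
    and head_tau: "h \<in> arcs Q \<Longrightarrow> head Q (\<tau>\<^sub>1 h) = \<tau> (tail Q h)"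
    and fixed_arrow_iff: "h \<in> arcs Q \<Longrightarrow> \<tau> (tail Q h) = head Q h \<longleftrightarrow> \<tau>\<^sub>1 h = h"
    and no_fixed_vertex: "i \<in> verts Q \<Longrightarrow> \<tau> i \<noteq> i"


section \<open>Polynomials over \<open>\<complex>[\<hbar>]\<close>\<close>

text \<open>
  The type \<open>complex poly\<close> is \<open>\<complex>[\<hbar>]\<close>, and \<open>mpol\<close> is the polynomial ring over it in variables
  \<open>X\<^sub>k\<close> indexed by all \<open>k :: nat\<close>; only the variables with \<open>1 \<le> k \<le> m\<close> are used for words of length \<open>m\<close>.
\<close>

abbreviation "keys \<equiv> Poly_Mapping.keys"
abbreviation "lookup \<equiv> Poly_Mapping.lookup"

type_synonym mpol = "(nat \<Rightarrow>\<^sub>0 nat) \<Rightarrow>\<^sub>0 complex poly"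

definition hbar :: "complex poly" where
  "hbar = [:0, 1:]"

definition Const :: "complex poly \<Rightarrow> mpol" where
  "Const c = Poly_Mapping.single 0 c"

definition Var :: "nat \<Rightarrow> mpol" where
  "Var k = Poly_Mapping.single (Poly_Mapping.single k 1) 1"

text \<open>The \<open>\<complex>[\<hbar>]\<close>-algebra homomorphism with \<open>X\<^sub>k \<mapsto> \<phi> k\<close>.\<close>

definition subst :: "(nat \<Rightarrow> mpol) \<Rightarrow> mpol \<Rightarrow> mpol" where
  "subst \<phi> g = (\<Sum>a\<in>keys g. Const (lookup g a) * (\<Prod>k\<in>keys a. \<phi> k ^ lookup a k))"

text \<open>Exact division in the integral domain \<open>mpol\<close>; meaningful only if \<open>b \<noteq> 0\<close> divides \<open>a\<close>.\<close>

definition exact_quot :: "mpol \<Rightarrow> mpol \<Rightarrow> mpol" where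
  "exact_quot a b = (THE q. b * q = a)"

text \<open>The polynomials \<open>p\<^sub>i\<close>, \<open>f\<^sub>i\<close>, \<open>X_bar\<^sub>i\<^sub>j\<close>, \<open>f_bar\<^sub>i\<^sub>j\<close>, evaluated at arguments in \<open>mpol\<close>.\<close>

definition p_pol :: "('q \<Rightarrow> complex multiset) \<Rightarrow> 'q \<Rightarrow> mpol \<Rightarrow> mpol" where
  "p_pol R i u = (\<Prod>c\<in>#R i. u - Const (smult c hbar))"

definition f_pol :: "('q \<Rightarrow> 'q) \<Rightarrow> ('q \<Rightarrow> complex multiset) \<Rightarrow> 'q \<Rightarrow> mpol \<Rightarrow> mpol" where
  "f_pol \<tau> R i u = p_pol R i u * p_pol R (\<tau> i) (- u + Const hbar)"

definition X_bar :: "('q, 'h) pre_digraph \<Rightarrow> 'q \<Rightarrow> 'q \<Rightarrow> mpol \<Rightarrow> mpol \<Rightarrow> mpol" where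
  "X_bar Q i j u v = (if j \<rightarrow>\<^bsub>Q\<^esub> i then u - v - Const (smult (1/2) hbar) else 1)"

definition f_bar :: "('q, 'h) pre_digraph \<Rightarrow> 'q \<Rightarrow> 'q \<Rightarrow> mpol \<Rightarrow> mpol \<Rightarrow> mpol" where
  "f_bar Q i j u v = X_bar Q i j u v * X_bar Q j i v u"


section \<open>Words\<close>

text \<open>
  A word \<open>(i\<^sub>1, \<dots>, i\<^sub>m)\<close> is a list, so that \<open>i\<^sub>k\<close> is \<open>i ! (k - 1)\<close>.  The maps \<open>s\<^sub>0\<close> and \<open>s\<^sub>m\<close> are
  separate functions because both are needed for the same word, also when \<open>m = 1\<close>.
\<close>

definition refl_left :: "('q \<Rightarrow> 'q) \<Rightarrow> 'q list \<Rightarrow> 'q list" where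
  "refl_left \<tau> i = i[0 := \<tau> (i ! 0)]"

definition refl_right :: "('q \<Rightarrow> 'q) \<Rightarrow> 'q list \<Rightarrow> 'q list" where
  "refl_right \<tau> i = i[length i - 1 := \<tau> (i ! (length i - 1))]"

definition swap :: "nat \<Rightarrow> 'q list \<Rightarrow> 'q list" where
  "swap k i = i[k - 1 := i ! k, k := i ! (k - 1)]"

text \<open>The corresponding maps \<open>Pol\<^sub>i \<rightarrow> Pol\<^bsub>s i\<^esub>\<close>.\<close>

definition refl_left_pol :: "mpol \<Rightarrow> mpol" where
  "refl_left_pol = subst (Var(1 := - Var 1 + Const hbar))"

definition refl_right_pol :: "nat \<Rightarrow> mpol \<Rightarrow> mpol" where
  "refl_right_pol m = subst (Var(m := - Var m))"

definition swap_pol :: "nat \<Rightarrow> mpol \<Rightarrow> mpol" where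
  "swap_pol k = subst (Var(k := Var (Suc k), Suc k := Var k))"


section \<open>Free algebras\<close>

datatype 'g free_word = Free_Word (letters: "'g list")

instantiation free_word :: (type) monoid_add
begin

definition zero_free_word :: "'a free_word" where
  "0 = Free_Word []"

definition plus_free_word :: "'a free_word \<Rightarrow> 'a free_word \<Rightarrow> 'a free_word" where
  "v + w = Free_Word (letters v @ letters w)"

instance
  by standard (simp_all add: zero_free_word_def plus_free_word_def)

end

text \<open>
  With the convolution product of \<open>Poly_Mapping\<close>, \<open>'g free_alg\<close> is the free unital \<open>\<complex>[\<hbar>]\<close>-algebra on
  the type \<open>'g\<close>; \<open>free_ring G\<close> is its subalgebra generated by \<open>G\<close>.
\<close>

type_synonym 'g free_alg = "'g free_word \<Rightarrow>\<^sub>0 complex poly"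

definition free_ring :: "'g set \<Rightarrow> 'g free_alg ring" where
  "free_ring G = \<lparr>carrier = {x. \<forall>w\<in>keys x. set (letters w) \<subseteq> G},
     mult = (*), one = 1, zero = 0, add = (+)\<rparr>"

definition free_const :: "complex poly \<Rightarrow> 'g free_alg" where
  "free_const c = Poly_Mapping.single 0 c"

definition free_gen :: "'g \<Rightarrow> 'g free_alg" where
  "free_gen g = Poly_Mapping.single (Free_Word [g]) 1"

definition augmentation_ideal :: "'g set \<Rightarrow> 'g free_alg set" where
  "augmentation_ideal G = {x \<in> carrier (free_ring G). lookup x 0 = 0}"


section \<open>The KLR iYangian\<close>

text \<open>
  \<open>Gen Dot\<^sub>k i\<close>, \<open>Gen Cross\<^sub>k i\<close>, \<open>Gen Refl_L i\<close>, \<open>Gen Refl_R i\<close> stand for \<open>y\<^sub>k(i)\<close>, \<open>\<sigma>\<^sub>k(i)\<close>, \<open>\<rho>\<^sub>L(i)\<close>, \<open>\<rho>\<^sub>R(i)\<close>.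
\<close>

datatype elem_diag = Dot nat | Cross nat | Refl_L | Refl_R

datatype 'q gen = Ident "'q list" | Gen elem_diag "'q list"

fun fits :: "elem_diag \<Rightarrow> nat \<Rightarrow> bool" where
  "fits (Dot k) m \<longleftrightarrow> 1 \<le> k \<and> k \<le> m"
| "fits (Cross k) m \<longleftrightarrow> 1 \<le> k \<and> k < m"
| "fits Refl_L m \<longleftrightarrow> 1 \<le> m"
| "fits Refl_R m \<longleftrightarrow> 1 \<le> m"

text \<open>\<open>Gen d i\<close> is an element of \<open>e(target \<tau> d i) \<Y> e(i)\<close>.\<close>

fun target :: "('q \<Rightarrow> 'q) \<Rightarrow> elem_diag \<Rightarrow> 'q list \<Rightarrow> 'q list" where
  "target \<tau> (Dot k) i = i"
| "target \<tau> (Cross k) i = swap k i"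
| "target \<tau> Refl_L i = refl_left \<tau> i"
| "target \<tau> Refl_R i = refl_right \<tau> i"

definition gens :: "('q, 'h) pre_digraph \<Rightarrow> 'q gen set" where
  "gens Q = {Ident i |i. i \<in> lists (verts Q)} \<union>
     {Gen d i |d i. i \<in> lists (verts Q) \<and> fits d (length i)}"

text \<open>
  \<open>diag \<tau> [d\<^sub>1, \<dots>, d\<^sub>r] i\<close> is the product \<open>d\<^sub>1 \<dots> d\<^sub>r e(i)\<close>, each \<open>d\<^sub>l\<close> being taken at the word that
  \<open>d\<^bsub>l+1\<^esub> \<dots> d\<^sub>r\<close> lead to when starting from \<open>i\<close>.
\<close>

fun targets :: "('q \<Rightarrow> 'q) \<Rightarrow> elem_diag list \<Rightarrow> 'q list \<Rightarrow> 'q list" where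
  "targets \<tau> [] i = i"
| "targets \<tau> (d # ds) i = target \<tau> d (targets \<tau> ds i)"

fun diag :: "('q \<Rightarrow> 'q) \<Rightarrow> elem_diag list \<Rightarrow> 'q list \<Rightarrow> 'q gen free_alg" where
  "diag \<tau> [] i = free_gen (Ident i)"
| "diag \<tau> (d # ds) i = free_gen (Gen d (targets \<tau> ds i)) * diag \<tau> ds i"

text \<open>
  \<open>dots i g\<close> is \<open>g(y\<^sub>1, \<dots>, y\<^sub>m) e(i)\<close> for \<open>g \<in> \<complex>[\<hbar>][X\<^sub>1, \<dots>, X\<^sub>m]\<close>.  In each monomial the (commuting) dots are
  written in increasing order.
\<close>

definition dots :: "'q list \<Rightarrow> mpol \<Rightarrow> 'q gen free_alg" where
  "dots i g = (\<Sum>a\<in>keys g. free_const (lookup g a) *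
     diag id (concat (map (\<lambda>k. replicate (lookup a k) (Dot k)) [1..<Suc (length i)])) i)"

text \<open>\<open>rel Q \<tau> R x y\<close> is the defining relation \<open>x = y\<close>.\<close>

inductive rel :: "('q, 'h) pre_digraph \<Rightarrow> ('q \<Rightarrow> 'q) \<Rightarrow> ('q \<Rightarrow> complex multiset)
    \<Rightarrow> 'q gen free_alg \<Rightarrow> 'q gen free_alg \<Rightarrow> bool"
  for Q :: "('q, 'h) pre_digraph" and \<tau> :: "'q \<Rightarrow> 'q" and R :: "'q \<Rightarrow> complex multiset"
where
  idem: "\<lbrakk>i \<in> lists (verts Q); j \<in> lists (verts Q)\<rbrakk> \<Longrightarrow>
    rel Q \<tau> R (free_gen (Ident i) * free_gen (Ident j)) (if i = j then free_gen (Ident i) else 0)"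
| idem_left: "\<lbrakk>i \<in> lists (verts Q); fits d (length i)\<rbrakk> \<Longrightarrow>
    rel Q \<tau> R (free_gen (Ident (target \<tau> d i)) * free_gen (Gen d i)) (free_gen (Gen d i))"
| idem_right: "\<lbrakk>i \<in> lists (verts Q); fits d (length i)\<rbrakk> \<Longrightarrow>
    rel Q \<tau> R (free_gen (Gen d i) * free_gen (Ident i)) (free_gen (Gen d i))"
  \<comment> \<open>(a) far commutativity\<close>
| dot_dot: "\<lbrakk>i \<in> lists (verts Q); m = length i; 1 \<le> k; k \<le> m; 1 \<le> l; l \<le> m\<rbrakk> \<Longrightarrow>
    rel Q \<tau> R (diag \<tau> [Dot k, Dot l] i) (diag \<tau> [Dot l, Dot k] i)"
| cross_cross_far: "\<lbrakk>i \<in> lists (verts Q); m = length i; 1 \<le> k; k < m; 1 \<le> l; l < m;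
      Suc k < l \<or> Suc l < k\<rbrakk> \<Longrightarrow>
    rel Q \<tau> R (diag \<tau> [Cross k, Cross l] i) (diag \<tau> [Cross l, Cross k] i)"
| cross_dot_far: "\<lbrakk>i \<in> lists (verts Q); m = length i; 1 \<le> k; k < m; 1 \<le> l; l \<le> m;
      l \<noteq> k; l \<noteq> Suc k\<rbrakk> \<Longrightarrow>
    rel Q \<tau> R (diag \<tau> [Cross k, Dot l] i) (diag \<tau> [Dot l, Cross k] i)"
| left_dot_far: "\<lbrakk>i \<in> lists (verts Q); m = length i; 2 \<le> l; l \<le> m\<rbrakk> \<Longrightarrow>
    rel Q \<tau> R (diag \<tau> [Refl_L, Dot l] i) (diag \<tau> [Dot l, Refl_L] i)"
| left_cross_far: "\<lbrakk>i \<in> lists (verts Q); m = length i; 2 \<le> l; l < m\<rbrakk> \<Longrightarrow>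
    rel Q \<tau> R (diag \<tau> [Refl_L, Cross l] i) (diag \<tau> [Cross l, Refl_L] i)"
| right_dot_far: "\<lbrakk>i \<in> lists (verts Q); m = length i; 1 \<le> l; l < m\<rbrakk> \<Longrightarrow>
    rel Q \<tau> R (diag \<tau> [Refl_R, Dot l] i) (diag \<tau> [Dot l, Refl_R] i)"
| right_cross_far: "\<lbrakk>i \<in> lists (verts Q); m = length i; 1 \<le> l; Suc l < m\<rbrakk> \<Longrightarrow>
    rel Q \<tau> R (diag \<tau> [Refl_R, Cross l] i) (diag \<tau> [Cross l, Refl_R] i)"
| left_right: "\<lbrakk>i \<in> lists (verts Q); m = length i; 2 \<le> m\<rbrakk> \<Longrightarrow>
    rel Q \<tau> R (diag \<tau> [Refl_L, Refl_R] i) (diag \<tau> [Refl_R, Refl_L] i)"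
  \<comment> \<open>(b) dots and crossings\<close>
| dot_cross: "\<lbrakk>i \<in> lists (verts Q); m = length i; 1 \<le> k; k < m\<rbrakk> \<Longrightarrow>
    rel Q \<tau> R (diag \<tau> [Dot k, Cross k] i)
      (diag \<tau> [Cross k, Dot (Suc k)] i + (if i ! (k - 1) = i ! k then diag \<tau> [] i else 0))"
| cross_dot: "\<lbrakk>i \<in> lists (verts Q); m = length i; 1 \<le> k; k < m\<rbrakk> \<Longrightarrow>
    rel Q \<tau> R (diag \<tau> [Cross k, Dot k] i)
      (diag \<tau> [Dot (Suc k), Cross k] i + (if i ! (k - 1) = i ! k then diag \<tau> [] i else 0))"
| cross_squared: "\<lbrakk>i \<in> lists (verts Q); m = length i; 1 \<le> k; k < m\<rbrakk> \<Longrightarrow>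
    rel Q \<tau> R (diag \<tau> [Cross k, Cross k] i)
      (if i ! (k - 1) = i ! k then 0
       else dots i (f_bar Q (i ! (k - 1)) (i ! k) (Var k) (Var (Suc k))))"
| braid: "\<lbrakk>i \<in> lists (verts Q); m = length i; 1 \<le> k; Suc k < m\<rbrakk> \<Longrightarrow>
    rel Q \<tau> R
      (diag \<tau> [Cross k, Cross (Suc k), Cross k] i
        - diag \<tau> [Cross (Suc k), Cross k, Cross (Suc k)] i)
      (if i ! (k - 1) = i ! Suc k \<and> i ! (k - 1) \<noteq> i ! k
       then dots i (exact_quot
         (f_bar Q (i ! (k - 1)) (i ! k) (Var (k + 2)) (Var (k + 1))
           - f_bar Q (i ! (k - 1)) (i ! k) (Var k) (Var (k + 1)))
         (Var (k + 2) - Var k))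
       else 0)"
  \<comment> \<open>(c) right mirror\<close>
| right_squared: "\<lbrakk>i \<in> lists (verts Q); m = length i; 1 \<le> m\<rbrakk> \<Longrightarrow>
    rel Q \<tau> R (diag \<tau> [Refl_R, Refl_R] i) (diag \<tau> [] i)"
| right_dot: "\<lbrakk>i \<in> lists (verts Q); m = length i; 1 \<le> m\<rbrakk> \<Longrightarrow>
    rel Q \<tau> R (diag \<tau> [Refl_R, Dot m] i) (- diag \<tau> [Dot m, Refl_R] i)"
| right_braid: "\<lbrakk>i \<in> lists (verts Q); m = length i; 2 \<le> m\<rbrakk> \<Longrightarrow>
    rel Q \<tau> R (diag \<tau> [Cross (m - 1), Refl_R, Cross (m - 1), Refl_R] i)
      (diag \<tau> [Refl_R, Cross (m - 1), Refl_R, Cross (m - 1)] i)"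
  \<comment> \<open>(d) left mirror\<close>
| left_squared: "\<lbrakk>i \<in> lists (verts Q); m = length i; 1 \<le> m\<rbrakk> \<Longrightarrow>
    rel Q \<tau> R (diag \<tau> [Refl_L, Refl_L] i) (dots i (f_pol \<tau> R (i ! 0) (Var 1)))"
| left_dot: "\<lbrakk>i \<in> lists (verts Q); m = length i; 1 \<le> m\<rbrakk> \<Longrightarrow>
    rel Q \<tau> R (diag \<tau> [Refl_L, Dot 1] i)
      (- diag \<tau> [Dot 1, Refl_L] i + free_const hbar * diag \<tau> [Refl_L] i)"
| left_braid: "\<lbrakk>i \<in> lists (verts Q); m = length i; 2 \<le> m\<rbrakk> \<Longrightarrow>
    rel Q \<tau> R
      (diag \<tau> [Cross 1, Refl_L, Cross 1, Refl_L] i - diag \<tau> [Refl_L, Cross 1, Refl_L, Cross 1] i)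
      (if \<tau> (i ! 0) = i ! 1
       then dots (swap 1 i) (exact_quot
           (f_pol \<tau> R (i ! 1) (Var 1) - f_pol \<tau> R (i ! 0) (Var 2))
           (Var 1 + Var 2 - Const hbar)) * diag \<tau> [Cross 1] i
       else 0)"

definition relators :: "('q, 'h) pre_digraph \<Rightarrow> ('q \<Rightarrow> 'q) \<Rightarrow> ('q \<Rightarrow> complex multiset)
    \<Rightarrow> 'q gen free_alg set" where
  "relators Q \<tau> R = {x - y |x y. rel Q \<tau> R x y}"

definition rel_ideal :: "('q, 'h) pre_digraph \<Rightarrow> ('q \<Rightarrow> 'q) \<Rightarrow> ('q \<Rightarrow> complex multiset)
    \<Rightarrow> 'q gen free_alg set" where
  "rel_ideal Q \<tau> R = Idl\<^bsub>free_ring (gens Q)\<^esub> (relators Q \<tau> R)"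

definition free_class :: "('q, 'h) pre_digraph \<Rightarrow> ('q \<Rightarrow> 'q) \<Rightarrow> ('q \<Rightarrow> complex multiset)
    \<Rightarrow> 'q gen free_alg \<Rightarrow> 'q gen free_alg set" where
  "free_class Q \<tau> R x = rel_ideal Q \<tau> R +>\<^bsub>free_ring (gens Q)\<^esub> x"

text \<open>
  The iYangian has the idempotents \<open>e(i)\<close> in place of a unit.  The free non-unital algebra on the generators is
  the augmentation ideal of the free unital one, and since all relators lie in it, the presented non-unital
  algebra is its image in the unital quotient.  In particular the \<open>one\<close> field of the record \<open>iyangian\<close>
  is not an element of the carrier; scalars act through the classes of constants in the unital quotient.
\<close>

definition iyangian :: "('q, 'h) pre_digraph \<Rightarrow> ('q \<Rightarrow> 'q) \<Rightarrow> ('q \<Rightarrow> complex multiset)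
    \<Rightarrow> 'q gen free_alg set ring" where
  "iyangian Q \<tau> R = (free_ring (gens Q) Quot rel_ideal Q \<tau> R)
     \<lparr>carrier := free_class Q \<tau> R ` augmentation_ideal (gens Q)\<rparr>"

definition iyangian_scale :: "('q, 'h) pre_digraph \<Rightarrow> ('q \<Rightarrow> 'q) \<Rightarrow> ('q \<Rightarrow> complex multiset)
    \<Rightarrow> complex poly \<Rightarrow> 'q gen free_alg set \<Rightarrow> 'q gen free_alg set" where
  "iyangian_scale Q \<tau> R c a = free_class Q \<tau> R (free_const c) \<otimes>\<^bsub>iyangian Q \<tau> R\<^esub> a"

definition idem_e :: "('q, 'h) pre_digraph \<Rightarrow> ('q \<Rightarrow> 'q) \<Rightarrow> ('q \<Rightarrow> complex multiset)
    \<Rightarrow> 'q list \<Rightarrow> 'q gen free_alg set" where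
  "idem_e Q \<tau> R i = free_class Q \<tau> R (free_gen (Ident i))"

definition dot_y :: "('q, 'h) pre_digraph \<Rightarrow> ('q \<Rightarrow> 'q) \<Rightarrow> ('q \<Rightarrow> complex multiset)
    \<Rightarrow> nat \<Rightarrow> 'q list \<Rightarrow> 'q gen free_alg set" where
  "dot_y Q \<tau> R k i = free_class Q \<tau> R (free_gen (Gen (Dot k) i))"

definition cross_sigma :: "('q, 'h) pre_digraph \<Rightarrow> ('q \<Rightarrow> 'q) \<Rightarrow> ('q \<Rightarrow> complex multiset)
    \<Rightarrow> nat \<Rightarrow> 'q list \<Rightarrow> 'q gen free_alg set" where
  "cross_sigma Q \<tau> R k i = free_class Q \<tau> R (free_gen (Gen (Cross k) i))"

definition rho_L :: "('q, 'h) pre_digraph \<Rightarrow> ('q \<Rightarrow> 'q) \<Rightarrow> ('q \<Rightarrow> complex multiset)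
    \<Rightarrow> 'q list \<Rightarrow> 'q gen free_alg set" where
  "rho_L Q \<tau> R i = free_class Q \<tau> R (free_gen (Gen Refl_L i))"

definition rho_R :: "('q, 'h) pre_digraph \<Rightarrow> ('q \<Rightarrow> 'q) \<Rightarrow> ('q \<Rightarrow> complex multiset)
    \<Rightarrow> 'q list \<Rightarrow> 'q gen free_alg set" where
  "rho_R Q \<tau> R i = free_class Q \<tau> R (free_gen (Gen Refl_R i))"


section \<open>The polynomial representation space\<close>

definition Pol_word :: "'q list \<Rightarrow> mpol set" where
  "Pol_word i = {g. \<forall>a\<in>keys g. keys a \<subseteq> {1..length i}}"

text \<open>An element of the direct sum is the finitely supported function sending a word to its component.\<close>

type_synonym 'q pol = "'q list \<Rightarrow>\<^sub>0 mpol"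

definition Pol :: "('q, 'h) pre_digraph \<Rightarrow> 'q pol set" where
  "Pol Q = {v. keys v \<subseteq> lists (verts Q) \<and> (\<forall>i. lookup v i \<in> Pol_word i)}"

definition pol_scale :: "complex poly \<Rightarrow> 'q pol \<Rightarrow> 'q pol" where
  "pol_scale c v = Poly_Mapping.map (\<lambda>g. Const c * g) v"

definition iyangian_action :: "('q, 'h) pre_digraph \<Rightarrow> ('q \<Rightarrow> 'q) \<Rightarrow> ('q \<Rightarrow> complex multiset)
    \<Rightarrow> ('q gen free_alg set \<Rightarrow> 'q pol \<Rightarrow> 'q pol) \<Rightarrow> bool" where
  "iyangian_action Q \<tau> R act \<longleftrightarrow>
     (\<forall>a \<in> carrier (iyangian Q \<tau> R).
        (\<forall>v \<in> Pol Q. act a v \<in> Pol Q) \<and>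
        (\<forall>v \<in> Pol Q. \<forall>w \<in> Pol Q. act a (v + w) = act a v + act a w) \<and>
        (\<forall>c. \<forall>v \<in> Pol Q. act a (pol_scale c v) = pol_scale c (act a v)) \<and>
        (\<forall>c. \<forall>v \<in> Pol Q. act (iyangian_scale Q \<tau> R c a) v = pol_scale c (act a v)) \<and>
        (\<forall>b \<in> carrier (iyangian Q \<tau> R). \<forall>v \<in> Pol Q.
           act (a \<oplus>\<^bsub>iyangian Q \<tau> R\<^esub> b) v = act a v + act b v \<and>
           act (a \<otimes>\<^bsub>iyangian Q \<tau> R\<^esub> b) v = act a (act b v)))"

definition faithful :: "('q, 'h) pre_digraph \<Rightarrow> ('q \<Rightarrow> 'q) \<Rightarrow> ('q \<Rightarrow> complex multiset)
    \<Rightarrow> ('q gen free_alg set \<Rightarrow> 'q pol \<Rightarrow> 'q pol) \<Rightarrow> bool" where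
  "faithful Q \<tau> R act \<longleftrightarrow>
     (\<forall>a \<in> carrier (iyangian Q \<tau> R). (\<forall>v \<in> Pol Q. act a v = 0) \<longrightarrow> a = \<zero>\<^bsub>iyangian Q \<tau> R\<^esub>)"

end

theory Submission
  imports Defs
begin

text \<open>
  That the formulas define an action is a check of each relation, where an identity between operators with denominators is
  proved after multiplying by the denominators.

  For faithfulness, \<open>\<Y> e(i)\<close> is filtered by the number of crossings and reflections.  Up to lower terms the
  crossings and reflections satisfy the braid relations of the affine Weyl group of type \<open>C\<^sub>m\<close> and square to \<open>0\<close>,
  and dots can be moved to the right.  So \<open>\<Y> e(i)\<close> is spanned by the products of one reduced word for each
  group element with a polynomial in the dots.  The group is realised by its simply transitive action on alcoves: words
  are told apart by the image of an interior point of the fundamental alcove, and sign conditions on that point decide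
  which letters shorten a word, so that the exchange property needs no length function.

  Over the fraction field, a word of length \<open>L\<close> acts by a nonzero multiple of its group element plus a combination
  of group elements with words of length less than \<open>L\<close>.  Different group elements are different automorphisms of the
  polynomial ring, hence linearly independent by Dedekind, and the top coefficients of an element acting by zero vanish.
\<close>

section \<open>Substitutions in \<open>mpol\<close>\<close>

text \<open>Uniqueness of reduced words is needed for diagrams and not only for group elements, and
  every braid move of diagrams may leave an error term that has to be controlled along the way. The
  relation \<open>sim\<close> therefore carries the point, the target word and the congruence modulo
  shorter diagrams together, and Matsumoto's theorem is proved in this form: if two letters are both
  descents, the longest alternating word in them splits off, and one braid move exchanges the two
  letters. The error terms are harmless because each has fewer crossings and reflections than the
  sides of its relation: a polynomial in the dots, or at the left mirror such a polynomial times one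
  crossing. That reduced words are the shortest ones for their point comes out of the same
  reduction. The scale 2m + 2 is chosen so that the coordinates 1, ..., m of the base point, their
  doubles, sums and differences are never multiples of it: one integer vector then lies on no wall
  at all. As the algebra has no unit, the argument runs separately on each block of elements x
  e(i).\<close>

abbreviation "single \<equiv> Poly_Mapping.single"

lemma Const_0 [simp]: "Const 0 = 0"
  and Const_1 [simp]: "Const 1 = 1"
  and Const_add: "Const (a + b) = Const a + Const b"
  and Const_diff: "Const (a - b) = Const a - Const b"
  and Const_uminus: "Const (- a) = - Const a"
  and Const_mult: "Const (a * b) = Const a * Const b"
  by (simp_all add: Const_def single_add single_diff single_uminus mult_single)

lemma Const_eq_iff [simp]: "Const a = Const b \<longleftrightarrow> a = b"
  by (metis Const_def lookup_single_eq)

lemma poly_mapping_sum_single: "g = (\<Sum>a\<in>keys g. single a (lookup g a))"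
proof (rule poly_mapping_eqI)
  fix k
  show "lookup g k = lookup (\<Sum>a\<in>keys g. single a (lookup g a)) k"
    by (simp add: lookup_sum lookup_single when_def in_keys_iff)
qed

lemma poly_mapping_single_induct [case_names zero add]:
  assumes "P 0" and "\<And>a c g. c \<noteq> 0 \<Longrightarrow> P g \<Longrightarrow> P (single a c + g)"
  shows "P (g :: 'a \<Rightarrow>\<^sub>0 'b :: comm_monoid_add)"
proof -
  have "P (\<Sum>a\<in>A. single a (lookup g a))" if "finite A" "A \<subseteq> keys g" for A
    using that
  proof (induction A rule: finite_induct)
    case (insert a A)
    then show ?case using assms(2) by (simp add: in_keys_iff)
  qed (use assms(1) in simp)
  from this[of "keys g"] show ?thesis using poly_mapping_sum_single[of g] by simp
qed

definition eval_monom :: "(nat \<Rightarrow> mpol) \<Rightarrow> (nat \<Rightarrow>\<^sub>0 nat) \<Rightarrow> mpol" where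
  "eval_monom \<phi> a = (\<Prod>k\<in>keys a. \<phi> k ^ lookup a k)"

lemma eval_monom_superset:
  assumes "finite A" "keys a \<subseteq> A"
  shows "eval_monom \<phi> a = (\<Prod>k\<in>A. \<phi> k ^ lookup a k)"
  unfolding eval_monom_def using assms
  by (intro prod.mono_neutral_left) (auto simp: in_keys_iff)

lemma eval_monom_add: "eval_monom \<phi> (a + b) = eval_monom \<phi> a * eval_monom \<phi> b"
proof -
  let ?A = "keys a \<union> keys b"
  have "eval_monom \<phi> c = (\<Prod>k\<in>?A. \<phi> k ^ lookup c k)" if "keys c \<subseteq> ?A" for c
    using that by (intro eval_monom_superset) auto
  with keys_add[of a b] show ?thesis
    by (simp add: lookup_add power_add prod.distrib)
qed

lemma eval_monom_0 [simp]: "eval_monom \<phi> 0 = 1"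
  by (simp add: eval_monom_def)

lemma eval_monom_single: "eval_monom \<phi> (single k n) = \<phi> k ^ n"
  by (simp add: eval_monom_def)

lemma subst_eq: "subst \<phi> g = (\<Sum>a\<in>keys g. Const (lookup g a) * eval_monom \<phi> a)"
  by (simp add: subst_def eval_monom_def)

lemma subst_0 [simp]: "subst \<phi> 0 = 0"
  by (simp add: subst_def)

lemma subst_add: "subst \<phi> (g + h) = subst \<phi> g + subst \<phi> h"
  unfolding subst_eq
  by (rule setsum_keys_plus_distrib) (simp_all add: Const_add algebra_simps)

lemma subst_single: "subst \<phi> (single a c) = Const c * eval_monom \<phi> a"
  by (simp add: subst_eq)

lemma subst_uminus: "subst \<phi> (- g) = - subst \<phi> g"
  using subst_add[of \<phi> g "- g"] by (simp add: eq_neg_iff_add_eq_0 add.commute)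

lemma subst_diff: "subst \<phi> (g - h) = subst \<phi> g - subst \<phi> h"
  using subst_add[of \<phi> g "- h"] by (simp add: subst_uminus)

lemma subst_mult: "subst \<phi> (g * h) = subst \<phi> g * subst \<phi> h"
proof (induction g rule: poly_mapping_single_induct)
  case (add a c g)
  have "subst \<phi> (single a c * h) = subst \<phi> (single a c) * subst \<phi> h"
  proof (induction h rule: poly_mapping_single_induct)
    case (add b d h)
    then show ?case
      by (simp add: distrib_left subst_add mult_single subst_single Const_mult eval_monom_add mult_ac)
  qed simp
  with add show ?case by (simp add: distrib_right subst_add)
qed simp

lemma subst_Const [simp]: "subst \<phi> (Const c) = Const c"
  by (simp add: Const_def[of c] subst_single)

lemma subst_1 [simp]: "subst \<phi> 1 = 1"
  using subst_Const[of \<phi> 1] by simp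

lemma subst_Var [simp]: "subst \<phi> (Var k) = \<phi> k"
  by (simp add: Var_def subst_single eval_monom_single)

lemma subst_power: "subst \<phi> (g ^ n) = subst \<phi> g ^ n"
  by (induction n) (simp_all add: subst_mult)

lemma subst_prod_mset: "subst \<phi> (\<Prod>c\<in>#A. g c) = (\<Prod>c\<in>#A. subst \<phi> (g c))"
  by (induction A) (simp_all add: subst_mult)

lemmas subst_simps = subst_add subst_diff subst_uminus subst_mult subst_power

section \<open>Polynomials in a prescribed set of variables\<close>

definition vars_in :: "nat set \<Rightarrow> mpol set" where
  "vars_in K = {g. \<forall>a\<in>keys g. keys a \<subseteq> K}"

lemma Pol_word_eq: "Pol_word i = vars_in {1..length i}"
  by (simp add: Pol_word_def vars_in_def)

lemma vars_in_UNIV [simp]: "vars_in UNIV = UNIV"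
  by (simp add: vars_in_def)

lemma vars_in_0 [simp]: "0 \<in> vars_in K"
  by (simp add: vars_in_def)

lemma vars_in_Const [simp]: "Const c \<in> vars_in K"
  by (simp add: vars_in_def Const_def)

lemma vars_in_1 [simp]: "1 \<in> vars_in K"
  by (simp add: vars_in_def)

lemma vars_in_Var [simp]: "Var k \<in> vars_in K \<longleftrightarrow> k \<in> K"
  by (simp add: vars_in_def Var_def)

lemma vars_in_add [simp]: "g \<in> vars_in K \<Longrightarrow> h \<in> vars_in K \<Longrightarrow> g + h \<in> vars_in K"
  using keys_add[of g h] by (auto simp: vars_in_def)

lemma vars_in_uminus [simp]: "- g \<in> vars_in K \<longleftrightarrow> g \<in> vars_in K"
  by (simp add: vars_in_def in_keys_iff)

lemma vars_in_diff [simp]: "g \<in> vars_in K \<Longrightarrow> h \<in> vars_in K \<Longrightarrow> g - h \<in> vars_in K"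
  using vars_in_add[of g K "- h"] by simp

lemma vars_in_mult [simp]: "g \<in> vars_in K \<Longrightarrow> h \<in> vars_in K \<Longrightarrow> g * h \<in> vars_in K"
proof -
  assume gh: "g \<in> vars_in K" "h \<in> vars_in K"
  have "keys a \<subseteq> K" if a: "a \<in> keys (g * h)" for a
  proof -
    from a keys_mult[of g h] obtain b c where "a = b + c" "b \<in> keys g" "c \<in> keys h" by blast
    with gh keys_add[of b c] show ?thesis unfolding vars_in_def by blast
  qed
  then show ?thesis by (auto simp: vars_in_def)
qed

lemma vars_in_prod_mset: "(\<And>a. g a \<in> vars_in K) \<Longrightarrow> (\<Prod>c\<in>#A. g c) \<in> vars_in K"
  by (induction A) simp_all

lemma single_eq_eval_monom: "single a c = Const c * eval_monom Var a"
proof (induction a arbitrary: c rule: poly_mapping_single_induct)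
  case (add k n a)
  have *: "single (single k n) 1 = Var k ^ n"
  proof (induction n)
    case (Suc n)
    have "single (single k (Suc n)) 1
        = Var k * single (single k n) 1"
      by (simp add: Var_def mult_single flip: single_add)
    with Suc show ?case by simp
  qed simp
  have "single (single k n + a) c
      = single (single k n) 1 * single a c"
    by (simp add: mult_single)
  also have "\<dots> = Const c * eval_monom Var (single k n + a)"
    by (simp only: * add eval_monom_add eval_monom_single) (simp add: mult_ac)
  finally show ?case .
qed (simp add: Const_def)

lemma subst_Var_id [simp]: "subst Var g = g"
proof (induction g rule: poly_mapping_single_induct)
  case (add a c g)
  then show ?case by (simp add: subst_add subst_single flip: single_eq_eval_monom)
qed simp

text \<open>Follows from \<open>subst Var g = g\<close>, which writes g through constants and its
  own variables by sums and products. Identities between composites of the substitutions s_0, s_k,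
  s_m are reduced by it to the variables.\<close>

lemma vars_in_induct [consumes 1, case_names Const Var add mult]:
  assumes "g \<in> vars_in K"
    and C: "\<And>c. P (Const c)" and V: "\<And>k. k \<in> K \<Longrightarrow> P (Var k)"
    and A: "\<And>g h. P g \<Longrightarrow> P h \<Longrightarrow> P (g + h)" and M: "\<And>g h. P g \<Longrightarrow> P h \<Longrightarrow> P (g * h)"
  shows "P g"
proof -
  have P0: "P 0" and P1: "P 1" using C[of 0] C[of 1] by simp_all
  have pow: "P (g ^ n)" if "P g" for g n
    using that by (induction n) (simp_all add: P1 M)
  have prod: "P (prod f A)" if "\<And>k. k \<in> A \<Longrightarrow> P (f k)" for f :: "nat \<Rightarrow> mpol" and A
    using that by (induction A rule: infinite_finite_induct) (simp_all add: P1 M)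
  have sum: "P (sum f A)" if "\<And>k. k \<in> A \<Longrightarrow> P (f k)" for f :: "(nat \<Rightarrow>\<^sub>0 nat) \<Rightarrow> mpol" and A
    using that by (induction A rule: infinite_finite_induct) (simp_all add: P0 A)
  have "P (subst Var g)"
    unfolding subst_def using assms(1)
    by (intro sum M C prod pow V) (auto simp: vars_in_def)
  then show ?thesis by simp
qed

lemmas mpol_induct = vars_in_induct[of _ UNIV, simplified, case_names Const Var add mult]

lemma subst_cong:
  assumes "g \<in> vars_in K" "\<And>k. k \<in> K \<Longrightarrow> \<phi> k = \<psi> k"
  shows "subst \<phi> g = subst \<psi> g"
  using assms(1) by (induction rule: vars_in_induct) (simp_all add: subst_add subst_mult assms(2))

lemma subst_vars_in:
  assumes "g \<in> vars_in K" "\<And>k. k \<in> K \<Longrightarrow> \<phi> k \<in> vars_in L"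
  shows "subst \<phi> g \<in> vars_in L"
  using assms(1) by (induction rule: vars_in_induct) (simp_all add: subst_add subst_mult assms(2))

text \<open>Both substitutions are ring homomorphisms, so a congruence modulo d spreads from the
  variables to all polynomials. This is why the divisions in the crossing operators, in the braid
  relation and in the left mirror relation are exact.\<close>

lemma dvd_subst_diff:
  assumes "\<And>k. d dvd \<phi> k - \<psi> k"
  shows "d dvd subst \<phi> g - subst \<psi> g"
proof (induction g rule: mpol_induct)
  case (add g h)
  have "subst \<phi> (g + h) - subst \<psi> (g + h) = (subst \<phi> g - subst \<psi> g) + (subst \<phi> h - subst \<psi> h)"
    by (simp add: subst_add algebra_simps)
  with add show ?case by (metis dvd_add)
next
  case (mult g h)
  have "subst \<phi> (g * h) - subst \<psi> (g * h)
      = (subst \<phi> g - subst \<psi> g) * subst \<phi> h + subst \<psi> g * (subst \<phi> h - subst \<psi> h)"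
    by (simp add: subst_mult algebra_simps)
  with mult show ?case by (metis dvd_add dvd_mult2 dvd_mult)
qed (simp_all add: assms)

section \<open>Exact division\<close>

lemma exact_quot_eqI:
  assumes "b \<noteq> 0" "b * q = a"
  shows "exact_quot a b = q"
  unfolding exact_quot_def using assms by (intro the_equality) auto

lemma exact_quot_mult:
  assumes "b \<noteq> 0" "b dvd a"
  shows "b * exact_quot a b = a"
  using assms exact_quot_eqI by (metis dvdE)

text \<open>Setting the variables outside K to zero is a homomorphism that fixes a and b, hence also
  their quotient.\<close>

lemma exact_quot_vars_in:
  assumes "b \<noteq> 0" "b dvd a" "a \<in> vars_in K" "b \<in> vars_in K"
  shows "exact_quot a b \<in> vars_in K"
proof -
  define \<pi> where "\<pi> = (\<lambda>k. if k \<in> K then Var k else 0)"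
  have id: "subst \<pi> g = g" if "g \<in> vars_in K" for g
    using subst_cong[OF that, of \<pi> Var] by (simp add: \<pi>_def)
  let ?q = "exact_quot a b"
  have "b * subst \<pi> ?q = b * ?q"
    using exact_quot_mult[OF assms(1,2)] id[OF assms(3)] id[OF assms(4)] by (metis subst_mult)
  then have "subst \<pi> ?q = ?q" using assms(1) by simp
  moreover have "subst \<pi> ?q \<in> vars_in K"
    using subst_vars_in[of ?q UNIV \<pi> K] by (simp add: \<pi>_def)
  ultimately show ?thesis by simp
qed

lemma Var_eq_iff [simp]: "Var k = Var l \<longleftrightarrow> k = l"
  by (metis vars_in_Var singleton_iff)

section \<open>The free algebra and its action\<close>

lemma free_ring_simps [simp]:
  "x \<otimes>\<^bsub>free_ring G\<^esub> y = x * y" "x \<oplus>\<^bsub>free_ring G\<^esub> y = x + y"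
  "\<zero>\<^bsub>free_ring G\<^esub> = 0" "\<one>\<^bsub>free_ring G\<^esub> = 1"
  by (simp_all add: free_ring_def)

lemma ring_free_ring: "ring (free_ring G)"
proof (rule ringI)
  have add: "x + y \<in> carrier (free_ring G)"
    if "x \<in> carrier (free_ring G)" "y \<in> carrier (free_ring G)" for x y :: "'a free_alg"
    using that keys_add[of x y] by (auto simp: free_ring_def)
  have zero: "0 \<in> carrier (free_ring G)" "1 \<in> carrier (free_ring G)"
    and uminus: "x \<in> carrier (free_ring G) \<Longrightarrow> - x \<in> carrier (free_ring G)" for x :: "'a free_alg"
    by (simp_all add: free_ring_def zero_free_word_def in_keys_iff)
  show "abelian_group (free_ring G)"
  proof (rule abelian_groupI)
    fix x assume "x \<in> carrier (free_ring G)"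
    then show "\<exists>y\<in>carrier (free_ring G). y \<oplus>\<^bsub>free_ring G\<^esub> x = \<zero>\<^bsub>free_ring G\<^esub>"
      by (intro bexI[of _ "- x"]) (simp_all add: uminus)
  qed (simp_all add: add zero add_ac)
  show "monoid (free_ring G)"
  proof (rule monoidI)
    fix x y :: "'a free_alg"
    assume xy: "x \<in> carrier (free_ring G)" "y \<in> carrier (free_ring G)"
    have "set (letters w) \<subseteq> G" if w: "w \<in> keys (x * y)" for w
    proof -
      from w keys_mult[of x y] obtain a b where "w = a + b" "a \<in> keys x" "b \<in> keys y" by blast
      with xy show ?thesis by (auto simp: free_ring_def plus_free_word_def)
    qed
    then show "x \<otimes>\<^bsub>free_ring G\<^esub> y \<in> carrier (free_ring G)" by (simp add: free_ring_def)
  qed (simp_all add: zero mult.assoc)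
qed (simp_all add: distrib_left distrib_right)

lemma a_minus_free_ring [simp]:
  assumes "x \<in> carrier (free_ring G)"
  shows "\<ominus>\<^bsub>free_ring G\<^esub> x = - x"
proof -
  interpret ring "free_ring G" by (rule ring_free_ring)
  have "- x \<in> carrier (free_ring G)" using assms by (simp add: free_ring_def in_keys_iff)
  with assms minus_equality[of "- x" x] show ?thesis by simp
qed

lemma free_carrier_simps [simp]:
  "0 \<in> carrier (free_ring G)" "1 \<in> carrier (free_ring G)"
  "x \<in> carrier (free_ring G) \<Longrightarrow> y \<in> carrier (free_ring G) \<Longrightarrow> x + y \<in> carrier (free_ring G)"
  "x \<in> carrier (free_ring G) \<Longrightarrow> y \<in> carrier (free_ring G) \<Longrightarrow> x * y \<in> carrier (free_ring G)"
  "- x \<in> carrier (free_ring G) \<longleftrightarrow> x \<in> carrier (free_ring G)"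
  "free_const c \<in> carrier (free_ring G)"
  "free_gen g \<in> carrier (free_ring G) \<longleftrightarrow> g \<in> G"
proof -
  interpret ring "free_ring G" by (rule ring_free_ring)
  show "0 \<in> carrier (free_ring G)" "1 \<in> carrier (free_ring G)"
    using zero_closed one_closed by simp_all
  show "x \<in> carrier (free_ring G) \<Longrightarrow> y \<in> carrier (free_ring G) \<Longrightarrow> x + y \<in> carrier (free_ring G)"
    "x \<in> carrier (free_ring G) \<Longrightarrow> y \<in> carrier (free_ring G) \<Longrightarrow> x * y \<in> carrier (free_ring G)"
    using a_closed m_closed by simp_all
qed (simp_all add: free_ring_def free_const_def free_gen_def zero_free_word_def in_keys_iff)

lemma free_carrier_diff [simp]:
  "x \<in> carrier (free_ring G) \<Longrightarrow> y \<in> carrier (free_ring G) \<Longrightarrow> x - y \<in> carrier (free_ring G)"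
  using free_carrier_simps(3)[of x G "- y"] by simp

lemma free_carrier_sum:
  "(\<And>a. a \<in> A \<Longrightarrow> f a \<in> carrier (free_ring G)) \<Longrightarrow> sum f A \<in> carrier (free_ring G)"
  by (induction A rule: infinite_finite_induct) simp_all

lemma free_const_commute: "free_const c * x = x * free_const c"
proof (induction x rule: poly_mapping_single_induct)
  case (add a d x)
  then show ?case by (simp add: free_const_def distrib_left distrib_right mult_single mult.commute)
qed simp

lemma free_const_simps:
  "free_const 0 = 0" "free_const 1 = 1" "free_const (a + b) = free_const a + free_const b"
  "free_const (a * b) = free_const a * free_const b" "free_const (- a) = - free_const a"
  by (simp_all add: free_const_def single_add mult_single single_uminus)

section \<open>The module of families of polynomials and its linear maps\<close>

lemma lookup_pol_scale [simp]: "lookup (pol_scale c v) i = Const c * lookup v i"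
  by (simp add: pol_scale_def Poly_Mapping.map.rep_eq when_def)

lemma pol_scale_add: "pol_scale c (v + w) = pol_scale c v + pol_scale c w"
  and pol_scale_add_left: "pol_scale (c + d) v = pol_scale c v + pol_scale d v"
  and pol_scale_scale: "pol_scale c (pol_scale d v) = pol_scale (c * d) v"
  and pol_scale_0 [simp]: "pol_scale 0 v = 0" and pol_scale_1 [simp]: "pol_scale 1 v = v"
  and pol_scale_zero [simp]: "pol_scale c 0 = 0"
  and pol_scale_single: "pol_scale c (single i g) = single i (Const c * g)"
  by (auto intro!: poly_mapping_eqI
        simp: lookup_add Const_add Const_mult algebra_simps lookup_single when_def)

definition pol_linear :: "('q pol \<Rightarrow> 'q pol) \<Rightarrow> bool" where
  "pol_linear F \<longleftrightarrow> (\<forall>v w. F (v + w) = F v + F w) \<and> (\<forall>c v. F (pol_scale c v) = pol_scale c (F v))"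

definition mpol_linear :: "(mpol \<Rightarrow> mpol) \<Rightarrow> bool" where
  "mpol_linear F \<longleftrightarrow> (\<forall>g h. F (g + h) = F g + F h) \<and> (\<forall>c g. F (Const c * g) = Const c * F g)"

lemma mpol_linear_compose: "mpol_linear F \<Longrightarrow> mpol_linear G \<Longrightarrow> mpol_linear (\<lambda>g. F (G g))"
  by (simp add: mpol_linear_def)

lemma mpol_linear_subst: "mpol_linear (subst \<phi>)"
  by (simp add: mpol_linear_def subst_add subst_mult)

lemma pol_linear_single:
  assumes "mpol_linear F"
  shows "pol_linear (\<lambda>v. single j (F (lookup v i)))"
  using assms by (simp add: pol_linear_def mpol_linear_def lookup_add single_add pol_scale_single)

section \<open>Divided differences\<close>

lemma Var_diff_neq_0 [simp]: "Var k - Var l \<noteq> 0 \<longleftrightarrow> k \<noteq> l"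
  by simp

lemma dvd_swap_diff: "Var (Suc k) - Var k dvd swap_pol k g - g"
proof -
  have "Var (Suc k) - Var k dvd subst (Var(k := Var (Suc k), Suc k := Var k)) g - subst Var g"
  proof (rule dvd_subst_diff)
    fix l
    have "Var (Suc k) - Var k dvd Var k - Var (Suc k)"
      by (metis dvd_minus_iff dvd_refl minus_diff_eq)
    then show "Var (Suc k) - Var k dvd (Var(k := Var (Suc k), Suc k := Var k)) l - Var l"
      by auto
  qed
  then show ?thesis by (simp add: swap_pol_def)
qed

definition demazure :: "nat \<Rightarrow> mpol \<Rightarrow> mpol" where
  "demazure k g = exact_quot (swap_pol k g - g) (Var (Suc k) - Var k)"

lemma demazure_mult: "(Var (Suc k) - Var k) * demazure k g = swap_pol k g - g"
  unfolding demazure_def by (rule exact_quot_mult) (simp_all add: dvd_swap_diff)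

lemma mpol_linear_demazure: "mpol_linear (demazure k)"
  unfolding mpol_linear_def demazure_def
proof (intro conjI allI exact_quot_eqI)
  fix g h :: mpol and c
  let ?D = "\<lambda>g. exact_quot (swap_pol k g - g) (Var (Suc k) - Var k)"
  note D = demazure_mult[of k, unfolded demazure_def]
  show "(Var (Suc k) - Var k) * (?D g + ?D h) = swap_pol k (g + h) - (g + h)"
    unfolding distrib_left D by (simp add: swap_pol_def subst_add)
  have "(Var (Suc k) - Var k) * (Const c * ?D g) = Const c * ((Var (Suc k) - Var k) * ?D g)"
    by (simp add: mult_ac)
  then show "(Var (Suc k) - Var k) * (Const c * ?D g) = swap_pol k (Const c * g) - Const c * g"
    unfolding D by (simp add: swap_pol_def subst_mult algebra_simps)
qed simp_all

locale iyangian_data = quiver_with_involution Q \<tau> \<tau>\<^sub>1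
  for Q :: "('q, 'h) pre_digraph" and \<tau> \<tau>\<^sub>1 +
  fixes R :: "'q \<Rightarrow> complex multiset"
begin

section \<open>Operators attached to generators, words and elements of the free algebra\<close>

abbreviation "words \<equiv> lists (verts Q)"
abbreviation "FR \<equiv> free_ring (gens Q)"
abbreviation "dia \<equiv> diag \<tau>"
abbreviation "tgt \<equiv> targets \<tau>"

text \<open>Works on bare polynomials, so that the relations become identities in
  \<open>mpol\<close>; source and target words are the business of \<open>gen_op\<close>.\<close>

fun elem_op :: "elem_diag \<Rightarrow> 'q list \<Rightarrow> mpol \<Rightarrow> mpol" where
  "elem_op (Dot k) i g = Var k * g"
| "elem_op (Cross k) i g = (if i ! (k - 1) = i ! k then demazure k g
     else swap_pol k (X_bar Q (i ! (k - 1)) (i ! k) (Var k) (Var (Suc k)) * g))"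
| "elem_op Refl_L i g = p_pol R (\<tau> (i ! 0)) (Var 1) * refl_left_pol g"
| "elem_op Refl_R i g = refl_right_pol (length i) g"

lemma mpol_linear_elem_op: "mpol_linear (elem_op d i)"
proof (cases d)
  case (Cross k)
  let ?X = "X_bar Q (i ! (k - 1)) (i ! k) (Var k) (Var (Suc k))"
  have "mpol_linear (\<lambda>g. ?X * g)"
    by (simp add: mpol_linear_def distrib_left mult.left_commute)
  then have "mpol_linear (\<lambda>g. swap_pol k (?X * g))"
    unfolding swap_pol_def by (rule mpol_linear_compose[OF mpol_linear_subst])
  then show ?thesis
    using Cross mpol_linear_demazure[of k] by (cases "i ! (k - 1) = i ! k") (simp_all add: mpol_linear_def)
qed (simp_all add: mpol_linear_def refl_left_pol_def refl_right_pol_def subst_simps algebra_simps)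

text \<open>Reading off only the component at i makes every product of generators with mismatched
  words act by zero.\<close>

fun gen_op :: "'q gen \<Rightarrow> 'q pol \<Rightarrow> 'q pol" where
  "gen_op (Ident i) v = single i (lookup v i)"
| "gen_op (Gen d i) v = single (target \<tau> d i) (elem_op d i (lookup v i))"

definition word_op :: "'q gen free_word \<Rightarrow> 'q pol \<Rightarrow> 'q pol" where
  "word_op w v = foldr gen_op (letters w) v"

definition alg_op :: "'q gen free_alg \<Rightarrow> 'q pol \<Rightarrow> 'q pol" where
  "alg_op x v = (\<Sum>w\<in>keys x. pol_scale (lookup x w) (word_op w v))"

lemma pol_linear_gen_op: "pol_linear (gen_op g)"
proof (cases g)
  case (Ident i)
  then show ?thesis using pol_linear_single[of "\<lambda>g. g" i i]
    by (simp add: mpol_linear_def pol_linear_def)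
next
  case (Gen d i)
  then show ?thesis using pol_linear_single[OF mpol_linear_elem_op, of "target \<tau> d i" d i i]
    by (simp add: pol_linear_def)
qed

lemma word_op_0 [simp]: "word_op 0 v = v"
  by (simp add: word_op_def zero_free_word_def)

lemma word_op_add: "word_op (a + b) v = word_op a (word_op b v)"
  by (simp add: word_op_def plus_free_word_def)

lemma pol_linear_word_op: "pol_linear (word_op w)"
proof -
  have "pol_linear (foldr gen_op gs)" for gs
    by (induction gs) (use pol_linear_gen_op in \<open>simp_all add: pol_linear_def\<close>)
  then show ?thesis by (simp add: word_op_def pol_linear_def)
qed

lemma alg_op_0 [simp]: "alg_op 0 v = 0"
  by (simp add: alg_op_def)

lemma alg_op_add: "alg_op (x + y) v = alg_op x v + alg_op y v"
  unfolding alg_op_def by (rule setsum_keys_plus_distrib) (simp_all add: pol_scale_add_left)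

lemma alg_op_uminus: "alg_op (- x) v = - alg_op x v"
  using alg_op_add[of x "- x" v] by (simp add: eq_neg_iff_add_eq_0 add.commute)

lemma alg_op_diff: "alg_op (x - y) v = alg_op x v - alg_op y v"
  using alg_op_add[of x "- y" v] by (simp add: alg_op_uminus)

lemma alg_op_sum: "alg_op (sum f A) v = (\<Sum>a\<in>A. alg_op (f a) v)"
  by (induction A rule: infinite_finite_induct) (simp_all add: alg_op_add)

lemma alg_op_single: "alg_op (single w c) v = pol_scale c (word_op w v)"
  by (simp add: alg_op_def)

lemma pol_linear_alg_op: "pol_linear (alg_op x)"
proof (induction x rule: poly_mapping_single_induct)
  case (add w c x)
  then show ?case using pol_linear_word_op[of w]
    by (simp add: pol_linear_def alg_op_add alg_op_single pol_scale_add pol_scale_scale mult.commute)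
qed (simp add: pol_linear_def)

lemma alg_op_mult: "alg_op (x * y) v = alg_op x (alg_op y v)"
proof (induction x rule: poly_mapping_single_induct)
  case (add a c x)
  have "alg_op (single a c * y) v = alg_op (single a c) (alg_op y v)"
  proof (induction y rule: poly_mapping_single_induct)
    case zero
    then show ?case using pol_linear_alg_op[of "single a c"]
      by (simp add: pol_linear_def) (metis pol_scale_0)
  next
    case (add b d y)
    then show ?case using pol_linear_alg_op[of "single a c"] pol_linear_word_op[of a]
      by (simp add: pol_linear_def distrib_left alg_op_add alg_op_single mult_single
          pol_scale_scale word_op_add pol_scale_add mult.commute)
  qed
  with add show ?case by (simp add: distrib_right alg_op_add)
qed simp

lemma alg_op_const: "alg_op (free_const c) v = pol_scale c v"
  by (simp add: free_const_def alg_op_single)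

lemma alg_op_gen: "alg_op (free_gen g) v = gen_op g v"
  by (simp add: free_gen_def alg_op_single word_op_def)

lemma alg_op_zero [simp]: "alg_op x 0 = 0"
  using pol_linear_alg_op[of x] by (simp add: pol_linear_def) (metis pol_scale_0)

fun seq_op :: "elem_diag list \<Rightarrow> 'q list \<Rightarrow> mpol \<Rightarrow> mpol" where
  "seq_op [] i g = g"
| "seq_op (d # ds) i g = elem_op d (tgt ds i) (seq_op ds i g)"

lemma alg_op_diag:
  "alg_op (dia ds i) v = single (tgt ds i) (seq_op ds i (lookup v i))"
  by (induction ds) (simp_all add: alg_op_gen alg_op_mult)

section \<open>Target words, dot monomials and stability of \<open>Pol Q\<close>\<close>

lemma length_target [simp]: "length (target \<tau> d i) = length i"
  by (cases d) (simp_all add: swap_def refl_left_def refl_right_def)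

lemma length_targets [simp]: "length (tgt ds i) = length i"
  by (induction ds) simp_all

lemma word_nth [simp]: "i \<in> words \<Longrightarrow> j < length i \<Longrightarrow> i ! j \<in> verts Q"
  by (auto simp: in_lists_conv_set)

lemma list_update_words: "i \<in> words \<Longrightarrow> q \<in> verts Q \<Longrightarrow> i[j := q] \<in> words"
  using set_update_subset_insert[of i j q] by (auto simp: in_lists_conv_set)

lemma target_words [simp]: "i \<in> words \<Longrightarrow> fits d (length i) \<Longrightarrow> target \<tau> d i \<in> words"
proof (cases d)
  case (Cross k)
  assume "i \<in> words" "fits d (length i)"
  moreover from this have "k - 1 < length i" "k < length i" using Cross by auto
  ultimately show ?thesis unfolding Cross target.simps swap_def
    by (intro list_update_words word_nth)
next
  case Refl_L
  assume "i \<in> words" "fits d (length i)"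
  moreover from this have "0 < length i" using Refl_L by auto
  ultimately show ?thesis unfolding Refl_L target.simps refl_left_def
    by (intro list_update_words tau_verts word_nth)
qed (simp_all add: refl_right_def list_update_words tau_verts)

abbreviation "seq_fits ds m \<equiv> (\<forall>d\<in>set ds. fits d m)"

lemma targets_words [simp]:
  "i \<in> words \<Longrightarrow> seq_fits ds (length i) \<Longrightarrow> tgt ds i \<in> words"
  by (induction ds) simp_all

lemma gens_simps [simp]:
  "Ident i \<in> gens Q \<longleftrightarrow> i \<in> words"
  "Gen d i \<in> gens Q \<longleftrightarrow> i \<in> words \<and> fits d (length i)"
  by (auto simp: gens_def)

lemma diag_carrier [simp]:
  "i \<in> words \<Longrightarrow> seq_fits ds (length i) \<Longrightarrow> dia ds i \<in> carrier FR"
  by (induction ds) simp_all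

definition dot_seq :: "nat \<Rightarrow> (nat \<Rightarrow>\<^sub>0 nat) \<Rightarrow> elem_diag list" where
  "dot_seq m a = concat (map (\<lambda>k. replicate (lookup a k) (Dot k)) [1..<Suc m])"

lemma set_dot_seq: "set (dot_seq m a) \<subseteq> Dot ` {1..m}"
  by (auto simp: dot_seq_def)

lemma seq_fits_dot_seq [simp]: "seq_fits (dot_seq m a) m"
  using set_dot_seq[of m a] by auto

text \<open>\<open>dots\<close> is built with \<open>id\<close> in place of \<tau>. Dots leave the
  word unchanged, so its monomials are also diagrams for \<tau>.\<close>

lemma diag_id_Dots: "set ds \<subseteq> range Dot \<Longrightarrow> diag id ds i = dia ds i \<and> targets id ds i = i \<and> tgt ds i = i"
  by (induction ds) auto

lemma dots_eq: "dots i g = (\<Sum>a\<in>keys g. free_const (lookup g a) * dia (dot_seq (length i) a) i)"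
proof -
  have "diag id (dot_seq (length i) a) i = dia (dot_seq (length i) a) i" for a
    using set_dot_seq[of "length i" a] by (intro conjunct1[OF diag_id_Dots]) auto
  then show ?thesis by (simp add: dots_def dot_seq_def)
qed

lemma targets_dot_seq [simp]: "tgt (dot_seq m a) i = i"
  using diag_id_Dots[of "dot_seq m a" i] set_dot_seq[of m a] by auto

lemma dots_carrier [simp]: "i \<in> words \<Longrightarrow> dots i g \<in> carrier FR"
  unfolding dots_eq by (intro free_carrier_sum free_carrier_simps(4,6) diag_carrier) simp_all

lemma seq_op_dot_seq:
  assumes "keys a \<subseteq> {1..m}"
  shows "seq_op (dot_seq m a) i g = eval_monom Var a * g"
proof -
  have repl: "seq_op (replicate n (Dot k) @ ds) i g = Var k ^ n * seq_op ds i g" for n k ds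
    by (induction n) (simp_all add: mult.assoc)
  have "seq_op (concat (map (\<lambda>k. replicate (lookup a k) (Dot k)) ks)) i g
      = prod_list (map (\<lambda>k. Var k ^ lookup a k) ks) * g" for ks
    by (induction ks) (simp_all add: repl mult.assoc)
  then have "seq_op (dot_seq m a) i g = (\<Prod>k\<in>{1..<Suc m}. Var k ^ lookup a k) * g"
    unfolding dot_seq_def using prod.distinct_set_conv_list[of "[1..<Suc m]" "\<lambda>k. Var k ^ lookup a k"]
    by (simp only: distinct_upt set_upt)
  also have "(\<Prod>k\<in>{1..<Suc m}. Var k ^ lookup a k) = eval_monom Var a"
    using assms by (intro eval_monom_superset[symmetric]) auto
  finally show ?thesis .
qed

lemma alg_op_dots:
  assumes "g \<in> Pol_word i"
  shows "alg_op (dots i g) v = single i (g * lookup v i)"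
proof -
  have "alg_op (dots i g) v
      = (\<Sum>a\<in>keys g. pol_scale (lookup g a) (single i (eval_monom Var a * lookup v i)))"
    unfolding dots_eq alg_op_sum using assms
    by (intro sum.cong refl) (simp add: alg_op_mult alg_op_const alg_op_diag seq_op_dot_seq Pol_word_def)
  also have "\<dots> = (\<Sum>a\<in>keys g. single i (Const (lookup g a) * eval_monom Var a * lookup v i))"
    by (simp add: pol_scale_single mult.assoc)
  also have "\<dots> = single i (\<Sum>a\<in>keys g. Const (lookup g a) * eval_monom Var a * lookup v i)"
    by (auto intro!: poly_mapping_eqI simp: lookup_sum lookup_single when_def)
  also have "(\<Sum>a\<in>keys g. Const (lookup g a) * eval_monom Var a * lookup v i) = subst Var g * lookup v i"
    by (simp add: subst_eq sum_distrib_right)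
  finally show ?thesis by simp
qed

lemma p_pol_vars_in: "u \<in> vars_in K \<Longrightarrow> p_pol R i u \<in> vars_in K"
  unfolding p_pol_def by (rule vars_in_prod_mset) simp

lemma elem_op_vars_in:
  assumes "fits d (length i)" "g \<in> Pol_word i"
  shows "elem_op d i g \<in> Pol_word i"
proof -
  have swap: "swap_pol k h \<in> Pol_word i" if "h \<in> Pol_word i" "1 \<le> k" "k < length i" for h k
    using that unfolding swap_pol_def Pol_word_eq by (intro subst_vars_in) auto
  show ?thesis
  proof (cases d)
    case (Dot k)
    with assms show ?thesis by (simp add: Pol_word_eq)
  next
    case (Cross k)
    have "demazure k g \<in> Pol_word i"
      unfolding demazure_def Pol_word_eq using Cross assms swap[of g k]
      by (intro exact_quot_vars_in dvd_swap_diff) (auto simp: Pol_word_eq)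
    moreover have "X_bar Q p q (Var k) (Var (Suc k)) * g \<in> Pol_word i" for p q
      using Cross assms by (auto simp: X_bar_def Pol_word_eq)
    ultimately show ?thesis using Cross assms swap by simp
  next
    case Refl_L
    with assms show ?thesis
      by (auto simp: Pol_word_eq refl_left_pol_def intro!: vars_in_mult p_pol_vars_in subst_vars_in[of g "{1..length i}"])
  next
    case Refl_R
    with assms show ?thesis
      by (auto simp: Pol_word_eq refl_right_pol_def intro!: subst_vars_in[of g "{1..length i}"])
  qed
qed

lemma single_in_Pol [simp]:
  "i \<in> words \<Longrightarrow> g \<in> Pol_word i \<Longrightarrow> single i g \<in> Pol Q"
  by (auto simp: Pol_def lookup_single when_def Pol_word_eq)

lemma Pol_lookup [simp]: "v \<in> Pol Q \<Longrightarrow> lookup v i \<in> Pol_word i"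
  by (simp add: Pol_def)

lemma Pol_0 [simp]: "0 \<in> Pol Q"
  by (simp add: Pol_def Pol_word_eq)

lemma Pol_add [simp]:
  assumes "v \<in> Pol Q" "w \<in> Pol Q"
  shows "v + w \<in> Pol Q"
proof -
  have "keys (v + w) \<subseteq> words" using assms keys_add[of v w] unfolding Pol_def by blast
  with assms show ?thesis by (simp add: Pol_def lookup_add Pol_word_eq)
qed

lemma Pol_scale [simp]: "v \<in> Pol Q \<Longrightarrow> pol_scale c v \<in> Pol Q"
  by (auto simp: Pol_def Pol_word_eq in_keys_iff subset_iff)

lemma Pol_sum: "(\<And>a. a \<in> A \<Longrightarrow> f a \<in> Pol Q) \<Longrightarrow> sum f A \<in> Pol Q"
  by (induction A rule: infinite_finite_induct) simp_all

lemma Pol_word_target [simp]: "Pol_word (target \<tau> d i) = Pol_word i"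
  by (simp add: Pol_word_eq)

lemma gen_op_Pol: "g \<in> gens Q \<Longrightarrow> v \<in> Pol Q \<Longrightarrow> gen_op g v \<in> Pol Q"
  using elem_op_vars_in by (cases g) simp_all

lemma alg_op_Pol:
  assumes "x \<in> carrier FR" "v \<in> Pol Q"
  shows "alg_op x v \<in> Pol Q"
proof -
  have "foldr gen_op gs v \<in> Pol Q" if "set gs \<subseteq> gens Q" for gs
    using that by (induction gs) (simp_all add: assms gen_op_Pol)
  then show ?thesis unfolding alg_op_def using assms
    by (intro Pol_sum Pol_scale) (auto simp: word_op_def free_ring_def)
qed

definition op_kernel :: "'q gen free_alg set" where
  "op_kernel = {x \<in> carrier FR. \<forall>v\<in>Pol Q. alg_op x v = 0}"

text \<open>Closure under right multiplication holds because the free ring maps \<open>Pol Q\<close>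
  into itself. Since the kernel is an ideal, it contains \<open>rel_ideal\<close> as soon as it
  contains the relators.\<close>

lemma ideal_op_kernel: "ideal op_kernel FR"
proof (rule idealI)
  interpret ring FR by (rule ring_free_ring)
  show "ring FR" by (rule ring_free_ring)
  show "subgroup op_kernel (add_monoid FR)"
    by (rule add.subgroupI)
      (auto simp: op_kernel_def alg_op_add alg_op_uminus simp flip: a_inv_def)
qed (auto simp: op_kernel_def alg_op_mult alg_op_Pol)

end

section \<open>The relations hold in the polynomial representation\<close>

lemma subst_p_pol: "subst \<phi> (p_pol R i u) = p_pol R i (subst \<phi> u)"
  by (simp add: p_pol_def subst_prod_mset subst_diff)

lemma subst_X_bar: "subst \<phi> (X_bar Q p q u v) = X_bar Q p q (subst \<phi> u) (subst \<phi> v)"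
  by (simp add: X_bar_def subst_diff)

lemma swap_pol_simps [simp]:
  "swap_pol k 0 = 0" "swap_pol k 1 = 1" "swap_pol k (Const c) = Const c"
  "swap_pol k (g + h) = swap_pol k g + swap_pol k h"
  "swap_pol k (g - h) = swap_pol k g - swap_pol k h"
  "swap_pol k (- g) = - swap_pol k g" "swap_pol k (g * h) = swap_pol k g * swap_pol k h"
  "swap_pol k (p_pol R i g) = p_pol R i (swap_pol k g)"
  "swap_pol k (X_bar Q p q g h) = X_bar Q p q (swap_pol k g) (swap_pol k h)"
  "swap_pol k (Var l) = (if l = k then Var (Suc k) else if l = Suc k then Var k else Var l)"
  by (simp_all add: swap_pol_def subst_simps subst_p_pol subst_X_bar)

lemma refl_left_pol_simps [simp]:
  "refl_left_pol 0 = 0" "refl_left_pol 1 = 1" "refl_left_pol (Const c) = Const c"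
  "refl_left_pol (g + h) = refl_left_pol g + refl_left_pol h"
  "refl_left_pol (g - h) = refl_left_pol g - refl_left_pol h"
  "refl_left_pol (- g) = - refl_left_pol g" "refl_left_pol (g * h) = refl_left_pol g * refl_left_pol h"
  "refl_left_pol (p_pol R i g) = p_pol R i (refl_left_pol g)"
  "refl_left_pol (X_bar Q p q g h) = X_bar Q p q (refl_left_pol g) (refl_left_pol h)"
  "refl_left_pol (Var l) = (if l = Suc 0 then - Var (Suc 0) + Const hbar else Var l)"
  by (simp_all add: refl_left_pol_def subst_simps subst_p_pol subst_X_bar)

lemma refl_right_pol_simps [simp]:
  "refl_right_pol m 0 = 0" "refl_right_pol m 1 = 1" "refl_right_pol m (Const c) = Const c"
  "refl_right_pol m (g + h) = refl_right_pol m g + refl_right_pol m h"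
  "refl_right_pol m (g - h) = refl_right_pol m g - refl_right_pol m h"
  "refl_right_pol m (- g) = - refl_right_pol m g" "refl_right_pol m (g * h) = refl_right_pol m g * refl_right_pol m h"
  "refl_right_pol m (p_pol R i g) = p_pol R i (refl_right_pol m g)"
  "refl_right_pol m (X_bar Q p q g h) = X_bar Q p q (refl_right_pol m g) (refl_right_pol m h)"
  "refl_right_pol m (Var l) = (if l = m then - Var m else Var l)"
  by (simp_all add: refl_right_pol_def subst_simps subst_p_pol subst_X_bar)

section \<open>Group relations between the automorphisms s_0, s_k, s_m\<close>

lemma swap_pol_invol [simp]: "swap_pol k (swap_pol k g) = g"
  by (induction g rule: mpol_induct) simp_all

lemma refl_left_pol_invol [simp]: "refl_left_pol (refl_left_pol g) = g"
  by (induction g rule: mpol_induct) simp_all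

lemma refl_right_pol_invol [simp]: "refl_right_pol m (refl_right_pol m g) = g"
  by (induction g rule: mpol_induct) simp_all

lemma swap_swap_far: "Suc k < l \<Longrightarrow> swap_pol l (swap_pol k g) = swap_pol k (swap_pol l g)"
  by (induction g rule: mpol_induct) simp_all

lemma refl_left_swap_far: "2 \<le> l \<Longrightarrow> refl_left_pol (swap_pol l g) = swap_pol l (refl_left_pol g)"
  by (induction g rule: mpol_induct) simp_all

lemma refl_right_swap_far: "Suc l < m \<Longrightarrow> refl_right_pol m (swap_pol l g) = swap_pol l (refl_right_pol m g)"
  by (induction g rule: mpol_induct) simp_all

lemma refl_left_right_pol: "2 \<le> m \<Longrightarrow> refl_left_pol (refl_right_pol m g) = refl_right_pol m (refl_left_pol g)"
  by (induction g rule: mpol_induct) simp_all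

lemma swap_pol_braid:
  "swap_pol k (swap_pol (Suc k) (swap_pol k g)) = swap_pol (Suc k) (swap_pol k (swap_pol (Suc k) g))"
  by (induction g rule: mpol_induct) simp_all

lemma refl_right_pol_braid:
  "swap_pol k (refl_right_pol (Suc k) (swap_pol k (refl_right_pol (Suc k) g)))
    = refl_right_pol (Suc k) (swap_pol k (refl_right_pol (Suc k) (swap_pol k g)))"
  by (induction g rule: mpol_induct) simp_all

lemma refl_left_pol_braid:
  "swap_pol (Suc 0) (refl_left_pol (swap_pol (Suc 0) (refl_left_pol g)))
    = refl_left_pol (swap_pol (Suc 0) (refl_left_pol (swap_pol (Suc 0) g)))"
  by (induction g rule: mpol_induct) simp_all

section \<open>Relations for divided differences\<close>

lemma demazureI: "(Var (Suc k) - Var k) * h = swap_pol k g - g \<Longrightarrow> demazure k g = h"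
  using demazure_mult[of k g] by (metis Var_diff_neq_0 mult_left_cancel n_not_Suc_n)

text \<open>Numerator and denominator both change sign under s_k.\<close>

lemma swap_demazure [simp]: "swap_pol k (demazure k g) = demazure k g"
proof -
  have "swap_pol k ((Var (Suc k) - Var k) * demazure k g) = g - swap_pol k g"
    unfolding demazure_mult by simp
  then have "(Var k - Var (Suc k)) * swap_pol k (demazure k g) = g - swap_pol k g" by simp
  then have "(Var (Suc k) - Var k) * swap_pol k (demazure k g) = swap_pol k g - g"
    by (metis minus_diff_eq mult_minus_left)
  then show ?thesis using demazureI by metis
qed

lemma demazure_demazure: "demazure k (demazure k g) = 0"
  by (rule demazureI) simp

lemma demazure_scale: "swap_pol k c = c \<Longrightarrow> demazure k (c * g) = c * demazure k g"
  by (rule demazureI) (simp add: demazure_mult mult.left_commute flip: right_diff_distrib)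

lemma demazure_scale_right: "swap_pol k c = c \<Longrightarrow> demazure k (g * c) = demazure k g * c"
  using demazure_scale[of k c g] by (simp add: mult.commute)

text \<open>F fixes the denominator and respects the numerator, so it commutes with the quotient.
  Besides the far generators this covers the conjugates of s_k by a mirror.\<close>

lemma demazure_hom:
  assumes "\<And>a b. F (a * b) = F a * F b" "\<And>a b. F (a - b) = F a - F b"
    and "F (Var (Suc k) - Var k) = Var (Suc k) - Var k" "F (swap_pol k g) = swap_pol k (F g)"
  shows "demazure k (F g) = F (demazure k g)"
proof (rule demazureI)
  have "(Var (Suc k) - Var k) * F (demazure k g) = F ((Var (Suc k) - Var k) * demazure k g)"
    by (simp only: assms(1,3))
  then show "(Var (Suc k) - Var k) * F (demazure k g) = swap_pol k (F g) - F g"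
    unfolding demazure_mult by (simp only: assms(2,4))
qed

lemma demazure_swap_far:
  "Suc k < l \<or> Suc l < k \<Longrightarrow> demazure k (swap_pol l g) = swap_pol l (demazure k g)"
  by (rule demazure_hom) (auto intro: swap_swap_far swap_swap_far[symmetric])

lemma demazure_refl_left:
  "2 \<le> k \<Longrightarrow> demazure k (refl_left_pol g) = refl_left_pol (demazure k g)"
  by (rule demazure_hom) (auto simp: refl_left_swap_far)

lemma demazure_refl_right:
  "Suc k < m \<Longrightarrow> demazure k (refl_right_pol m g) = refl_right_pol m (demazure k g)"
  by (rule demazure_hom) (auto simp: refl_right_swap_far)

text \<open>Conjugated by the right mirror, s_k becomes X_k -> -X_{k+1}, X_{k+1} -> -X_k. This fixes
  the denominator X_{k+1} - X_k and commutes with s_k. At the left mirror the same happens up to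
  \<open>hbar\<close>.\<close>

lemma demazure_refl_right_conj:
  "demazure k (refl_right_pol (Suc k) (swap_pol k (refl_right_pol (Suc k) g)))
    = refl_right_pol (Suc k) (swap_pol k (refl_right_pol (Suc k) (demazure k g)))"
  by (rule demazure_hom) (simp_all add: refl_right_pol_braid)

lemma demazure_refl_left_conj:
  "demazure (Suc 0) (refl_left_pol (swap_pol (Suc 0) (refl_left_pol g)))
    = refl_left_pol (swap_pol (Suc 0) (refl_left_pol (demazure (Suc 0) g)))"
  by (rule demazure_hom) (simp_all add: refl_left_pol_braid)

lemma demazure_demazure_far:
  assumes "Suc k < l"
  shows "demazure k (demazure l g) = demazure l (demazure k g)"
proof (rule demazureI)
  have l: "(Var (Suc k) - Var k) * swap_pol l h = swap_pol l ((Var (Suc k) - Var k) * h)" for h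
    using assms by simp
  have "(Var (Suc l) - Var l) * ((Var (Suc k) - Var k) * demazure l (demazure k g))
      = (Var (Suc k) - Var k) * ((Var (Suc l) - Var l) * demazure l (demazure k g))"
    by (simp only: mult_ac)
  also have "\<dots> = swap_pol l (swap_pol k g - g) - (swap_pol k g - g)"
    by (simp only: demazure_mult right_diff_distrib l)
  also have "\<dots> = (Var (Suc l) - Var l) * (swap_pol k (demazure l g) - demazure l g)"
  proof -
    have "(Var (Suc l) - Var l) * swap_pol k (demazure l g) = swap_pol k ((Var (Suc l) - Var l) * demazure l g)"
      using assms by simp
    then show ?thesis using assms
      unfolding right_diff_distrib demazure_mult by (simp add: swap_swap_far)
  qed
  finally show "(Var (Suc k) - Var k) * demazure l (demazure k g) = swap_pol k (demazure l g) - demazure l g"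
    by (metis Var_diff_neq_0 mult_left_cancel n_not_Suc_n)
qed

text \<open>Clearing denominators in the nil-Hecke braid relation makes both sides the antisymmetrizer.\<close>

lemma nil_hecke_antisymmetrizer:
  fixes a b :: "'a :: comm_ring_1"
  assumes "a * U = sV - V" "b * V = tW - W" "a * W = sg - g"
    and "(a + b) * sV = stW - W" "(a + b) * tW = tsg - tg" "b * stW = stsg - stg"
  shows "a * b * (a + b) * U = stsg - stg - tsg + tg + sg - g"
proof -
  have "a * b * (a + b) * U = b * ((a + b) * (a * U))" by (simp add: mult_ac)
  also have "\<dots> = b * ((a + b) * sV) - (a + b) * (b * V)"
    unfolding assms(1) by (simp add: algebra_simps)
  also have "\<dots> = b * stW - (a + b) * tW + a * W"
    unfolding assms(2,4) by (simp add: algebra_simps)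
  finally show ?thesis unfolding assms(3,5,6) by simp
qed

lemma demazure_braid:
  "demazure k (demazure (Suc k) (demazure k g)) = demazure (Suc k) (demazure k (demazure (Suc k) g))"
proof -
  let ?x = "Var k" and ?y = "Var (Suc k)" and ?z = "Var (Suc (Suc k))"
  let ?s = "swap_pol k" and ?t = "swap_pol (Suc k)"
  have D: "(?y - ?x) * demazure k h = ?s h - h" "(?z - ?y) * demazure (Suc k) h = ?t h - h" for h
    by (rule demazure_mult)+
  \<comment> \<open>The roots y - x, z - y and their sum z - x are permuted up to sign by s and t.
    The next lines transport the defining equation of a divided difference along these
    permutations.\<close>
  have s: "(?z - ?x) * ?s (demazure (Suc k) h) = ?s (?t h) - ?s h" for h
    using arg_cong[OF D(2), of ?s h] by simp
  have t: "(?z - ?x) * ?t (demazure k h) = ?t (?s h) - ?t h" for h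
    using arg_cong[OF D(1), of ?t h] by simp
  have st: "(?z - ?y) * ?s (?t (demazure k h)) = ?s (?t (?s h)) - ?s (?t h)" for h
    using arg_cong[OF t, of ?s h] by simp
  have ts: "(?y - ?x) * ?t (?s (demazure (Suc k) h)) = ?t (?s (?t h)) - ?t (?s h)" for h
    using arg_cong[OF s, of ?t h] by simp
  let ?U = "demazure k (demazure (Suc k) (demazure k g))"
  let ?U' = "demazure (Suc k) (demazure k (demazure (Suc k) g))"
  have "(?y - ?x) * (?z - ?y) * ((?y - ?x) + (?z - ?y)) * ?U
      = ?s (?t (?s g)) - ?s (?t g) - ?t (?s g) + ?t g + ?s g - g"
    by (rule nil_hecke_antisymmetrizer[OF D(1) D(2) D(1) _ _ st]) (simp_all add: s t)
  moreover have "(?z - ?y) * (?y - ?x) * ((?z - ?y) + (?y - ?x)) * ?U'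
      = ?t (?s (?t g)) - ?t (?s g) - ?s (?t g) + ?s g + ?t g - g"
    by (rule nil_hecke_antisymmetrizer[OF D(2) D(1) D(2) _ _ ts]) (simp_all add: s t)
  ultimately have "(?y - ?x) * (?z - ?y) * ((?y - ?x) + (?z - ?y)) * ?U
      = (?y - ?x) * (?z - ?y) * ((?y - ?x) + (?z - ?y)) * ?U'"
    by (simp add: swap_pol_braid mult_ac add_ac)
  then show ?thesis by simp
qed


lemma X_bar_diff: "u - v = u' - v' \<Longrightarrow> X_bar Q p q u v = X_bar Q p q u' v'"
  by (simp add: X_bar_def)

text \<open>Replacing \<open>Var k\<close> by \<open>Var (k + 2)\<close> turns the second term into
  the first and is trivial modulo their difference.\<close>

lemma f_bar_dvd: "Var (k + 2) - Var k dvd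
    f_bar Q p q (Var (k + 2)) (Var (k + 1)) - f_bar Q p q (Var k) (Var (k + 1))"
proof -
  let ?F = "f_bar Q p q (Var k) (Var (k + 1))"
  have "Var (k + 2) - Var k dvd subst (Var(k := Var (k + 2))) ?F - subst Var ?F"
    by (rule dvd_subst_diff) simp
  then show ?thesis by (simp add: f_bar_def subst_X_bar subst_mult)
qed

section \<open>The maps s_0, s_k, s_m on words\<close>

lemma length_swap [simp]: "length (swap k i) = length i"
  and length_refl_left [simp]: "length (refl_left \<tau> i) = length i"
  and length_refl_right [simp]: "length (refl_right \<tau> i) = length i"
  by (simp_all add: swap_def refl_left_def refl_right_def)

lemma swap_eq_Nil [simp]: "swap k i = [] \<longleftrightarrow> i = []"
  and refl_left_eq_Nil [simp]: "refl_left \<tau> i = [] \<longleftrightarrow> i = []"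
  and refl_right_eq_Nil [simp]: "refl_right \<tau> i = [] \<longleftrightarrow> i = []"
  by (simp_all add: swap_def refl_left_def refl_right_def)

lemma nth_swap [simp]:
  "Suc n < length i \<Longrightarrow> swap (Suc n) i ! l = (if l = n then i ! Suc n else if l = Suc n then i ! n else i ! l)"
  by (auto simp: swap_def nth_list_update)

lemma nth_refl_left [simp]:
  "i \<noteq> [] \<Longrightarrow> refl_left \<tau> i ! l = (if l = 0 then \<tau> (i ! 0) else i ! l)"
  by (auto simp: refl_left_def nth_list_update)

lemma nth_refl_right [simp]:
  "length i = Suc n \<Longrightarrow> refl_right \<tau> i ! l = (if l = n then \<tau> (i ! n) else i ! l)"
  by (auto simp: refl_right_def nth_list_update)

lemma swap_far: "Suc a < b \<Longrightarrow> Suc b < length i \<Longrightarrow>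
    swap (Suc b) (swap (Suc a) i) = swap (Suc a) (swap (Suc b) i)"
  by (rule nth_equalityI) auto

lemma refl_left_swap: "0 < l \<Longrightarrow> Suc l < length i \<Longrightarrow>
    refl_left \<tau> (swap (Suc l) i) = swap (Suc l) (refl_left \<tau> i)"
  by (cases "i = []"; rule nth_equalityI) auto

lemma refl_right_swap: "length i = Suc n \<Longrightarrow> Suc l < n \<Longrightarrow>
    refl_right \<tau> (swap (Suc l) i) = swap (Suc l) (refl_right \<tau> i)"
  by (rule nth_equalityI) auto

lemma refl_left_right:
  "length i = Suc (Suc n) \<Longrightarrow> refl_left \<tau> (refl_right \<tau> i) = refl_right \<tau> (refl_left \<tau> i)"
  by (cases "i = []"; rule nth_equalityI) auto

lemma swap_braid:
  "Suc (Suc n) < length i \<Longrightarrow> swap (Suc n) (swap (Suc (Suc n)) (swap (Suc n) i))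
    = swap (Suc (Suc n)) (swap (Suc n) (swap (Suc (Suc n)) i))"
  by (rule nth_equalityI) auto

lemma swap_swap [simp]: "Suc n < length i \<Longrightarrow> swap (Suc n) (swap (Suc n) i) = i"
  by (rule nth_equalityI) auto

lemma refl_right_braid:
  "length i = Suc (Suc n) \<Longrightarrow> swap (Suc n) (refl_right \<tau> (swap (Suc n) (refl_right \<tau> i)))
    = refl_right \<tau> (swap (Suc n) (refl_right \<tau> (swap (Suc n) i)))"
  by (rule nth_equalityI) auto

lemma refl_left_braid:
  "length i = Suc (Suc n) \<Longrightarrow> swap (Suc 0) (refl_left \<tau> (swap (Suc 0) (refl_left \<tau> i)))
    = refl_left \<tau> (swap (Suc 0) (refl_left \<tau> (swap (Suc 0) i)))"
  by (cases "i = []"; rule nth_equalityI) auto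

section \<open>Relations between the operators in terms of labels\<close>

context iyangian_data
begin

text \<open>A crossing sees the word only through two labels. With these as arguments, the relations
  become identities about two or three labels instead of lists.\<close>

definition cross_op :: "nat \<Rightarrow> 'q \<Rightarrow> 'q \<Rightarrow> mpol \<Rightarrow> mpol" where
  "cross_op k p q g = (if p = q then demazure k g
     else swap_pol k (X_bar Q p q (Var k) (Var (Suc k)) * g))"

lemma elem_op_Cross: "elem_op (Cross k) i g = cross_op k (i ! (k - 1)) (i ! k) g"
  by (simp add: cross_op_def)

declare elem_op.simps(2) [simp del]
declare elem_op_Cross [simp]

lemma dominates_tau: "i \<in> verts Q \<Longrightarrow> j \<in> verts Q \<Longrightarrow> \<tau> i \<rightarrow>\<^bsub>Q\<^esub> \<tau> j \<longleftrightarrow> j \<rightarrow>\<^bsub>Q\<^esub> i"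
proof -
  have *: "\<tau> q \<rightarrow>\<^bsub>Q\<^esub> \<tau> p" if "p \<rightarrow>\<^bsub>Q\<^esub> q" for p q
  proof -
    from that obtain h where h: "h \<in> arcs Q" "tail Q h = p" "head Q h = q"
      by (auto simp: arcs_ends_def arc_to_ends_def)
    then have "(\<tau> q, \<tau> p) = arc_to_ends Q (\<tau>\<^sub>1 h)"
      by (simp add: arc_to_ends_def tail_tau head_tau)
    then show ?thesis using tau_arcs[OF h(1)] by (auto simp: arcs_ends_def)
  qed
  assume "i \<in> verts Q" "j \<in> verts Q"
  with *[of "\<tau> i" "\<tau> j"] *[of j i] show ?thesis by (auto simp: tau_tau)
qed

text \<open>The involution reverses arrows, and reflecting both variables reverses their difference.
  The two changes compensate when a crossing is moved behind a mirror.\<close>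

lemma X_bar_tau:
  assumes "p \<in> verts Q" "q \<in> verts Q" "u - v = u' - v'"
  shows "X_bar Q (\<tau> q) (\<tau> p) u v = X_bar Q p q u' v'"
  using assms by (simp add: X_bar_def dominates_tau)

lemma X_bar_tau_right:
  assumes "p \<in> verts Q" "q \<in> verts Q" "u - v = u' - v'"
  shows "X_bar Q p (\<tau> q) u v = X_bar Q q (\<tau> p) u' v'"
  using X_bar_tau[of q "\<tau> p" u v u' v'] assms by (simp add: tau_tau tau_verts)

lemma X_bar_tau_left:
  assumes "p \<in> verts Q" "q \<in> verts Q" "u - v = u' - v'"
  shows "X_bar Q (\<tau> p) q u v = X_bar Q (\<tau> q) p u' v'"
  using X_bar_tau[of "\<tau> q" p u v u' v'] assms by (simp add: tau_tau tau_verts)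

lemma tau_eq_iff: "p \<in> verts Q \<Longrightarrow> q \<in> verts Q \<Longrightarrow> \<tau> p = \<tau> q \<longleftrightarrow> p = q"
  by (metis tau_tau)

lemma cross_op_dot:
  "Var k * cross_op k p q g = cross_op k p q (Var (Suc k) * g) + (if p = q then g else 0)"
  "cross_op k p q (Var k * g) = Var (Suc k) * cross_op k p q g + (if p = q then g else 0)"
proof -
  have "demazure k (Var (Suc k) * g) = Var k * demazure k g - g"
    using arg_cong[OF demazure_mult[of k g], of "\<lambda>h. Var k * h"]
    by (intro demazureI) (simp add: algebra_simps)
  moreover have "demazure k (Var k * g) = Var (Suc k) * demazure k g + g"
    using arg_cong[OF demazure_mult[of k g], of "\<lambda>h. Var (Suc k) * h"]
    by (intro demazureI) (simp add: algebra_simps)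
  ultimately show "Var k * cross_op k p q g = cross_op k p q (Var (Suc k) * g) + (if p = q then g else 0)"
    "cross_op k p q (Var k * g) = Var (Suc k) * cross_op k p q g + (if p = q then g else 0)"
    by (simp_all add: cross_op_def mult.left_commute)
qed

lemma cross_op_scale: "swap_pol k c = c \<Longrightarrow> cross_op k p q (c * g) = c * cross_op k p q g"
  by (simp add: cross_op_def demazure_scale mult.left_commute)

lemma cross_op_squared:
  "cross_op k q p (cross_op k p q g)
    = (if p = q then 0 else f_bar Q p q (Var k) (Var (Suc k)) * g)"
  by (simp add: cross_op_def demazure_demazure f_bar_def mult_ac)

lemma cross_op_far:
  assumes "Suc k < l"
  shows "cross_op k p q (cross_op l p' q' g) = cross_op l p' q' (cross_op k p q g)"
  using assms demazure_demazure_far[OF assms]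
  by (cases "p = q"; cases "p' = q'")
    (simp_all add: cross_op_def demazure_swap_far demazure_scale_right swap_swap_far mult_ac)

text \<open>P stands for the prefactor \<open>p_pol\<close> of the left reflection; as a polynomial
  in X_1 alone it is fixed by s_l for l \<ge> 2.\<close>

lemma cross_op_refl_left:
  "2 \<le> l \<Longrightarrow> P \<in> vars_in {1} \<Longrightarrow> P * refl_left_pol (cross_op l p q g) = cross_op l p q (P * refl_left_pol g)"
proof -
  assume l: "2 \<le> l" and "P \<in> vars_in {1}"
  from this(2) have "swap_pol l P = P"
    by (induction rule: vars_in_induct) (use l in simp_all)
  then show ?thesis using l
    by (simp add: cross_op_def demazure_refl_left demazure_scale refl_left_swap_far mult_ac)
qed

lemma cross_op_refl_right:
  "Suc l < m \<Longrightarrow> refl_right_pol m (cross_op l p q g) = cross_op l p q (refl_right_pol m g)"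
  by (simp add: cross_op_def demazure_refl_right refl_right_swap_far)

text \<open>If exactly two neighbouring labels agree, the two arrow factors form a product that is
  symmetric in the variables of the divided difference and passes through it. Only p = r \<noteq> q
  leaves a remainder: there the divided difference stands in the middle and contributes a term in g
  itself, with different arrow factors on the two sides.\<close>

lemma cross_op_braid:
  "cross_op k q r (cross_op (Suc k) p r (cross_op k p q g))
      - cross_op (Suc k) p q (cross_op k p r (cross_op (Suc k) q r g))
    = (if p = r \<and> p \<noteq> q then exact_quot
        (f_bar Q p q (Var (k + 2)) (Var (k + 1)) - f_bar Q p q (Var k) (Var (k + 1)))
        (Var (k + 2) - Var k) * g else 0)" (is "?L1 - ?L2 = ?r")
proof -
  let ?x = "Var k" and ?y = "Var (Suc k)" and ?z = "Var (Suc (Suc k))"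
  let ?s = "swap_pol k" and ?t = "swap_pol (Suc k)"
  have D: "(?y - ?x) * demazure k h = ?s h - h" "(?z - ?y) * demazure (Suc k) h = ?t h - h" for h
    by (rule demazure_mult)+
  have s: "(?z - ?x) * ?s (demazure (Suc k) h) = ?s (?t h) - ?s h" for h
    using arg_cong[OF D(2), of ?s h] by simp
  have t: "(?z - ?x) * ?t (demazure k h) = ?t (?s h) - ?t h" for h
    using arg_cong[OF D(1), of ?t h] by simp
  have st: "(?z - ?y) * ?s (?t (demazure k h)) = ?s (?t (?s h)) - ?s (?t h)" for h
    using arg_cong[OF t, of ?s h] by simp
  have ts: "(?y - ?x) * ?t (?s (demazure (Suc k) h)) = ?t (?s (?t h)) - ?t (?s h)" for h
    using arg_cong[OF s, of ?t h] by simp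
  consider "p = q" "q = r" | "p = q" "q \<noteq> r" | "p \<noteq> q" "q = r" | "p = r" "p \<noteq> q"
    | "p \<noteq> q" "q \<noteq> r" "p \<noteq> r" by blast
  then show ?thesis
  proof cases
    case 1
    then show ?thesis by (simp add: cross_op_def demazure_braid)
  next
    case 2
    have "demazure (Suc k) (?s (?t g)) = ?s (?t (demazure k g))"
      by (rule demazureI) (simp add: st swap_pol_braid)
    moreover have "?t (X_bar Q q r ?y ?x * X_bar Q q r ?z ?x) = X_bar Q q r ?y ?x * X_bar Q q r ?z ?x"
      by (simp add: mult_ac)
    ultimately show ?thesis using 2 demazure_scale[of "Suc k" "X_bar Q q r ?y ?x * X_bar Q q r ?z ?x" "?s (?t g)"]
      by (simp add: cross_op_def mult_ac)
  next
    case 3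
    have "demazure k (?t (?s g)) = ?t (?s (demazure (Suc k) g))"
      by (rule demazureI) (simp add: ts swap_pol_braid)
    moreover have "?s (X_bar Q p q ?z ?y * X_bar Q p q ?z ?x) = X_bar Q p q ?z ?y * X_bar Q p q ?z ?x"
      by (simp add: mult_ac)
    ultimately show ?thesis using 3 demazure_scale[of k "X_bar Q p q ?z ?y * X_bar Q p q ?z ?x" "?t (?s g)"]
      by (simp add: cross_op_def mult_ac)
  next
    case 4
    let ?A = "X_bar Q p q" and ?B = "X_bar Q q p"
    \<comment> \<open>The terms of \<open>?L1\<close> and \<open>?L2\<close> in s t s g coincide and
      cancel in the difference; the terms in g give the remainder.\<close>
    have L1: "(?z - ?x) * ?L1 = ?B ?y ?x * (?A ?z ?y * ?s (?t (?s g)) - ?A ?x ?y * g)"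
      using 4 s[of "?s (?A ?x ?y * g)"] by (simp add: cross_op_def mult.left_commute)
    have L2: "(?z - ?x) * ?L2 = ?A ?z ?y * (?B ?y ?x * ?s (?t (?s g)) - ?B ?y ?z * g)"
      using 4 t[of "?t (?B ?y ?z * g)"] by (simp add: cross_op_def mult.left_commute swap_pol_braid)
    have "(?z - ?x) * ?r = (?A ?z ?y * ?B ?y ?z - ?A ?x ?y * ?B ?y ?x) * g"
      using 4 exact_quot_mult[OF _ f_bar_dvd[of k Q p q]] by (simp add: f_bar_def flip: mult.assoc)
    then have "(?z - ?x) * (?L1 - ?L2) = (?z - ?x) * ?r"
      unfolding right_diff_distrib L1 L2 by (simp add: algebra_simps)
    then show ?thesis by simp
  next
    case 5
    then show ?thesis by (simp add: cross_op_def mult_ac swap_pol_braid)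
  qed
qed

text \<open>Up to \<tau>, each side has one crossing with labels p, q and one with labels p, \<tau>
  q. As \<tau> has no fixed vertex, at most one of the two is a divided difference, and the arrow
  factor of the other one is symmetric enough to pass through it.\<close>

lemma cross_op_refl_right_braid:
  fixes k :: nat
  defines "\<rho> \<equiv> refl_right_pol (Suc k)"
  assumes pq: "p \<in> verts Q" "q \<in> verts Q"
  shows "cross_op k (\<tau> q) (\<tau> p) (\<rho> (cross_op k p (\<tau> q) (\<rho> g)))
    = \<rho> (cross_op k q (\<tau> p) (\<rho> (cross_op k p q g)))"
proof -
  let ?x = "Var k" and ?y = "Var (Suc k)"
  have qp: "q = \<tau> p \<longleftrightarrow> p = \<tau> q" "\<tau> q = \<tau> p \<longleftrightarrow> p = q" using pq by (auto simp: tau_tau tau_eq_iff)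
  note conj = demazure_refl_right_conj[of k, folded \<rho>_def]
  consider "p = q" "p \<noteq> \<tau> q" | "p = \<tau> q" "p \<noteq> q" | "p \<noteq> q" "p \<noteq> \<tau> q"
    using no_fixed_vertex pq by metis
  then show ?thesis
  proof cases
    case 1
    have "X_bar Q p (\<tau> p) (- ?x) ?y = X_bar Q p (\<tau> p) (- ?y) ?x"
      by (rule X_bar_diff) simp
    with 1 show ?thesis
      by (simp add: cross_op_def \<rho>_def demazure_scale demazure_refl_right_conj refl_right_pol_braid)
  next
    case 2
    have "X_bar Q p q (- ?x) ?y = X_bar Q p q (- ?y) ?x"
      by (rule X_bar_diff) simp
    moreover have "\<rho> (demazure k (\<rho> (swap_pol k g))) = swap_pol k (\<rho> (demazure k (\<rho> g)))"
      using conj[of "\<rho> g"] by (simp add: \<rho>_def)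
    moreover from 2 have "\<tau> p = q" "\<tau> q = p" using pq by (simp_all add: tau_tau)
    ultimately show ?thesis using 2(2)
      by (simp add: cross_op_def \<rho>_def demazure_scale)
  next
    case 3
    have "X_bar Q (\<tau> q) (\<tau> p) ?y ?x = X_bar Q p q (- ?x) (- ?y)"
      "X_bar Q p (\<tau> q) (- ?x) ?y = X_bar Q q (\<tau> p) (- ?y) ?x"
      by (rule X_bar_tau X_bar_tau_right; use pq in simp)+
    with 3 qp show ?thesis
      by (simp add: cross_op_def \<rho>_def refl_right_pol_braid mult_ac)
  qed
qed

text \<open>Rests on the symmetry f_q(-u + hbar) = f_{\<tau> q}(u): modulo X_1 + X_2 - hbar the
  argument X_1 may be replaced by -X_2 + hbar.\<close>

lemma f_pol_dvd:
  assumes "q \<in> verts Q" "\<tau> p = q" "p \<in> verts Q"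
  shows "Var 1 + Var 2 - Const hbar dvd f_pol \<tau> R q (Var 1) - f_pol \<tau> R p (Var 2)"
proof -
  let ?F = "f_pol \<tau> R q (Var 1)"
  have "Var 1 + Var 2 - Const hbar dvd subst Var ?F - subst (Var(1 := - Var 2 + Const hbar)) ?F"
    by (rule dvd_subst_diff) (simp add: algebra_simps)
  moreover have "subst (Var(1 := - Var 2 + Const hbar)) ?F = f_pol \<tau> R p (Var 2)"
    using assms by (auto simp: f_pol_def subst_mult subst_p_pol subst_simps tau_tau mult.commute)
  ultimately show ?thesis by simp
qed

text \<open>The cases are those of the right mirror. For \<tau> p = q the divided difference sits
  between two reflections, which turn its denominator into X_1 + X_2 - hbar. The prefactors meet
  different arguments in the two products and combine to the values of f_q at X_1 and of f_p at
  X_2.\<close>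

lemma cross_op_refl_left_braid:
  defines "\<rho> \<equiv> refl_left_pol" and "P \<equiv> \<lambda>q. p_pol R q (Var 1)" and "C \<equiv> cross_op (Suc 0)"
  assumes pq: "p \<in> verts Q" "q \<in> verts Q"
  shows "C (\<tau> q) (\<tau> p) (P (\<tau> q) * \<rho> (C (\<tau> p) q (P (\<tau> p) * \<rho> g)))
      - P (\<tau> p) * \<rho> (C (\<tau> q) p (P (\<tau> q) * \<rho> (C p q g)))
    = (if \<tau> p = q then exact_quot (f_pol \<tau> R q (Var 1) - f_pol \<tau> R p (Var 2))
        (Var 1 + Var 2 - Const hbar) * C p q g else 0)" (is "?L1 - ?L2 = ?r")
proof -
  let ?x = "Var (Suc 0)" and ?y = "Var (Suc (Suc 0))" and ?h = "Const hbar"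
  let ?s = "swap_pol (Suc 0)"
  have qp: "\<tau> q = p \<longleftrightarrow> \<tau> p = q" "\<tau> q = \<tau> p \<longleftrightarrow> p = q" using pq by (auto simp: tau_tau tau_eq_iff)
  consider "p = q" "\<tau> p \<noteq> q" | "\<tau> p = q" "p \<noteq> q" | "p \<noteq> q" "\<tau> p \<noteq> q"
    using no_fixed_vertex pq by metis
  then show ?thesis
  proof cases
    case 1
    let ?c = "p_pol R (\<tau> p) ?x * p_pol R (\<tau> p) ?y * X_bar Q (\<tau> p) p ?y (- ?x + ?h)"
    have "X_bar Q (\<tau> p) p ?x (- ?y + ?h) = X_bar Q (\<tau> p) p ?y (- ?x + ?h)"
      by (rule X_bar_diff) simp
    then have c: "swap_pol (Suc 0) ?c = ?c" by (simp add: mult_ac)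
    have "?L1 = demazure (Suc 0) (?c * \<rho> (?s (\<rho> g)))"
      using 1 by (simp add: C_def P_def \<rho>_def cross_op_def mult_ac)
    also have "\<dots> = ?L2"
      using 1 demazure_refl_left_conj[of g]
      unfolding demazure_scale[OF c] by (simp add: C_def P_def \<rho>_def cross_op_def mult_ac)
    finally show ?thesis using 1 by simp
  next
    case 2
    then have tq: "\<tau> q = p" using qp by simp
    let ?d = "?x + ?y - ?h" and ?A = "X_bar Q p q ?y ?x"
    let ?P = "p_pol R"
    have D: "(?y - ?x) * demazure (Suc 0) h = ?s h - h" for h
      using demazure_mult[of "Suc 0" h] by simp
    have L: "?d * \<rho> (demazure (Suc 0) h) = \<rho> (?s h) - \<rho> h" for h
      using arg_cong[OF D, of \<rho> h] by (simp add: \<rho>_def algebra_simps)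
    have SL: "?d * ?s (\<rho> (demazure (Suc 0) h)) = ?s (\<rho> (?s h)) - ?s (\<rho> h)" for h
      using arg_cong[OF L, of ?s h] by (simp add: add.commute)
    have A: "X_bar Q p q (?h - ?x) (?h - ?y) = ?A"
      by (rule X_bar_diff) simp
    have L1: "?d * ?L1 = ?A * ?P p ?y * (?P q ?x * ?s (\<rho> (?s (\<rho> g))) - ?P q (- ?y + ?h) * ?s g)"
      using 2 tq SL[of "?P q ?x * \<rho> g"]
      by (simp add: C_def P_def cross_op_def mult_ac) (simp add: \<rho>_def)
    have L2: "?d * ?L2 = ?P q ?x * ?A * (?P p ?y * ?s (\<rho> (?s (\<rho> g))) - ?P p (- ?x + ?h) * ?s g)"
      using 2 tq L[of "?P p ?x * \<rho> (?s (X_bar Q p q ?x ?y * g))"]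
      by (simp add: C_def P_def cross_op_def mult_ac A) (simp add: \<rho>_def A refl_left_pol_braid algebra_simps)
    have "?d \<noteq> 0"
    proof
      assume "?d = 0"
      \<comment> \<open>At X_1 = hbar + 1, X_2 = 0 the denominator takes the value 1.\<close>
      then have "subst (Var(Suc 0 := ?h + 1, Suc (Suc 0) := 0)) ?d = 0" by (simp only: subst_0)
      then show False by (simp add: subst_simps)
    qed
    moreover have "?d * ?r = (?P q ?x * ?P p (- ?x + ?h) - ?P p ?y * ?P q (- ?y + ?h)) * (?A * ?s g)"
      using 2 tq exact_quot_mult[OF _ f_pol_dvd[of q p]] pq \<open>?d \<noteq> 0\<close>
      by (simp add: f_pol_def C_def cross_op_def numeral_2_eq_2 flip: mult.assoc)
    ultimately have "?d * (?L1 - ?L2) = ?d * ?r"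
      unfolding right_diff_distrib L1 L2 by (simp add: algebra_simps)
    then show ?thesis using \<open>?d \<noteq> 0\<close> by simp
  next
    case 3
    have "X_bar Q (\<tau> q) (\<tau> p) ?y ?x = X_bar Q p q (- ?x + ?h) (- ?y + ?h)"
      "X_bar Q (\<tau> p) q ?x (- ?y + ?h) = X_bar Q (\<tau> q) p ?y (- ?x + ?h)"
      by (rule X_bar_tau X_bar_tau_left; use pq in simp)+
    with 3 qp show ?thesis
      by (simp add: C_def P_def cross_op_def \<rho>_def refl_left_pol_braid mult_ac)
  qed
qed


section \<open>The defining relations in the free algebra\<close>

lemma refl_left_refl_left: "i \<noteq> [] \<Longrightarrow> i \<in> words \<Longrightarrow> refl_left \<tau> (refl_left \<tau> i) = i"
  by (simp add: refl_left_def tau_tau)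

lemma refl_right_refl_right: "i \<noteq> [] \<Longrightarrow> i \<in> words \<Longrightarrow> refl_right \<tau> (refl_right \<tau> i) = i"
  by (simp add: refl_right_def tau_tau)

text \<open>Membership is included so that a single induction over \<open>rel\<close> shows both
  that the relators lie in the free ring and that they act by zero.\<close>

definition holds :: "'q gen free_alg \<Rightarrow> 'q gen free_alg \<Rightarrow> bool" where
  "holds x y \<longleftrightarrow> x \<in> carrier FR \<and> y \<in> carrier FR \<and> (\<forall>v\<in>Pol Q. alg_op x v = alg_op y v)"

lemma holds_diag:
  assumes "i \<in> words" "seq_fits ds (length i)" "seq_fits ds' (length i)"
    and "tgt ds i = tgt ds' i"
    and "\<And>g. seq_op ds i g = seq_op ds' i g"
  shows "holds (dia ds i) (dia ds' i)"
  using assms by (simp add: holds_def alg_op_diag)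

lemma f_bar_Pol: "1 \<le> k \<Longrightarrow> 1 \<le> l \<Longrightarrow> k \<le> length i \<Longrightarrow> l \<le> length i \<Longrightarrow> f_bar Q p q (Var k) (Var l) \<in> Pol_word i"
  by (auto simp: f_bar_def X_bar_def Pol_word_eq)

lemma f_pol_Pol: "1 \<le> k \<Longrightarrow> k \<le> length i \<Longrightarrow> f_pol \<tau> R p (Var k) \<in> Pol_word i"
  by (auto simp: f_pol_def Pol_word_eq intro!: vars_in_mult p_pol_vars_in)

lemma holds_far:
  assumes "i \<in> words"
  shows cross_cross_holds: "\<lbrakk>Suc a < b; Suc b < length i\<rbrakk> \<Longrightarrow>
      holds (dia [Cross (Suc b), Cross (Suc a)] i) (dia [Cross (Suc a), Cross (Suc b)] i)"
    and cross_left_holds: "\<lbrakk>0 < a; Suc a < length i\<rbrakk> \<Longrightarrow>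
      holds (dia [Refl_L, Cross (Suc a)] i) (dia [Cross (Suc a), Refl_L] i)"
    and cross_right_holds: "\<lbrakk>length i = Suc b; Suc a < b\<rbrakk> \<Longrightarrow>
      holds (dia [Refl_R, Cross (Suc a)] i) (dia [Cross (Suc a), Refl_R] i)"
    and left_right_holds: "length i = Suc (Suc b) \<Longrightarrow>
      holds (dia [Refl_L, Refl_R] i) (dia [Refl_R, Refl_L] i)"
proof -
  assume "Suc a < b" "Suc b < length i"
  with assms cross_op_far[of "Suc a" "Suc b", symmetric]
  show "holds (dia [Cross (Suc b), Cross (Suc a)] i) (dia [Cross (Suc a), Cross (Suc b)] i)"
    by (intro holds_diag) (simp_all add: swap_far)
next
  assume a: "0 < a" "Suc a < length i"
  then have "i \<noteq> []" by auto
  with a assms cross_op_refl_left[of "Suc a" "p_pol R (\<tau> (i ! 0)) (Var (Suc 0))"]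
    p_pol_vars_in[of "Var (Suc 0)" "{Suc 0}"]
  show "holds (dia [Refl_L, Cross (Suc a)] i) (dia [Cross (Suc a), Refl_L] i)"
    by (intro holds_diag) (simp_all add: refl_left_swap)
next
  assume "length i = Suc b" "Suc a < b"
  with assms show "holds (dia [Refl_R, Cross (Suc a)] i) (dia [Cross (Suc a), Refl_R] i)"
    by (intro holds_diag) (simp_all add: refl_right_swap cross_op_refl_right)
next
  assume b: "length i = Suc (Suc b)"
  then have "i \<noteq> []" by auto
  with assms b show "holds (dia [Refl_L, Refl_R] i) (dia [Refl_R, Refl_L] i)"
    by (intro holds_diag) (simp_all add: refl_left_right refl_left_right_pol)
qed

lemma cross_dot_holds:
  assumes "i \<in> words" "Suc n < length i"
  shows "holds (dia [Dot (Suc n), Cross (Suc n)] i)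
      (dia [Cross (Suc n), Dot (Suc (Suc n))] i + (if i ! n = i ! Suc n then dia [] i else 0))"
    and "holds (dia [Cross (Suc n), Dot (Suc n)] i)
      (dia [Dot (Suc (Suc n)), Cross (Suc n)] i + (if i ! n = i ! Suc n then dia [] i else 0))"
proof -
  have "swap (Suc n) i = i" if "i ! n = i ! Suc n"
    using that by (metis swap_def diff_Suc_1 list_update_id)
  moreover have "dia [Dot (Suc n), Cross (Suc n)] i \<in> carrier FR"
    "dia [Cross (Suc n), Dot (Suc n)] i \<in> carrier FR"
    "dia [Cross (Suc n), Dot (Suc (Suc n))] i \<in> carrier FR"
    "dia [Dot (Suc (Suc n)), Cross (Suc n)] i \<in> carrier FR" "dia [] i \<in> carrier FR"
    using assms by (intro diag_carrier; auto)+
  ultimately show "holds (dia [Dot (Suc n), Cross (Suc n)] i)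
      (dia [Cross (Suc n), Dot (Suc (Suc n))] i + (if i ! n = i ! Suc n then dia [] i else 0))"
    and "holds (dia [Cross (Suc n), Dot (Suc n)] i)
      (dia [Dot (Suc (Suc n)), Cross (Suc n)] i + (if i ! n = i ! Suc n then dia [] i else 0))"
    using assms
    by (auto simp: holds_def alg_op_diag alg_op_add cross_op_dot single_add simp del: diag.simps)
qed

lemma cross_squared_holds:
  assumes "i \<in> words" "Suc n < length i"
  shows "holds (dia [Cross (Suc n), Cross (Suc n)] i)
      (if i ! n = i ! Suc n then 0 else dots i (f_bar Q (i ! n) (i ! Suc n) (Var (Suc n)) (Var (Suc (Suc n)))))"
  using assms
  by (auto simp: holds_def alg_op_diag alg_op_dots f_bar_Pol cross_op_squared simp del: diag.simps)

lemma braid_holds: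
  fixes n :: nat
  defines "k \<equiv> Suc n"
  assumes "i \<in> words" "Suc k < length i"
  shows "holds
      (dia [Cross k, Cross (Suc k), Cross k] i - dia [Cross (Suc k), Cross k, Cross (Suc k)] i)
      (if i ! n = i ! Suc k \<and> i ! n \<noteq> i ! k
       then dots i (exact_quot
         (f_bar Q (i ! n) (i ! k) (Var (k + 2)) (Var (k + 1)) - f_bar Q (i ! n) (i ! k) (Var k) (Var (k + 1)))
         (Var (k + 2) - Var k)) else 0)"
proof -
  let ?L = "dia [Cross k, Cross (Suc k), Cross k] i - dia [Cross (Suc k), Cross k, Cross (Suc k)] i"
  let ?F = "exact_quot (f_bar Q (i ! n) (i ! k) (Var (k + 2)) (Var (k + 1))
      - f_bar Q (i ! n) (i ! k) (Var k) (Var (k + 1))) (Var (k + 2) - Var k)"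
  have F: "?F \<in> Pol_word i"
    using assms f_bar_Pol[of "k + 2" "k + 1" i] f_bar_Pol[of k "k + 1" i] unfolding Pol_word_eq
    by (intro exact_quot_vars_in f_bar_dvd) auto
  have "alg_op ?L v = single (tgt [Cross k, Cross (Suc k), Cross k] i)
      (cross_op k (i ! k) (i ! Suc k) (cross_op (Suc k) (i ! n) (i ! Suc k) (cross_op k (i ! n) (i ! k) (lookup v i)))
      - cross_op (Suc k) (i ! n) (i ! k) (cross_op k (i ! n) (i ! Suc k) (cross_op (Suc k) (i ! k) (i ! Suc k) (lookup v i))))" for v
    using assms by (simp add: alg_op_diff alg_op_diag swap_braid single_diff del: diag.simps)
  then have L: "alg_op ?L v = single (tgt [Cross k, Cross (Suc k), Cross k] i)
      (if i ! n = i ! Suc k \<and> i ! n \<noteq> i ! k then ?F * lookup v i else 0)" for v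
    unfolding cross_op_braid by simp
  \<comment> \<open>The triple crossing exchanges the outer two labels, so it preserves the word
    when they agree. The remainder occurs only then, and \<open>dots i\<close> has it end at the
    word i.\<close>
  have T: "tgt [Cross k, Cross (Suc k), Cross k] i = i" if "i ! n = i ! Suc k"
    using that assms by (intro nth_equalityI) auto
  have "?L \<in> carrier FR"
    using assms by (intro free_carrier_diff diag_carrier) auto
  with F T show ?thesis using assms(2)
    by (auto simp: holds_def L alg_op_dots simp del: diag.simps targets.simps)
qed

lemma right_holds:
  assumes "i \<in> words" "i \<noteq> []"
  shows right_squared_holds: "holds (dia [Refl_R, Refl_R] i) (dia [] i)"
    and right_dot_holds: "holds (dia [Refl_R, Dot (length i)] i) (- dia [Dot (length i), Refl_R] i)"
proof -
  have i: "Suc 0 \<le> length i" using assms by (cases i) auto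
  show "holds (dia [Refl_R, Refl_R] i) (dia [] i)"
    using assms i by (intro holds_diag) (auto simp: refl_right_refl_right)
  have "- dia [Dot (length i), Refl_R] i \<in> carrier FR"
    using assms i by (simp only: free_carrier_simps(5)) (intro diag_carrier, auto)
  then show "holds (dia [Refl_R, Dot (length i)] i) (- dia [Dot (length i), Refl_R] i)"
    using assms i
    by (auto simp: holds_def alg_op_diag alg_op_uminus single_uminus simp del: diag.simps)
qed

lemma right_braid_holds:
  assumes "i \<in> words" "length i = Suc (Suc n)"
  shows "holds (dia [Cross (Suc n), Refl_R, Cross (Suc n), Refl_R] i)
      (dia [Refl_R, Cross (Suc n), Refl_R, Cross (Suc n)] i)"
proof -
  have "i ! n \<in> verts Q" "i ! Suc n \<in> verts Q" using assms by simp_all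
  from cross_op_refl_right_braid[OF this, of "Suc n"] assms show ?thesis
    by (intro holds_diag) (simp_all add: refl_right_braid)
qed

lemma left_holds:
  assumes "i \<in> words" "i \<noteq> []"
  shows left_squared_holds: "holds (dia [Refl_L, Refl_L] i) (dots i (f_pol \<tau> R (i ! 0) (Var 1)))"
    and left_dot_holds: "holds (dia [Refl_L, Dot 1] i)
      (- dia [Dot 1, Refl_L] i + free_const hbar * dia [Refl_L] i)"
proof -
  have i: "Suc 0 \<le> length i" "i ! 0 \<in> verts Q" using assms by (cases i; auto)+
  show "holds (dia [Refl_L, Refl_L] i) (dots i (f_pol \<tau> R (i ! 0) (Var 1)))"
    using assms i f_pol_Pol[of 1 i "i ! 0"]
    by (auto simp: holds_def alg_op_diag alg_op_dots refl_left_refl_left tau_tau f_pol_def mult_ac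
        simp del: diag.simps)
  have "- dia [Dot 1, Refl_L] i + free_const hbar * dia [Refl_L] i \<in> carrier FR"
    using assms i
    by (intro free_carrier_simps(3,4,6) free_carrier_simps(5)[THEN iffD2] diag_carrier) auto
  moreover have "alg_op (dia [Refl_L, Dot 1] i) v
      = alg_op (- dia [Dot 1, Refl_L] i + free_const hbar * dia [Refl_L] i) v" for v
    by (simp add: alg_op_diag alg_op_uminus alg_op_add alg_op_diff alg_op_mult[of "free_const _"] alg_op_const
        pol_scale_single algebra_simps single_diff del: diag.simps)
  ultimately show "holds (dia [Refl_L, Dot 1] i)
      (- dia [Dot 1, Refl_L] i + free_const hbar * dia [Refl_L] i)"
    using assms i by (auto simp: holds_def simp del: diag.simps intro!: diag_carrier)
qed

lemma left_braid_holds: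
  assumes "i \<in> words" "length i = Suc (Suc n)"
  shows "holds
      (dia [Cross 1, Refl_L, Cross 1, Refl_L] i - dia [Refl_L, Cross 1, Refl_L, Cross 1] i)
      (if \<tau> (i ! 0) = i ! 1
       then dots (swap 1 i) (exact_quot
           (f_pol \<tau> R (i ! 1) (Var 1) - f_pol \<tau> R (i ! 0) (Var 2))
           (Var 1 + Var 2 - Const hbar)) * dia [Cross 1] i
       else 0)"
proof -
  have v: "i ! 0 \<in> verts Q" "i ! Suc 0 \<in> verts Q" and ne: "i \<noteq> []" using assms by auto
  let ?F = "exact_quot (f_pol \<tau> R (i ! 1) (Var 1) - f_pol \<tau> R (i ! 0) (Var 2)) (Var 1 + Var 2 - Const hbar)"
  have F: "?F \<in> Pol_word (swap 1 i)" if "\<tau> (i ! 0) = i ! 1"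
  proof -
    have "Var 1 + Var 2 - Const hbar \<noteq> 0"
    proof
      assume "Var 1 + Var 2 - Const hbar = 0"
      then have "subst (Var(1 := Const hbar + 1, 2 := 0)) (Var 1 + Var 2 - Const hbar) = 0"
        by (simp only: subst_0)
      then show False by (simp add: subst_simps)
    qed
    then show ?thesis
      using assms f_pol_Pol[of 1 i "i ! 1"] f_pol_Pol[of 2 i "i ! 0"] v that unfolding Pol_word_eq
      by (intro exact_quot_vars_in f_pol_dvd) auto
  qed
  let ?L = "dia [Cross 1, Refl_L, Cross 1, Refl_L] i - dia [Refl_L, Cross 1, Refl_L, Cross 1] i"
  have L: "alg_op ?L v = single (tgt [Cross 1, Refl_L, Cross 1, Refl_L] i)
      (if \<tau> (i ! 0) = i ! 1 then ?F * cross_op (Suc 0) (i ! 0) (i ! Suc 0) (lookup v i) else 0)" for v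
    using assms ne arg_cong[OF cross_op_refl_left_braid[OF v, of "lookup v i"],
        of "single (tgt [Cross 1, Refl_L, Cross 1, Refl_L] i)"]
    by (simp add: alg_op_diff alg_op_diag refl_left_braid tau_tau v single_diff del: diag.simps
        flip: length_0_conv)
  \<comment> \<open>The four letters lead from (i_1, i_2) to (\<tau> i_1, \<tau> i_2); for \<tau>
    i_1 = i_2 this is the exchange of the two labels.\<close>
  have T: "tgt [Cross 1, Refl_L, Cross 1, Refl_L] i = swap 1 i" if "\<tau> (i ! 0) = i ! 1"
    using that assms ne v tau_tau[of "i ! 0"]
    by (intro nth_equalityI) (auto simp flip: length_0_conv)
  have "?L \<in> carrier FR" "dia [Cross 1] i \<in> carrier FR" "swap 1 i \<in> words"
    using assms target_words[of i "Cross 1"] by (auto intro!: free_carrier_diff diag_carrier simp del: diag.simps)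
  moreover have "alg_op ?L v = single (swap 1 i)
      (if \<tau> (i ! 0) = i ! 1 then ?F * cross_op (Suc 0) (i ! 0) (i ! Suc 0) (lookup v i) else 0)" for v
    using L[of v] T by auto
  ultimately show ?thesis unfolding holds_def using F
    by (auto simp: alg_op_mult alg_op_dots alg_op_diag simp del: diag.simps simp flip: One_nat_def)
qed

lemma rel_holds: "rel Q \<tau> R x y \<Longrightarrow> holds x y"
proof (induction rule: rel.induct)
  case (idem i j)
  then show ?case by (auto simp: holds_def alg_op_mult alg_op_gen lookup_single when_def)
next
  case (idem_left i d)
  then show ?case by (auto simp: holds_def alg_op_mult alg_op_gen)
next
  case (idem_right i d)
  then show ?case by (auto simp: holds_def alg_op_mult alg_op_gen)
next
  case (dot_dot i m k l)
  then show ?case by (intro holds_diag) (auto simp: mult_ac)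
next
  case (cross_cross_far i m k l)
  then show ?case using cross_cross_holds[of i "k - 1" "l - 1"] cross_cross_holds[of i "l - 1" "k - 1"]
    by (auto simp: holds_def simp del: diag.simps)
next
  case (cross_dot_far i m k l)
  then show ?case by (intro holds_diag) (auto simp: cross_op_scale)
next
  case (left_dot_far i m l)
  then show ?case by (intro holds_diag) (auto simp: mult_ac)
next
  case (left_cross_far i m l)
  then show ?case using cross_left_holds[of i "l - 1"] by (simp del: diag.simps)
next
  case (right_dot_far i m l)
  then show ?case by (intro holds_diag) (auto simp: mult_ac)
next
  case (right_cross_far i m l)
  then show ?case using cross_right_holds[of i "m - 1" "l - 1"] by (simp del: diag.simps)
next
  case (left_right i m)
  then show ?case using left_right_holds[of i "m - 2"] by (simp del: diag.simps)
next
  case (dot_cross i m k)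
  then show ?case using cross_dot_holds(1)[of i "k - 1"] by (simp del: diag.simps)
next
  case (cross_dot i m k)
  then show ?case using cross_dot_holds(2)[of i "k - 1"] by (simp del: diag.simps)
next
  case (cross_squared i m k)
  then obtain n where n: "k = Suc n" by (cases k) auto
  show ?case unfolding n diff_Suc_1 using cross_squared n by (intro cross_squared_holds) simp_all
next
  case (braid i m k)
  then obtain n where n: "k = Suc n" by (cases k) auto
  show ?case unfolding n diff_Suc_1 using braid n by (intro braid_holds) simp_all
next
  case (right_squared i m)
  then show ?case using right_squared_holds[of i] by (cases i) (auto simp del: diag.simps)
next
  case (right_dot i m)
  then show ?case using right_dot_holds[of i] by (cases i) (auto simp del: diag.simps)
next
  case (right_braid i m)
  then have "length i = Suc (Suc (m - 2))" "m - 1 = Suc (m - 2)" by simp_all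
  then show ?case using right_braid_holds[of i "m - 2"] right_braid(1) by metis
next
  case (left_squared i m)
  then show ?case using left_squared_holds[of i] by (cases i) (auto simp del: diag.simps)
next
  case (left_dot i m)
  then show ?case using left_dot_holds[of i] by (cases i) (auto simp del: diag.simps)
next
  case (left_braid i m)
  moreover from this have "length i = Suc (Suc (m - 2))" by simp
  ultimately show ?case using left_braid_holds[of i "m - 2"] by metis
qed

lemma relators_carrier: "relators Q \<tau> R \<subseteq> carrier FR"
  using rel_holds by (auto simp: relators_def holds_def)

lemma rel_ideal_subset: "rel_ideal Q \<tau> R \<subseteq> op_kernel"
  unfolding rel_ideal_def
proof (rule ring.genideal_minimal[OF ring_free_ring ideal_op_kernel])
  show "relators Q \<tau> R \<subseteq> op_kernel"
    using rel_holds by (auto simp: relators_def holds_def op_kernel_def alg_op_diff)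
qed

end

section \<open>Spanning sets modulo the relations\<close>

definition is_dot :: "elem_diag \<Rightarrow> bool" where
  "is_dot d \<longleftrightarrow> d \<in> range Dot"

lemma is_dot_simps [simp]: "is_dot (Dot k)" "\<not> is_dot (Cross k)" "\<not> is_dot Refl_L" "\<not> is_dot Refl_R"
  by (auto simp: is_dot_def)

definition dotless :: "nat \<Rightarrow> elem_diag list \<Rightarrow> bool" where
  "dotless m ds \<longleftrightarrow> (\<forall>d\<in>set ds. fits d m \<and> \<not> is_dot d)"

lemma dotless_simps [simp]:
  "dotless m []" "dotless m (d # ds) \<longleftrightarrow> fits d m \<and> \<not> is_dot d \<and> dotless m ds"
  "dotless m (ds @ ds') \<longleftrightarrow> dotless m ds \<and> dotless m ds'"
  by (auto simp: dotless_def)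

lemma dotless_fits: "dotless m ds \<Longrightarrow> \<forall>d\<in>set ds. fits d m"
  by (simp add: dotless_def)

context iyangian_data
begin

declare in_listsD [rule del] in_listsI [rule del]

section \<open>Congruence modulo the relations\<close>

abbreviation "I \<equiv> rel_ideal Q \<tau> R"

lemma ideal_I: "ideal I FR"
  unfolding rel_ideal_def by (rule ring.genideal_ideal[OF ring_free_ring relators_carrier])

lemma I_carrier: "x \<in> I \<Longrightarrow> x \<in> carrier FR"
  using rel_ideal_subset by (auto simp: op_kernel_def)

lemma I_0 [simp]: "0 \<in> I"
  using additive_subgroup.zero_closed[OF ideal.axioms(1)[OF ideal_I]] by simp

lemma I_add [simp]: "x \<in> I \<Longrightarrow> y \<in> I \<Longrightarrow> x + y \<in> I"
  using additive_subgroup.a_closed[OF ideal.axioms(1)[OF ideal_I]] by simp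

lemma I_mult_left: "x \<in> I \<Longrightarrow> a \<in> carrier FR \<Longrightarrow> a * x \<in> I"
  using ideal.I_l_closed[OF ideal_I] by simp

lemma I_mult_right: "x \<in> I \<Longrightarrow> a \<in> carrier FR \<Longrightarrow> x * a \<in> I"
  using ideal.I_r_closed[OF ideal_I] by simp

lemma I_uminus [simp]: "x \<in> I \<Longrightarrow> - x \<in> I"
  using I_mult_left[of x "- 1"] by simp

text \<open>Equality in the quotient, with membership of both sides built in so that congruences can
  be added and multiplied without side conditions.\<close>

definition eqv :: "'q gen free_alg \<Rightarrow> 'q gen free_alg \<Rightarrow> bool" (infix "\<approx>" 50) where
  "x \<approx> y \<longleftrightarrow> x \<in> carrier FR \<and> y \<in> carrier FR \<and> x - y \<in> I"

lemma eqv_refl [simp]: "x \<approx> x \<longleftrightarrow> x \<in> carrier FR"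
  by (simp add: eqv_def)

lemma eqv_sym: "x \<approx> y \<Longrightarrow> y \<approx> x"
  using I_uminus[of "x - y"] by (simp add: eqv_def)

lemma eqv_commute: "x \<approx> y \<longleftrightarrow> y \<approx> x"
  using eqv_sym by blast

lemma eqv_trans [trans]: "x \<approx> y \<Longrightarrow> y \<approx> z \<Longrightarrow> x \<approx> z"
  using I_add[of "x - y" "y - z"] by (simp add: eqv_def)

lemma eqv_add: "x \<approx> y \<Longrightarrow> x' \<approx> y' \<Longrightarrow> x + x' \<approx> y + y'"
  using I_add[of "x - y" "x' - y'"] by (simp add: eqv_def algebra_simps)

lemma eqv_uminus: "x \<approx> y \<Longrightarrow> - x \<approx> - y"
  using I_uminus[of "x - y"] by (simp add: eqv_def)

lemma eqv_diff: "x \<approx> y \<Longrightarrow> x' \<approx> y' \<Longrightarrow> x - x' \<approx> y - y'"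
  using eqv_add[of x y "- x'" "- y'"] eqv_uminus by simp

lemma eqv_mult: "x \<approx> y \<Longrightarrow> x' \<approx> y' \<Longrightarrow> x * x' \<approx> y * y'"
  using I_add[OF I_mult_right[of "x - y" x'] I_mult_left[of "x' - y'" y]]
  by (simp add: eqv_def algebra_simps)

lemma eqv_mult_left: "x \<approx> y \<Longrightarrow> a \<in> carrier FR \<Longrightarrow> a * x \<approx> a * y"
  by (rule eqv_mult) simp_all

lemma eqv_mult_right: "x \<approx> y \<Longrightarrow> a \<in> carrier FR \<Longrightarrow> x * a \<approx> y * a"
  by (rule eqv_mult) simp_all

lemma eqv_carrier: "x \<approx> y \<Longrightarrow> x \<in> carrier FR \<and> y \<in> carrier FR"
  by (simp add: eqv_def)

lemma rel_eqv: "rel Q \<tau> R x y \<Longrightarrow> x \<approx> y"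
  using ring.genideal_self[OF ring_free_ring relators_carrier] rel_holds[of x y]
  by (auto simp: eqv_def holds_def rel_ideal_def relators_def)

lemma eqv_0_iff: "x \<approx> 0 \<longleftrightarrow> x \<in> I"
  using I_carrier by (auto simp: eqv_def)

section \<open>Composable and mismatched products of diagrams\<close>

lemma Ident_diag:
  assumes "i \<in> words" "seq_fits ds (length i)"
  shows "free_gen (Ident (tgt ds i)) * dia ds i \<approx> dia ds i"
proof (cases ds)
  case Nil
  then show ?thesis using assms rel_eqv[OF rel.idem[of i Q i \<tau> R]] by simp
next
  case (Cons d ds')
  then have "free_gen (Ident (target \<tau> d (tgt ds' i))) * free_gen (Gen d (tgt ds' i))
      \<approx> free_gen (Gen d (tgt ds' i))"
    using assms by (intro rel_eqv rel.idem_left) simp_all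
  from eqv_mult_right[OF this, of "dia ds' i"] show ?thesis
    using assms Cons by (simp add: mult.assoc)
qed

lemma Ident_diag_neq:
  assumes "i \<in> words" "seq_fits ds (length i)" "j \<in> words" "j \<noteq> tgt ds i"
  shows "free_gen (Ident j) * dia ds i \<approx> 0"
proof -
  have t: "tgt ds i \<in> words" using assms by simp
  have "free_gen (Ident j) * dia ds i
      \<approx> free_gen (Ident j) * (free_gen (Ident (tgt ds i)) * dia ds i)"
    using assms by (intro eqv_mult_left eqv_sym[OF Ident_diag]) simp_all
  also have "\<dots> \<approx> 0 * dia ds i"
    using eqv_mult_right[OF rel_eqv[OF rel.idem[of j Q "tgt ds i" \<tau> R]], of "dia ds i"] assms t
    by (simp add: mult.assoc)
  finally show ?thesis by simp
qed

lemma Gen_diag_neq: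
  assumes "i \<in> words" "seq_fits ds (length i)" "j \<in> words" "fits d (length j)" "j \<noteq> tgt ds i"
  shows "free_gen (Gen d j) * dia ds i \<approx> 0"
proof -
  have "free_gen (Gen d j) * dia ds i \<approx> (free_gen (Gen d j) * free_gen (Ident j)) * dia ds i"
    using assms by (intro eqv_mult_right[OF eqv_sym[OF rel_eqv[OF rel.idem_right]]]) simp_all
  also have "\<dots> \<approx> free_gen (Gen d j) * 0"
    unfolding mult.assoc using assms by (intro eqv_mult_left Ident_diag_neq) simp_all
  finally show ?thesis by simp
qed

text \<open>The idempotent that ends the left diagram is absorbed by the right one.\<close>

lemma diag_append:
  assumes "i \<in> words" "seq_fits ds (length i)" "seq_fits ds' (length i)"
  shows "dia ds (tgt ds' i) * dia ds' i \<approx> dia (ds @ ds') i"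
  using assms(2)
proof (induction ds)
  case Nil
  then show ?case using Ident_diag assms by simp
next
  case (Cons d ds)
  have t: "tgt (ds @ ds') i = tgt ds (tgt ds' i)" for ds
    by (induction ds) simp_all
  from Cons show ?case using assms
    by (simp add: mult.assoc t eqv_mult_left)
qed

lemma targets_append: "tgt (ds @ ds') i = tgt ds (tgt ds' i)"
  by (induction ds) simp_all

section \<open>Polynomials in the dots\<close>

lemma Dots_perm:
  assumes "i \<in> words" "mset ds = mset ds'" "set ds \<subseteq> Dot ` {1..length i}"
  shows "dia ds i \<approx> dia ds' i"
proof -
  have fit: "seq_fits ds (length i)" if "set ds \<subseteq> Dot ` {1..length i}" for ds
    using that by auto
  have t: "tgt ds i = i" if "set ds \<subseteq> Dot ` {1..length i}" for ds
    using that by (intro diag_id_Dots[THEN conjunct2, THEN conjunct2]) auto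
  have swap: "dia (ys @ d # zs) i \<approx> dia (d # ys @ zs) i"
    if "set (ys @ d # zs) \<subseteq> Dot ` {1..length i}" for ys d zs
    using that
  proof (induction ys)
    case Nil
    then have "seq_fits (d # zs) (length i)" by (intro fit) simp
    then show ?case using assms(1) by (simp del: diag.simps)
  next
    case (Cons y ys)
    then obtain k l where kl: "y = Dot k" "d = Dot l" "1 \<le> k" "k \<le> length i" "1 \<le> l" "l \<le> length i"
      by auto
    have zs: "set (ys @ zs) \<subseteq> Dot ` {1..length i}" using Cons.prems by auto
    have c: "dia (ys @ zs) i \<in> carrier FR" by (rule diag_carrier[OF assms(1) fit[OF zs]])
    have "dia ((y # ys) @ d # zs) i = free_gen (Gen y i) * dia (ys @ d # zs) i"
      using t[of "ys @ d # zs"] Cons.prems by simp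
    also have "\<dots> \<approx> free_gen (Gen y i) * dia (d # ys @ zs) i"
      using Cons kl assms(1) by (intro eqv_mult_left) auto
    also have "free_gen (Gen y i) * dia (d # ys @ zs) i
        = free_gen (Gen y i) * (free_gen (Gen d i) * dia (ys @ zs) i)"
      using t[OF zs] by simp
    \<comment> \<open>The relation \<open>dot_dot\<close> compares products that end in e(i), so
      e(i) is inserted before the two dots are exchanged and absorbed afterwards.\<close>
    also have "\<dots> \<approx> free_gen (Gen y i) * (free_gen (Gen d i) * (free_gen (Ident i) * dia (ys @ zs) i))"
      using kl assms(1) c t[OF zs] fit[OF zs] Ident_diag[of i "ys @ zs"]
      by (intro eqv_mult_left eqv_sym[OF Ident_diag[of i "ys @ zs", unfolded t[OF zs]]]) auto
    also have "\<dots> \<approx> free_gen (Gen d i) * (free_gen (Gen y i) * (free_gen (Ident i) * dia (ys @ zs) i))"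
      using eqv_mult_right[OF rel_eqv[OF rel.dot_dot[of i Q "length i" k l \<tau> R]] c] kl assms(1)
      by (simp add: mult.assoc)
    also have "\<dots> \<approx> free_gen (Gen d i) * (free_gen (Gen y i) * dia (ys @ zs) i)"
      using kl assms(1) c t[OF zs] fit[OF zs]
      by (intro eqv_mult_left Ident_diag[of i "ys @ zs", unfolded t[OF zs]]) auto
    also have "\<dots> = dia (d # (y # ys) @ zs) i"
      using t[OF zs] kl by simp
    finally show ?case .
  qed
  show ?thesis using assms(2,3)
  proof (induction ds arbitrary: ds')
    case Nil
    then show ?case using assms(1) by simp
  next
    case (Cons d ds)
    then have "d \<in> set ds'" by (metis list.set_intros(1) set_mset_mset)
    then obtain ys zs where ds': "ds' = ys @ d # zs" by (meson split_list)
    have s: "set ds' \<subseteq> Dot ` {1..length i}" using Cons.prems by (metis set_mset_mset)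
    have *: "mset ds = mset (ys @ zs)" using Cons.prems(1) ds' by simp
    have "dia (d # ds) i = free_gen (Gen d i) * dia ds i"
      using t[of ds] Cons.prems by simp
    also have "\<dots> \<approx> free_gen (Gen d i) * dia (ys @ zs) i"
      using Cons.IH[OF *] Cons.prems assms(1) by (intro eqv_mult_left) auto
    also have "\<dots> = dia (d # ys @ zs) i" using t[of "ys @ zs"] s ds' by simp
    also have "\<dots> \<approx> dia ds' i" unfolding ds' using s ds' by (intro eqv_sym[OF swap]) simp
    finally show ?case .
  qed
qed

lemma mset_dot_seq: "mset (dot_seq m (a + b)) = mset (dot_seq m a @ dot_seq m b)"
proof -
  have "mset (concat (map (\<lambda>k. replicate (lookup (a + b) k) (Dot k)) ks))
      = mset (concat (map (\<lambda>k. replicate (lookup a k) (Dot k)) ks))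
      + mset (concat (map (\<lambda>k. replicate (lookup b k) (Dot k)) ks))" for ks
    by (induction ks) (simp_all add: lookup_add replicate_add)
  then show ?thesis by (simp add: dot_seq_def)
qed

lemma dots_0 [simp]: "dots i 0 = 0" for i :: "'q list"
  by (simp add: dots_eq)

lemma dots_add: "dots i (g + h) = dots i g + dots i h" for i :: "'q list"
  unfolding dots_eq by (rule setsum_keys_plus_distrib) (simp_all add: free_const_simps distrib_right)

lemma dots_uminus: "dots i (- g) = - dots i g" for i :: "'q list"
  using dots_add[of i g "- g"] by (simp add: eq_neg_iff_add_eq_0 add.commute)

lemma dots_single: "dots i (single a c) = free_const c * dia (dot_seq (length i) a) i" for i :: "'q list"
  by (simp add: dots_eq free_const_simps)

lemma dots_Const_mult: "dots i (Const c * g) = free_const c * dots i g" for i :: "'q list"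
proof (induction g rule: poly_mapping_single_induct)
  case (add a d g)
  have "Const c * single a d = single a (c * d)"
    by (simp add: Const_def mult_single)
  with add show ?case by (simp add: distrib_left dots_add dots_single free_const_simps mult.assoc)
qed simp

text \<open>A congruence rather than an equation, because the product of two ordered monomials still
  has to be sorted.\<close>

lemma dots_mult:
  assumes "i \<in> words"
  shows "dots i g * dots i h \<approx> dots i (g * h)"
proof (induction g rule: poly_mapping_single_induct)
  case zero
  then show ?case by simp
next
  case (add a c g)
  have "dots i (single a c) * dots i h \<approx> dots i (single a c * h)"
  proof (induction h rule: poly_mapping_single_induct)
    case zero
    then show ?case by simp
  next
    case (add b d h)
    have s: "set (dot_seq (length i) a @ dot_seq (length i) b) \<subseteq> Dot ` {1..length i}"
      using set_dot_seq[of "length i"] by auto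
    have "dia (dot_seq (length i) a) i * dia (dot_seq (length i) b) i
        \<approx> dia (dot_seq (length i) a @ dot_seq (length i) b) i"
      using diag_append[of i "dot_seq (length i) a" "dot_seq (length i) b"] assms by simp
    also have "\<dots> \<approx> dia (dot_seq (length i) (a + b)) i"
      using Dots_perm[OF assms _ s] by (simp add: mset_dot_seq)
    finally have "free_const (c * d) * (dia (dot_seq (length i) a) i * dia (dot_seq (length i) b) i)
        \<approx> free_const (c * d) * dia (dot_seq (length i) (a + b)) i"
      by (intro eqv_mult_left) simp_all
    moreover have "free_const (c * d) * (dia (dot_seq (length i) a) i * dia (dot_seq (length i) b) i)
        = dots i (single a c) * dots i (single b d)"
      using free_const_commute[of d "dia (dot_seq (length i) a) i"]
      by (simp add: dots_single free_const_simps mult.assoc) (simp flip: mult.assoc)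
    ultimately have "dots i (single a c) * dots i (single b d)
        \<approx> dots i (single a c * single b d)"
      by (simp add: dots_single mult_single)
    from eqv_add[OF this add(2)] show ?case by (simp add: distrib_left dots_add)
  qed
  from eqv_add[OF this add(2)] show ?case by (simp add: distrib_right dots_add)
qed

lemma dots_1: "dots i 1 = free_gen (Ident i)" for i :: "'q list"
proof -
  have "concat (map (\<lambda>k. []) ks) = []" for ks :: "nat list" by (induction ks) simp_all
  then have "dot_seq (length i) 0 = []" by (simp only: dot_seq_def lookup_zero replicate_0)
  then show ?thesis using dots_single[of i 0 1] by (simp add: free_const_simps)
qed

lemma dot_seq_Var:
  assumes "1 \<le> k" "k \<le> m"
  shows "dot_seq m (single k 1) = [Dot k]"
proof -
  have "concat (map (\<lambda>l. replicate (lookup (single k 1) l) (Dot l)) ls)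
      = replicate (count_list ls k) (Dot k)" for ls
    by (induction ls) (auto simp: lookup_single when_def)
  moreover have "count_list [1..<Suc m] k = 1"
  proof -
    have "count_list [1..<Suc m] k = count (mset [1..<Suc m]) k"
      by (simp only: count_mset count_list_eq_length_filter)
    moreover have "count (mset [1..<Suc m]) k = 1"
      using assms distinct_upt[of 1 "Suc m"] unfolding distinct_count_atmost_1 by simp
    ultimately show ?thesis by simp
  qed
  ultimately show ?thesis by (simp add: dot_seq_def)
qed

lemma dots_Var: "1 \<le> k \<Longrightarrow> k \<le> length i \<Longrightarrow> dots i (Var k) = dia [Dot k] i" for i :: "'q list"
  by (simp only: Var_def dots_single dot_seq_Var free_const_simps mult_1_left)


text \<open>The part of \<open>\<Y> e(i)\<close> with less than \<open>L\<close> crossings and reflections, lifted to the free algebra.\<close>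

inductive filt :: "'q list \<Rightarrow> nat \<Rightarrow> 'q gen free_alg \<Rightarrow> bool" for i L where
  ideal: "x \<in> I \<Longrightarrow> filt i L x"
| add: "filt i L x \<Longrightarrow> filt i L y \<Longrightarrow> filt i L (x + y)"
| normal: "dotless (length i) ds \<Longrightarrow> length ds < L \<Longrightarrow> g \<in> Pol_word i \<Longrightarrow> filt i L (dia ds i * dots i g)"

lemma filt_0 [simp]: "filt i L 0"
  by (simp add: filt.ideal)

lemma filt_eqv: "x \<approx> y \<Longrightarrow> filt i L y \<Longrightarrow> filt i L x"
  using filt.add[OF filt.ideal[of "x - y" i L], of y] by (simp add: eqv_def)

lemma filt_uminus: "filt i L x \<Longrightarrow> filt i L (- x)"
proof (induction rule: filt.induct)
  case (add x y)
  then show ?case using filt.add[of i L "- x" "- y"] by (simp add: add.commute)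
next
  case (normal ds g)
  then show ?case using filt.normal[of i ds L "- g"] by (simp add: dots_uminus Pol_word_eq)
qed (simp add: filt.ideal)

lemma filt_mono: "filt i L x \<Longrightarrow> L \<le> L' \<Longrightarrow> filt i L' x"
  by (induction rule: filt.induct) (auto intro: filt.intros)

lemma filt_sum: "(\<And>a. a \<in> A \<Longrightarrow> filt i L (f a)) \<Longrightarrow> filt i L (sum f A)"
  by (induction A rule: infinite_finite_induct) (auto intro: filt.add)

lemma filt_diag:
  assumes "i \<in> words" "dotless (length i) ds" "length ds < L"
  shows "filt i L (dia ds i)"
proof (rule filt_eqv)
  show "filt i L (dia ds i * dots i 1)" using assms by (intro filt.normal) (simp_all add: Pol_word_eq)
  have "dia ds i * free_gen (Ident i) \<approx> dia ds i"
    using dotless_fits[OF assms(2)]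
  proof (induction ds)
    case Nil
    then show ?case using assms(1) rel_eqv[OF rel.idem[of i Q i \<tau> R]] by simp
  next
    case (Cons d ds)
    then show ?case using assms(1) by (simp add: mult.assoc eqv_mult_left)
  qed
  then show "dia ds i \<approx> dia ds i * dots i 1" by (simp add: dots_1 eqv_sym)
qed

lemma filt_dots_right:
  assumes "i \<in> words" "filt i L x" "h \<in> Pol_word i"
  shows "filt i L (x * dots i h)"
  using assms(2)
proof (induction rule: filt.induct)
  case (ideal x)
  then show ?case using assms(1) by (simp add: filt.ideal I_mult_right)
next
  case (add x y)
  then show ?case by (simp add: distrib_right filt.add)
next
  case (normal ds g)
  then have "filt i L (dia ds i * dots i (g * h))"
    using assms(3) by (intro filt.normal) (simp_all add: Pol_word_eq)
  moreover have "dia ds i * dots i g * dots i h \<approx> dia ds i * dots i (g * h)"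
    unfolding mult.assoc using assms(1) dotless_fits[OF normal(1)] by (intro eqv_mult_left dots_mult) simp_all
  ultimately show ?case by (rule filt_eqv[rotated])
qed

lemma filt_const_left:
  assumes "i \<in> words" "filt i L x"
  shows "filt i L (free_const c * x)"
  using assms(2)
proof (induction rule: filt.induct)
  case (ideal x)
  then show ?case by (simp add: filt.ideal I_mult_left)
next
  case (add x y)
  then show ?case by (simp add: distrib_left filt.add)
next
  case (normal ds g)
  then have "filt i L (dia ds i * dots i (Const c * g))"
    by (intro filt.normal) (simp_all add: Pol_word_eq)
  then show ?case
    using free_const_commute[of c "dia ds i"] by (simp add: dots_Const_mult flip: mult.assoc)
qed

lemma filt_Ident_left:
  assumes "i \<in> words" "filt i L x" "j \<in> words"
  shows "filt i L (free_gen (Ident j) * x)"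
  using assms(2)
proof (induction rule: filt.induct)
  case (ideal x)
  then show ?case using assms by (simp add: filt.ideal I_mult_left)
next
  case (add x y)
  then show ?case by (simp add: distrib_left filt.add)
next
  case (normal ds g)
  show ?case
  proof (cases "j = tgt ds i")
    case True
    then have "free_gen (Ident j) * dia ds i * dots i g \<approx> dia ds i * dots i g"
      using assms(1) dotless_fits[OF normal(1)] by (simp add: eqv_mult_right Ident_diag)
    with filt.normal[OF normal] show ?thesis by (simp add: filt_eqv mult.assoc)
  next
    case False
    then have "free_gen (Ident j) * dia ds i * dots i g \<approx> 0 * dots i g"
      using assms dotless_fits[OF normal(1)] by (intro eqv_mult_right Ident_diag_neq) simp_all
    then show ?thesis by (simp add: filt_eqv mult.assoc)
  qed
qed

text \<open>Reduces left multiplication by a generator to single diagrams: the polynomial on the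
  right rides along, and a generator at the wrong word gives zero. L and L' are separate since
  crossings and reflections raise the bound by one while dots keep it.\<close>

lemma filt_Gen_left_aux:
  assumes "i \<in> words" "j \<in> words" "fits d (length j)" "length j = length i"
    and diag: "\<And>ds. dotless (length i) ds \<Longrightarrow> length ds < L \<Longrightarrow> filt i L' (dia (d # ds) i)"
    and "filt i L x"
  shows "filt i L' (free_gen (Gen d j) * x)"
  using assms(6)
proof (induction rule: filt.induct)
  case (ideal x)
  then show ?case using assms by (simp add: filt.ideal I_mult_left)
next
  case (add x y)
  then show ?case by (simp add: distrib_left filt.add)
next
  case (normal ds g)
  show ?case
  proof (cases "j = tgt ds i")
    case True
    with diag[OF normal(1,2)] normal assms filt_dots_right[of i L' "dia (d # ds) i" g]
    show ?thesis by (simp add: mult.assoc)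
  next
    case False
    then have "free_gen (Gen d j) * dia ds i * dots i g \<approx> 0 * dots i g"
      using assms dotless_fits[OF normal(1)] by (intro eqv_mult_right Gen_diag_neq) simp_all
    then show ?thesis by (simp add: filt_eqv mult.assoc)
  qed
qed

lemma filt_Gen_left:
  assumes "i \<in> words" "j \<in> words" "fits d (length i)" "length j = length i" "\<not> is_dot d" "filt i L x"
  shows "filt i (Suc L) (free_gen (Gen d j) * x)"
  using assms by (intro filt_Gen_left_aux[of i j d L "Suc L" x] filt_diag) simp_all

text \<open>One shape covers the dot relations of all generators: s is 1 or -1, c is zero except for
  the value \<open>hbar\<close> at the left mirror, and c' is zero except for 1 or -1 at a crossing
  of equal labels. In no case does the number of crossings and reflections grow.\<close>

lemma Dot_past_generator:
  assumes "t \<in> words" "fits d (length t)" "\<not> is_dot d" "1 \<le> k" "k \<le> length t"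
  shows "\<exists>l s c c'. 1 \<le> l \<and> l \<le> length t \<and>
    dia [Dot k, d] t \<approx> free_const s * dia [d, Dot l] t + free_const c * dia [d] t
      + free_const c' * dia [] t" (is "\<exists>l s c c'. ?P l s c c'")
proof (cases d)
  case (Dot k)
  then show ?thesis using assms by simp
next
  case (Cross n)
  then have n: "1 \<le> n" "n < length t" using assms by simp_all
  consider "k = n" | "k = Suc n" | "k \<noteq> n" "k \<noteq> Suc n" by blast
  then show ?thesis
  proof cases
    case 1
    from rel_eqv[OF rel.dot_cross[OF assms(1) refl n]]
    have "?P (Suc n) 1 0 (if t ! (n - 1) = t ! n then 1 else 0)"
      using 1 n Cross by (simp add: free_const_simps del: diag.simps split: if_splits)
    then show ?thesis by blast
  next
    case 2
    let ?e = "if t ! (n - 1) = t ! n then dia [] t else 0"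
    have "dia [Cross n, Dot n] t - ?e \<approx> (dia [Dot (Suc n), Cross n] t + ?e) - ?e"
      using rel_eqv[OF rel.cross_dot[OF assms(1) refl n]] assms(1) by (intro eqv_diff) simp_all
    then have "dia [Dot k, d] t \<approx> dia [Cross n, Dot n] t - ?e"
      using 2 Cross by (subst eqv_commute) (simp del: diag.simps)
    then have "?P n 1 0 (if t ! (n - 1) = t ! n then - 1 else 0)"
      using n Cross by (simp add: free_const_simps del: diag.simps split: if_splits)
    then show ?thesis by blast
  next
    case 3
    then have "dia [d, Dot k] t \<approx> dia [Dot k, d] t"
      using rel_eqv[OF rel.cross_dot_far[OF assms(1) refl n assms(4,5)]] Cross by (simp del: diag.simps)
    then have "dia [Dot k, d] t \<approx> dia [d, Dot k] t" by (rule eqv_sym)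
    then have "?P k 1 0 0" using assms by (simp add: free_const_simps del: diag.simps)
    then show ?thesis by blast
  qed
next
  case Refl_L
  have t: "1 \<le> length t" using assms by simp
  show ?thesis
  proof (cases "k = 1")
    case True
    have "dia [Refl_L, Dot 1] t - free_const hbar * dia [Refl_L] t
        \<approx> (- dia [Dot 1, Refl_L] t + free_const hbar * dia [Refl_L] t) - free_const hbar * dia [Refl_L] t"
      using rel_eqv[OF rel.left_dot[OF assms(1) refl t]] assms t
      by (intro eqv_diff) (simp_all del: diag.simps)
    from eqv_uminus[OF this] have "dia [Dot k, d] t
        \<approx> free_const (- 1) * dia [d, Dot 1] t + free_const hbar * dia [d] t + free_const 0 * dia [] t"
      using True Refl_L by (subst eqv_commute) (simp add: free_const_simps del: diag.simps)
    then have "?P 1 (- 1) hbar 0" using t by blast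
    then show ?thesis by blast
  next
    case False
    then have "dia [d, Dot k] t \<approx> dia [Dot k, d] t"
      using rel_eqv[OF rel.left_dot_far[OF assms(1) refl _ assms(5)]] Refl_L assms(4)
      by (simp del: diag.simps)
    then have "dia [Dot k, d] t \<approx> dia [d, Dot k] t" by (rule eqv_sym)
    then have "?P k 1 0 0" using assms by (simp add: free_const_simps del: diag.simps)
    then show ?thesis by blast
  qed
next
  case Refl_R
  have t: "1 \<le> length t" using assms by simp
  show ?thesis
  proof (cases "k = length t")
    case True
    from eqv_uminus[OF rel_eqv[OF rel.right_dot[OF assms(1) refl t]]]
    have "dia [Dot k, d] t
        \<approx> free_const (- 1) * dia [d, Dot k] t + free_const 0 * dia [d] t + free_const 0 * dia [] t"
      using True Refl_R by (subst eqv_commute) (simp add: free_const_simps del: diag.simps)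
    then have "?P k (- 1) 0 0" using assms by blast
    then show ?thesis by blast
  next
    case False
    then have "dia [d, Dot k] t \<approx> dia [Dot k, d] t"
      using rel_eqv[OF rel.right_dot_far[OF assms(1) refl assms(4)]] Refl_R assms(5)
      by (simp del: diag.simps)
    then have "dia [Dot k, d] t \<approx> dia [d, Dot k] t" by (rule eqv_sym)
    then have "?P k 1 0 0" using assms by (simp add: free_const_simps del: diag.simps)
    then show ?thesis by blast
  qed
qed

lemma filt_diag_Dot:
  assumes "i \<in> words" "dotless (length i) ds" "length ds < L" "1 \<le> k" "k \<le> length i"
  shows "filt i L (dia (Dot k # ds) i)"
  using assms(2-)
proof (induction ds arbitrary: k L)
  case Nil
  then have "filt i L (dia [] i * dots i (Var k))"
    by (intro filt.normal) (simp_all add: Pol_word_eq)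
  moreover have "dia [Dot k] i \<approx> dia [] i * dots i (Var k)"
    using Nil assms(1) Ident_diag[of i "[Dot k]"] by (simp add: dots_Var eqv_sym)
  ultimately show ?case by (rule filt_eqv[rotated])
next
  case (Cons d ds)
  let ?t = "tgt ds i"
  have ds: "dotless (length i) ds" "seq_fits ds (length i)" "fits d (length i)" "\<not> is_dot d"
    using Cons.prems dotless_fits[of "length i" ds] by simp_all
  then have t: "?t \<in> words" using assms(1) by simp
  \<comment> \<open>After the dot has passed the remaining letters, d is attached again on the left,
    which raises the bound by one; hence the induction hypothesis is used at L'.\<close>
  obtain L' where L: "L = Suc L'" "length ds < L'" using Cons.prems(2) by (cases L) auto
  obtain l s c c' where l: "1 \<le> l" "l \<le> length i" and
    e: "dia [Dot k, d] ?t \<approx> free_const s * dia [d, Dot l] ?t + free_const c * dia [d] ?t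
      + free_const c' * dia [] ?t"
    using Dot_past_generator[OF t, of d k] ds Cons.prems by (auto simp del: diag.simps)
  let ?D = "\<lambda>ds'. dia (ds' @ ds) i"
  have app: "dia ds' ?t * dia ds i \<approx> ?D ds'" if "seq_fits ds' (length i)" for ds'
    using that assms(1) ds by (intro diag_append) simp_all
  have fit: "seq_fits [Dot k, d] (length i)" "seq_fits [d, Dot l] (length i)" "seq_fits [d] (length i)" "seq_fits [] (length i)"
    using ds l Cons.prems by simp_all
  have "?D [Dot k, d] \<approx> dia [Dot k, d] ?t * dia ds i"
    using app[OF fit(1)] by (rule eqv_sym)
  also have "\<dots> \<approx> (free_const s * dia [d, Dot l] ?t + free_const c * dia [d] ?t
      + free_const c' * dia [] ?t) * dia ds i"
    using assms(1) ds by (intro eqv_mult_right[OF e] diag_carrier)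
  also have "\<dots> \<approx> free_const s * ?D [d, Dot l] + free_const c * ?D [d] + free_const c' * ?D []"
    unfolding distrib_right mult.assoc
    by (intro eqv_add eqv_mult_left app fit free_carrier_simps)
  finally have eqv: "?D [Dot k, d] \<approx> free_const s * ?D [d, Dot l] + free_const c * ?D [d] + free_const c' * ?D []" .
  have "filt i L' (dia (Dot l # ds) i)"
    using Cons.IH[OF ds(1) L(2)] l by simp
  then have "filt i L (free_gen (Gen d ?t) * dia (Dot l # ds) i)"
    unfolding L using assms(1) t ds by (intro filt_Gen_left) simp_all
  moreover have "filt i L (dia (d # ds) i)" "filt i L (dia ds i)"
    using Cons.prems assms(1) ds by (intro filt_diag; simp)+
  ultimately have "filt i L (free_const s * ?D [d, Dot l] + free_const c * ?D [d] + free_const c' * ?D [])"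
    using assms(1) by (intro filt.add filt_const_left) simp_all
  with eqv show ?case by (simp add: filt_eqv)
qed

lemma filt_Dot_left:
  assumes "i \<in> words" "j \<in> words" "length j = length i" "1 \<le> k" "k \<le> length i" "filt i L x"
  shows "filt i L (free_gen (Gen (Dot k) j) * x)"
  using assms by (intro filt_Gen_left_aux[of i j "Dot k" L L x] filt_diag_Dot) simp_all

lemma filt_dots_left:
  assumes "i \<in> words" "j \<in> words" "length j = length i" "filt i L x"
  shows "filt i L (dots j g * x)"
proof -
  have "filt i L (dia ds j * x)" if "set ds \<subseteq> Dot ` {1..length i}" for ds
    using that
  proof (induction ds)
    case Nil
    then show ?case using assms by (simp add: filt_Ident_left)
  next
    case (Cons d ds)
    then have "tgt ds j = j" by (intro diag_id_Dots[THEN conjunct2, THEN conjunct2]) auto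
    with Cons assms show ?case by (auto simp: mult.assoc intro!: filt_Dot_left)
  qed
  with set_dot_seq[of "length j"] show ?thesis
    unfolding dots_eq sum_distrib_right mult.assoc using assms
    by (intro filt_sum filt_const_left) simp_all
qed

text \<open>Exhaustiveness of the filtration, also for diagrams with dots in any position.\<close>

lemma filt_any_diag:
  assumes "i \<in> words" "seq_fits ds (length i)"
  shows "\<exists>L. filt i L (dia ds i)"
  using assms(2)
proof (induction ds)
  case Nil
  then show ?case using filt_diag[of i "[]" 1] assms(1) by auto
next
  case (Cons d ds)
  then obtain L where "filt i L (dia ds i)" by auto
  let ?t = "tgt ds i"
  have t: "?t \<in> words" "fits d (length i)" using Cons.prems assms(1) by simp_all
  have "filt i (Suc L) (free_gen (Gen d ?t) * dia ds i)"
  proof (cases "is_dot d")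
    case True
    then obtain k where "d = Dot k" by (auto simp: is_dot_def)
    with t assms(1) \<open>filt i L (dia ds i)\<close> have "filt i L (free_gen (Gen d ?t) * dia ds i)"
      by (simp add: filt_Dot_left)
    then show ?thesis by (rule filt_mono) simp
  next
    case False
    with t assms(1) \<open>filt i L (dia ds i)\<close> show ?thesis by (intro filt_Gen_left) simp_all
  qed
  then show ?case by auto
qed

end

section \<open>Reduced words of the affine Weyl group\<close>

text \<open>
  Points are scaled by \<open>2m + 2\<close> with \<open>\<hbar> = 1\<close>, so that they stay integral: the left mirror reflects in
  \<open>x\<^sub>1 = m + 1\<close>, \<open>base m\<close> lies in the alcove \<open>m + 1 > x\<^sub>1 > \<dots> > x\<^sub>m > 0\<close>, and \<open>desc m d x\<close> says that the wall
  of \<open>d\<close> separates \<open>x\<close> from this alcove.  The value of \<open>base m\<close> outside \<open>{1..m}\<close> is irrelevant.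
\<close>

fun pact :: "nat \<Rightarrow> elem_diag \<Rightarrow> (nat \<Rightarrow> int) \<Rightarrow> nat \<Rightarrow> int" where
  "pact m (Dot k) x = x"
| "pact m (Cross k) x = x(k := x (Suc k), Suc k := x k)"
| "pact m Refl_L x = x(Suc 0 := 2 * int m + 2 - x (Suc 0))"
| "pact m Refl_R x = x(m := - x m)"

fun desc :: "nat \<Rightarrow> elem_diag \<Rightarrow> (nat \<Rightarrow> int) \<Rightarrow> bool" where
  "desc m (Dot k) x \<longleftrightarrow> False"
| "desc m (Cross k) x \<longleftrightarrow> x k < x (Suc k)"
| "desc m Refl_L x \<longleftrightarrow> int m + 1 < x (Suc 0)"
| "desc m Refl_R x \<longleftrightarrow> x m < 0"

definition base :: "nat \<Rightarrow> nat \<Rightarrow> int" where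
  "base m k = (if 1 \<le> k \<and> k \<le> m then int m + 1 - int k else 0)"

definition pt :: "nat \<Rightarrow> elem_diag list \<Rightarrow> nat \<Rightarrow> int" where
  "pt m ds = foldr (pact m) ds (base m)"

lemma pt_simps [simp]: "pt m [] = base m" "pt m (d # ds) = pact m d (pt m ds)"
  by (simp_all add: pt_def)

text \<open>The point lies on no wall of the affine arrangement, whose walls are given by 2 x_j, x_j
  - x_k or x_j + x_k being equal to a multiple of 2m + 2. Such congruences are preserved by all
  reflections, unlike the inequalities of a single alcove.\<close>

definition generic :: "nat \<Rightarrow> (nat \<Rightarrow> int) \<Rightarrow> bool" where
  "generic m x \<longleftrightarrow> (\<forall>j\<in>{1..m}. \<not> 2 * int m + 2 dvd 2 * x j \<and>
     (\<forall>k\<in>{1..m}. j \<noteq> k \<longrightarrow> \<not> 2 * int m + 2 dvd x j - x k \<and> \<not> 2 * int m + 2 dvd x j + x k))"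

lemma genericI:
  assumes "\<And>j. 1 \<le> j \<Longrightarrow> j \<le> m \<Longrightarrow> \<not> 2 * int m + 2 dvd 2 * x j"
    and "\<And>j k. 1 \<le> j \<Longrightarrow> j \<le> m \<Longrightarrow> 1 \<le> k \<Longrightarrow> k \<le> m \<Longrightarrow> j \<noteq> k \<Longrightarrow> \<not> 2 * int m + 2 dvd x j - x k"
    and "\<And>j k. 1 \<le> j \<Longrightarrow> j \<le> m \<Longrightarrow> 1 \<le> k \<Longrightarrow> k \<le> m \<Longrightarrow> j \<noteq> k \<Longrightarrow> \<not> 2 * int m + 2 dvd x j + x k"
  shows "generic m x"
  using assms by (simp add: generic_def)

lemma genericD:
  assumes "generic m x" "1 \<le> j" "j \<le> m"
  shows "\<not> 2 * int m + 2 dvd 2 * x j"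
    and "1 \<le> k \<Longrightarrow> k \<le> m \<Longrightarrow> j \<noteq> k \<Longrightarrow> \<not> 2 * int m + 2 dvd x j - x k"
    and "1 \<le> k \<Longrightarrow> k \<le> m \<Longrightarrow> j \<noteq> k \<Longrightarrow> \<not> 2 * int m + 2 dvd x j + x k"
  using assms by (simp_all add: generic_def)

lemma generic_base: "generic m (base m)"
proof (rule genericI)
  fix j assume "1 \<le> j" "j \<le> m"
  then show "\<not> 2 * int m + 2 dvd 2 * base m j"
    by (intro zdvd_not_zless) (simp_all add: base_def)
next
  fix j k :: nat assume jk: "1 \<le> j" "j \<le> m" "1 \<le> k" "k \<le> m" "j \<noteq> k"
  then show "\<not> 2 * int m + 2 dvd base m j + base m k"
    by (intro zdvd_not_zless) (simp_all add: base_def)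
  show "\<not> 2 * int m + 2 dvd base m j - base m k"
  proof (cases "j < k")
    case True
    with jk show ?thesis by (intro zdvd_not_zless) (simp_all add: base_def)
  next
    case False
    with jk have "\<not> 2 * int m + 2 dvd base m k - base m j"
      by (intro zdvd_not_zless) (simp_all add: base_def)
    then show ?thesis by (simp add: dvd_diff_commute)
  qed
qed

lemma generic_pact:
  assumes "generic m x" "fits d m"
  shows "generic m (pact m d x)"
proof -
  define N where "N = 2 * int m + 2"
  note D = genericD[OF assms(1), folded N_def]
  \<comment> \<open>The left mirror replaces a coordinate a by N - a; this turns each tested form
    into another one, up to sign and a multiple of N.\<close>
  have N: "N dvd N - a \<longleftrightarrow> N dvd a" "N dvd 2 * (N - a) \<longleftrightarrow> N dvd 2 * a"
    "N dvd N - a - b \<longleftrightarrow> N dvd a + b" "N dvd N - a + b \<longleftrightarrow> N dvd b - a"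
    "N dvd b - (N - a) \<longleftrightarrow> N dvd b + a" "N dvd b + (N - a) \<longleftrightarrow> N dvd b - a" for a b
  proof -
    have *: "N dvd c \<longleftrightarrow> N dvd c'" if "c + c' = N * e \<or> c - c' = N * e" for c c' e
    proof -
      from that have "c = N * e + - c' \<or> c = N * e + c'" by auto
      then show ?thesis by (metis dvd_add_right_iff dvd_minus_iff dvd_triv_left)
    qed
    show "N dvd N - a \<longleftrightarrow> N dvd a" by (rule *[of _ _ 1]) simp
    show "N dvd 2 * (N - a) \<longleftrightarrow> N dvd 2 * a" by (rule *[of _ _ 2]) simp
    show "N dvd N - a - b \<longleftrightarrow> N dvd a + b" by (rule *[of _ _ 1]) simp
    show "N dvd N - a + b \<longleftrightarrow> N dvd b - a" by (rule *[of _ _ 1]) simp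
    show "N dvd b - (N - a) \<longleftrightarrow> N dvd b + a" by (rule *[of _ _ "- 1"]) simp
    show "N dvd b + (N - a) \<longleftrightarrow> N dvd b - a" by (rule *[of _ _ 1]) simp
  qed
  show ?thesis
  proof (cases d)
    case (Dot k)
    then show ?thesis using assms(1) by simp
  next
    case (Cross n)
    let ?\<pi> = "\<lambda>j. if j = n then Suc n else if j = Suc n then n else j"
    have "pact m d x j = x (?\<pi> j)" for j using Cross by simp
    moreover have "1 \<le> ?\<pi> j \<and> ?\<pi> j \<le> m" if "1 \<le> j" "j \<le> m" for j
      using that assms(2) Cross by auto
    moreover have "?\<pi> j \<noteq> ?\<pi> k" if "j \<noteq> k" for j k using that by auto
    ultimately show ?thesis
      by (intro genericI; fold N_def) (simp_all add: D del: pact.simps)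
  next
    case Refl_L
    then have p: "pact m d x = x(Suc 0 := N - x (Suc 0))" by (simp add: N_def)
    show ?thesis
    proof (rule genericI; fold N_def)
      fix j k :: nat assume "1 \<le> j" "j \<le> m" "1 \<le> k" "k \<le> m" "j \<noteq> k"
      then show "\<not> N dvd pact m d x j - pact m d x k" "\<not> N dvd pact m d x j + pact m d x k"
        using D(2)[of j k] D(2)[of k j] D(3)[of j k] D(3)[of k j]
        by (auto simp: p N add.commute)
    qed (use D(1) p N in auto)
  next
    case Refl_R
    have neg: "- a - b = - (a + b)" "- a + b = - (a - b)" for a b :: int by simp_all
    show ?thesis
    proof (rule genericI; fold N_def)
      fix j k :: nat assume "1 \<le> j" "j \<le> m" "1 \<le> k" "k \<le> m" "j \<noteq> k"
      then show "\<not> N dvd pact m d x j - pact m d x k" "\<not> N dvd pact m d x j + pact m d x k"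
        using Refl_R D(2)[of j k] D(2)[of k j] D(3)[of j k] D(3)[of k j]
        by (auto simp: neg add.commute dvd_minus_iff simp del: minus_add_distrib minus_diff_eq)
    qed (use Refl_R D(1) in auto)
  qed
qed

lemma generic_pt: "\<forall>d\<in>set ds. fits d m \<Longrightarrow> generic m (pt m ds)"
  by (induction ds) (simp_all add: generic_base generic_pact)

lemma pact_invol [simp]: "pact m d (pact m d x) = x"
  by (cases d) auto

text \<open>Genericity keeps the point off the wall of d, and the reflection exchanges the two sides
  of that wall.\<close>

lemma desc_pact:
  assumes "generic m x" "fits d m" "\<not> is_dot d"
  shows "desc m d (pact m d x) \<longleftrightarrow> \<not> desc m d x"
proof -
  have nz: "x j \<noteq> 0" "x j \<noteq> int m + 1" if "1 \<le> j" "j \<le> m" for j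
    using genericD(1)[OF assms(1) that] by auto
  have ne: "x j \<noteq> x k" if "1 \<le> j" "j \<le> m" "1 \<le> k" "k \<le> m" "j \<noteq> k" for j k
    using genericD(2)[OF assms(1) that] by auto
  show ?thesis
  proof (cases d)
    case (Cross k)
    with assms ne[of k "Suc k"] show ?thesis by auto
  next
    case Refl_L
    with assms nz(2)[of 1] show ?thesis by auto
  next
    case Refl_R
    with assms nz(1)[of m] show ?thesis by auto
  qed (use assms in simp)
qed

lemma not_desc_base: "fits d m \<Longrightarrow> \<not> desc m d (base m)"
  by (cases d) (auto simp: base_def)

text \<open>Reducedness in terms of alcoves: every letter, when it is added on the left, moves the
  point to the far side of its wall. Such words turn out to be the shortest ones for their
  point.\<close>

fun good :: "nat \<Rightarrow> elem_diag list \<Rightarrow> bool" where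
  "good m [] \<longleftrightarrow> True"
| "good m (d # ds) \<longleftrightarrow> good m ds \<and> desc m d (pt m (d # ds))"

fun alt :: "nat \<Rightarrow> 'a \<Rightarrow> 'a \<Rightarrow> 'a list" where
  "alt 0 s t = []"
| "alt (Suc n) s t = s # alt n t s"

text \<open>The condition under which \<open>alt n s t\<close> can be split off, letter by letter,
  from the left of a reduced word with point x.\<close>

fun descs :: "nat \<Rightarrow> nat \<Rightarrow> elem_diag \<Rightarrow> elem_diag \<Rightarrow> (nat \<Rightarrow> int) \<Rightarrow> bool" where
  "descs m 0 s t x \<longleftrightarrow> True"
| "descs m (Suc n) s t x \<longleftrightarrow> desc m s x \<and> descs m n t s (pact m s x)"

lemma length_alt [simp]: "length (alt n s t) = n"
  by (induction n arbitrary: s t) simp_all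

lemma dotless_alt: "fits s m \<Longrightarrow> fits t m \<Longrightarrow> \<not> is_dot s \<Longrightarrow> \<not> is_dot t \<Longrightarrow> dotless m (alt n s t)"
  by (induction n arbitrary: s t) simp_all

lemma pt_append: "pt m (ds @ ds') = foldr (pact m) ds (pt m ds')"
  by (simp add: pt_def)

lemma good_alt: "good m v \<Longrightarrow> descs m n s t (pt m (alt n s t @ v)) \<Longrightarrow> good m (alt n s t @ v)"
  by (induction n arbitrary: s t) simp_all


section \<open>Braid relations up to shorter diagrams\<close>

context iyangian_data
begin

text \<open>All that the exchange argument needs to know about two generators whose product has
  order n. If both are descents, then the longest element of their dihedral group splits off in
  either spelling; both spellings act equally on points and on words; and the braid relation,
  composed with any u, holds up to diagrams with fewer letters.\<close>

definition braid_pair :: "'q list \<Rightarrow> nat \<Rightarrow> elem_diag \<Rightarrow> elem_diag \<Rightarrow> bool" where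
  "braid_pair i n s t \<longleftrightarrow> 2 \<le> n \<and>
    (\<forall>x. desc (length i) s x \<and> desc (length i) t x \<longrightarrow>
      descs (length i) n s t x \<and> descs (length i) n t s x) \<and>
    (\<forall>x. foldr (pact (length i)) (alt n s t) x = foldr (pact (length i)) (alt n t s) x) \<and>
    (\<forall>j\<in>words. length j = length i \<longrightarrow> tgt (alt n s t) j = tgt (alt n t s) j) \<and>
    (\<forall>u. dotless (length i) u \<longrightarrow>
      filt i (n + length u) (dia (alt n s t @ u) i - dia (alt n t s @ u) i))"

lemma braid_pair_sym: "braid_pair i n s t \<Longrightarrow> braid_pair i n t s"
  unfolding braid_pair_def using filt_uminus[of i _ "dia _ i - dia _ i"]
  by (auto simp del: diag.simps)

lemma filt_rel_append:
  assumes "i \<in> words" "dotless (length i) w" "dotless (length i) w'" "dotless (length i) u"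
    and "dia w (tgt u i) - dia w' (tgt u i) \<approx> z" "filt i L (z * dia u i)"
  shows "filt i L (dia (w @ u) i - dia (w' @ u) i)"
proof (rule filt_eqv[OF _ assms(6)])
  have fit: "seq_fits w (length i)" "seq_fits w' (length i)" "seq_fits u (length i)"
    using assms dotless_fits by blast+
  have "dia (w @ u) i - dia (w' @ u) i
      \<approx> dia w (tgt u i) * dia u i - dia w' (tgt u i) * dia u i"
    using assms(1) fit by (intro eqv_diff; subst eqv_commute) (intro diag_append; simp)+
  also have "\<dots> \<approx> z * dia u i"
    using eqv_mult_right[OF assms(5), of "dia u i"] assms(1) fit by (simp add: left_diff_distrib)
  finally show "dia (w @ u) i - dia (w' @ u) i \<approx> z * dia u i" .
qed

lemma eqv_diff_0: "x \<approx> y \<Longrightarrow> x - y \<approx> 0"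
  using eqv_diff[of x y y y] by (simp add: eqv_carrier)

lemma braid_pair_commuting:
  assumes "i \<in> words" "dotless (length i) [s, t]"
    and "\<And>x. pact (length i) s (pact (length i) t x) = pact (length i) t (pact (length i) s x)"
    and "\<And>x. desc (length i) s (pact (length i) t x) = desc (length i) s x"
    and "\<And>x. desc (length i) t (pact (length i) s x) = desc (length i) t x"
    and "\<And>j. j \<in> words \<Longrightarrow> length j = length i \<Longrightarrow>
      target \<tau> s (target \<tau> t j) = target \<tau> t (target \<tau> s j) \<and> dia [s, t] j \<approx> dia [t, s] j"
  shows "braid_pair i 2 s t"
  unfolding braid_pair_def
proof (intro conjI allI ballI impI)
  fix u assume u: "dotless (length i) u"
  then have "tgt u i \<in> words" using assms(1) dotless_fits by simp
  then have "dia [s, t] (tgt u i) - dia [t, s] (tgt u i) \<approx> 0"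
    using assms(6) by (intro eqv_diff_0) (simp del: diag.simps)
  then have "filt i (2 + length u) (dia ([s, t] @ u) i - dia ([t, s] @ u) i)"
    using assms(1,2) u by (intro filt_rel_append[of i _ _ u 0]) simp_all
  then show "filt i (2 + length u) (dia (alt 2 s t @ u) i - dia (alt 2 t s @ u) i)"
    by (simp add: numeral_2_eq_2 del: diag.simps)
qed (use assms in \<open>auto simp: numeral_2_eq_2\<close>)

lemma braid_pair_far_crossings:
  assumes "i \<in> words" "Suc k < l" "1 \<le> k" "l < length i"
  shows "braid_pair i 2 (Cross k) (Cross l)"
proof (rule braid_pair_commuting)
  fix j assume "j \<in> words" "length j = length i"
  with assms swap_far[of "k - 1" "l - 1" j] rel.cross_cross_far[of j Q "length j" k l \<tau> R]
  show "target \<tau> (Cross k) (target \<tau> (Cross l) j) = target \<tau> (Cross l) (target \<tau> (Cross k) j)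
      \<and> dia [Cross k, Cross l] j \<approx> dia [Cross l, Cross k] j"
    by (simp add: rel_eqv del: diag.simps)
qed (use assms in \<open>auto simp: fun_eq_iff\<close>)

lemma braid_pair_left_crossing:
  assumes "i \<in> words" "2 \<le> l" "l < length i"
  shows "braid_pair i 2 Refl_L (Cross l)"
proof (rule braid_pair_commuting)
  fix j assume "j \<in> words" "length j = length i"
  with assms refl_left_swap[of "l - 1" j \<tau>] rel.left_cross_far[of j Q "length j" l \<tau> R]
  show "target \<tau> Refl_L (target \<tau> (Cross l) j) = target \<tau> (Cross l) (target \<tau> Refl_L j)
      \<and> dia [Refl_L, Cross l] j \<approx> dia [Cross l, Refl_L] j"
    by (simp add: rel_eqv del: diag.simps)
qed (use assms in \<open>auto simp: fun_eq_iff\<close>)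

lemma braid_pair_right_crossing:
  assumes "i \<in> words" "1 \<le> l" "Suc l < length i"
  shows "braid_pair i 2 Refl_R (Cross l)"
proof (rule braid_pair_commuting)
  fix j assume "j \<in> words" "length j = length i"
  with assms refl_right_swap[of j "length j - 1" "l - 1" \<tau>] rel.right_cross_far[of j Q "length j" l \<tau> R]
  show "target \<tau> Refl_R (target \<tau> (Cross l) j) = target \<tau> (Cross l) (target \<tau> Refl_R j)
      \<and> dia [Refl_R, Cross l] j \<approx> dia [Cross l, Refl_R] j"
    by (simp add: rel_eqv del: diag.simps)
qed (use assms in \<open>auto simp: fun_eq_iff\<close>)

lemma braid_pair_left_right:
  assumes "i \<in> words" "2 \<le> length i"
  shows "braid_pair i 2 Refl_L Refl_R"
proof (rule braid_pair_commuting)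
  fix j assume "j \<in> words" "length j = length i"
  with assms refl_left_right[of j "length j - 2" \<tau>] rel.left_right[of j Q "length j" \<tau> R]
  show "target \<tau> Refl_L (target \<tau> Refl_R j) = target \<tau> Refl_R (target \<tau> Refl_L j)
      \<and> dia [Refl_L, Refl_R] j \<approx> dia [Refl_R, Refl_L] j"
    by (simp add: rel_eqv del: diag.simps)
qed (use assms in \<open>auto simp: fun_eq_iff\<close>)

lemma braid_pair_adjacent_crossings:
  assumes "i \<in> words" "1 \<le> k" "Suc k < length i"
  shows "braid_pair i 3 (Cross k) (Cross (Suc k))"
  unfolding braid_pair_def
proof (intro conjI allI ballI impI)
  have k: "k = Suc (k - 1)" using assms by simp
  fix j assume "j \<in> words" "length j = length i"
  with swap_braid[of "k - 1" j, folded k] assms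
  show "tgt (alt 3 (Cross k) (Cross (Suc k))) j = tgt (alt 3 (Cross (Suc k)) (Cross k)) j"
    by (simp add: numeral_3_eq_3)
next
  fix u assume u: "dotless (length i) u"
  let ?t = "tgt u i"
  have t: "?t \<in> words" using assms(1) u dotless_fits by simp
  \<comment> \<open>The right side of the braid relation is zero or a polynomial in the dots, so all
    three crossings disappear.\<close>
  obtain z where z: "dia [Cross k, Cross (Suc k), Cross k] ?t - dia [Cross (Suc k), Cross k, Cross (Suc k)] ?t \<approx> z"
    and "z = 0 \<or> (\<exists>g. z = dots ?t g)"
    using rel_eqv[OF rel.braid[of ?t Q "length ?t" k \<tau> R]] t assms by (auto simp del: diag.simps split: if_splits)
  then have "filt i (3 + length u) (z * dia u i)"
    using t u assms(1) by (auto intro!: filt_dots_left filt_diag)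
  then have "filt i (3 + length u) (dia ([Cross k, Cross (Suc k), Cross k] @ u) i
      - dia ([Cross (Suc k), Cross k, Cross (Suc k)] @ u) i)"
    using assms u by (intro filt_rel_append[OF _ _ _ _ z]) simp_all
  then show "filt i (3 + length u) (dia (alt 3 (Cross k) (Cross (Suc k)) @ u) i
      - dia (alt 3 (Cross (Suc k)) (Cross k) @ u) i)"
    by (simp add: numeral_3_eq_3 del: diag.simps)
qed (use assms in \<open>auto simp: numeral_3_eq_3 fun_eq_iff\<close>)

lemma numeral_4_eq_4: "4 = Suc (Suc (Suc (Suc 0)))"
  by simp

lemma braid_pair_right_mirror:
  assumes "i \<in> words" "length i = Suc (Suc n)"
  shows "braid_pair i 4 (Cross (Suc n)) Refl_R"
  unfolding braid_pair_def
proof (intro conjI allI ballI impI)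
  fix j assume "j \<in> words" "length j = length i"
  with refl_right_braid[of j n \<tau>] assms
  show "tgt (alt 4 (Cross (Suc n)) Refl_R) j = tgt (alt 4 Refl_R (Cross (Suc n))) j"
    by (simp add: numeral_4_eq_4)
next
  fix u assume u: "dotless (length i) u"
  let ?t = "tgt u i"
  have t: "?t \<in> words" using assms(1) u dotless_fits by simp
  have "dia [Cross (Suc n), Refl_R, Cross (Suc n), Refl_R] ?t
      - dia [Refl_R, Cross (Suc n), Refl_R, Cross (Suc n)] ?t \<approx> 0"
    using rel_eqv[OF rel.right_braid[of ?t Q "length ?t" \<tau> R]] t assms
    by (intro eqv_diff_0) (simp del: diag.simps)
  then have "filt i (4 + length u) (dia ([Cross (Suc n), Refl_R, Cross (Suc n), Refl_R] @ u) i
      - dia ([Refl_R, Cross (Suc n), Refl_R, Cross (Suc n)] @ u) i)"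
    using assms u by (intro filt_rel_append[of i _ _ u 0]) simp_all
  then show "filt i (4 + length u) (dia (alt 4 (Cross (Suc n)) Refl_R @ u) i
      - dia (alt 4 Refl_R (Cross (Suc n)) @ u) i)"
    by (simp add: numeral_4_eq_4 del: diag.simps)
qed (use assms in \<open>auto simp: numeral_4_eq_4 fun_eq_iff\<close>)

lemma braid_pair_left_mirror:
  assumes "i \<in> words" "length i = Suc (Suc n)"
  shows "braid_pair i 4 (Cross 1) Refl_L"
  unfolding braid_pair_def
proof (intro conjI allI ballI impI)
  fix j assume "j \<in> words" "length j = length i"
  with refl_left_braid[of j n \<tau>] assms
  show "tgt (alt 4 (Cross 1) Refl_L) j = tgt (alt 4 Refl_L (Cross 1)) j"
    by (simp add: numeral_4_eq_4)
next
  fix u assume u: "dotless (length i) u"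
  let ?t = "tgt u i"
  have t: "?t \<in> words" "swap 1 ?t \<in> words"
    using assms u dotless_fits target_words[of ?t "Cross 1"] by simp_all
  \<comment> \<open>One crossing can survive here: a diagram with 1 + length u letters is still
    below the bound 4 + length u.\<close>
  obtain z where z: "dia [Cross 1, Refl_L, Cross 1, Refl_L] ?t - dia [Refl_L, Cross 1, Refl_L, Cross 1] ?t \<approx> z"
    and z': "z = 0 \<or> (\<exists>g. z = dots (swap 1 ?t) g * dia [Cross 1] ?t)"
    using rel_eqv[OF rel.left_braid[of ?t Q "length ?t" \<tau> R]] t assms by (auto simp del: diag.simps split: if_splits)
  have "dia [Cross 1] ?t * dia u i \<approx> dia ([Cross 1] @ u) i"
    using assms u dotless_fits by (intro diag_append) simp_all
  moreover have "filt i (4 + length u) (dia ([Cross 1] @ u) i)"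
    using assms u by (intro filt_diag) simp_all
  ultimately have "filt i (4 + length u) (dia [Cross 1] ?t * dia u i)"
    by (rule filt_eqv)
  with z' have "filt i (4 + length u) (z * dia u i)"
    using t u assms(1) by (auto simp: mult.assoc simp del: diag.simps intro!: filt_dots_left)
  then have "filt i (4 + length u) (dia ([Cross 1, Refl_L, Cross 1, Refl_L] @ u) i
      - dia ([Refl_L, Cross 1, Refl_L, Cross 1] @ u) i)"
    using assms u by (intro filt_rel_append[OF _ _ _ _ z]) simp_all
  then show "filt i (4 + length u) (dia (alt 4 (Cross 1) Refl_L @ u) i
      - dia (alt 4 Refl_L (Cross 1) @ u) i)"
    by (simp add: numeral_4_eq_4 del: diag.simps)
qed (use assms in \<open>auto simp: numeral_4_eq_4 fun_eq_iff\<close>)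

lemma braid_pair_exists:
  assumes "i \<in> words" "dotless (length i) [s, t]" "s \<noteq> t"
    and x: "desc (length i) s x" "desc (length i) t x"
  shows "\<exists>n. braid_pair i n s t"
proof -
  have two: "length i = Suc (Suc (length i - 2))" if "2 \<le> length i" using that by simp
  have CC: "\<exists>n. braid_pair i n (Cross k) (Cross l)" if "k < l" "1 \<le> k" "l < length i" for k l
    using that braid_pair_far_crossings[of i k l] braid_pair_adjacent_crossings[of i k] assms(1)
    by (cases "l = Suc k") auto
  have LC: "\<exists>n. braid_pair i n Refl_L (Cross l)" if "1 \<le> l" "l < length i" for l
    using that braid_pair_left_crossing[of i l] assms(1) two
      braid_pair_sym[OF braid_pair_left_mirror[of i "length i - 2"]]
    by (cases "l = 1") auto
  have RC: "\<exists>n. braid_pair i n Refl_R (Cross l)" if "1 \<le> l" "l < length i" for l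
  proof (cases "Suc l = length i")
    case True
    with that have "length i = Suc (Suc (l - 1))" "Suc (l - 1) = l" by simp_all
    with braid_pair_sym[OF braid_pair_right_mirror[of i "l - 1"]] assms(1) show ?thesis by auto
  qed (use that braid_pair_right_crossing[of i l] assms(1) in auto)
  have LR: "\<exists>n. braid_pair i n Refl_L Refl_R" if "{s, t} = {Refl_L, Refl_R}"
  proof -
    \<comment> \<open>On a single strand the two mirrors generate an infinite dihedral group and
      satisfy no braid relation. Descents for both would require x_1 > m + 1 and x_1 < 0 at
      once.\<close>
    have "length i \<noteq> 1" using x that by (auto simp: doubleton_eq_iff)
    moreover have "1 \<le> length i" using assms(2) that by (auto simp: doubleton_eq_iff)
    ultimately show ?thesis using braid_pair_left_right[OF assms(1)] by auto
  qed
  have sym: "\<exists>n. braid_pair i n a b \<Longrightarrow> \<exists>n. braid_pair i n b a" for a b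
    using braid_pair_sym by blast
  show ?thesis
  proof (cases s; cases t)
    fix k l assume st: "s = Cross k" "t = Cross l"
    show ?thesis
    proof (cases "k < l")
      case True
      with st assms(2) CC show ?thesis by simp
    next
      case False
      with st assms(2,3) show ?thesis by (auto intro!: sym[OF CC])
    qed
  qed (use assms LC RC LR sym[OF LC] sym[OF RC] sym[OF LR] in \<open>simp_all add: insert_commute\<close>)
qed

text \<open>Equality of diagrams up to shorter ones, together with the combinatorial data that go
  along. Only ds' has to be reduced, so that a word not known to be reduced can be compared with a
  reduced one.\<close>

definition sim :: "'q list \<Rightarrow> elem_diag list \<Rightarrow> elem_diag list \<Rightarrow> bool" where
  "sim i ds ds' \<longleftrightarrow> dotless (length i) ds' \<and> good (length i) ds' \<and> length ds = length ds' \<and>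
    pt (length i) ds = pt (length i) ds' \<and> tgt ds i = tgt ds' i \<and>
    filt i (length ds) (dia ds i - dia ds' i)"

lemma sim_refl: "dotless (length i) ds \<Longrightarrow> good (length i) ds \<Longrightarrow> sim i ds ds"
  by (simp add: sim_def)

lemma sim_trans: "sim i ds ds' \<Longrightarrow> sim i ds' ds'' \<Longrightarrow> sim i ds ds''"
  using filt.add[of i "length ds" "dia ds i - dia ds' i" "dia ds' i - dia ds'' i"]
  by (auto simp: sim_def)

lemma filt_Cons_diff:
  assumes "i \<in> words" "dotless (length i) (d # ds)" "tgt ds i = tgt ds' i"
    and "filt i L (dia ds i - dia ds' i)"
  shows "filt i (Suc L) (dia (d # ds) i - dia (d # ds') i)"
proof -
  have "tgt ds i \<in> words" "length (tgt ds i) = length i"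
    using assms(1,2) dotless_fits[of "length i" ds] by simp_all
  then show ?thesis
    using filt_Gen_left[of i "tgt ds i" d L "dia ds i - dia ds' i"] assms
    by (simp add: right_diff_distrib)
qed

lemma sim_Cons:
  assumes "i \<in> words" "dotless (length i) (d # ds)" "sim i ds ds'" "good (length i) (d # ds')"
  shows "sim i (d # ds) (d # ds')"
  using assms filt_Cons_diff[of i d ds ds' "length ds"] by (auto simp: sim_def simp del: diag.simps)

text \<open>The assumption \<open>exch\<close> is the exchange property below length L, because the
  lemma is applied inside the induction that proves this property. Removing one letter leaves a
  shorter word, for which the next letter of the alternating word is again a descent.\<close>

lemma peel_alternating:
  assumes "i \<in> words" "dotless (length i) [s, t]"
    and exch: "\<And>ds d. \<lbrakk>length ds < L; dotless (length i) (d # ds); good (length i) ds;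
      desc (length i) d (pt (length i) ds)\<rbrakk> \<Longrightarrow> \<exists>ds'. sim i ds (d # ds')"
    and "length ds < L" "dotless (length i) ds" "good (length i) ds"
    and "descs (length i) n s t (pt (length i) ds)"
  shows "\<exists>v. sim i ds (alt n s t @ v)"
  using assms(2,4-)
proof (induction n arbitrary: s t ds)
  case 0
  then show ?case using sim_refl by auto
next
  case (Suc n)
  let ?m = "length i"
  obtain ds' where ds': "sim i ds (s # ds')" using exch[of ds s] Suc.prems by auto
  then have *: "dotless ?m (s # ds')" "good ?m (s # ds')" "length ds = Suc (length ds')"
    "pt ?m ds = pact ?m s (pt ?m ds')"
    by (simp_all add: sim_def)
  have "descs ?m n t s (pt ?m ds')" using Suc.prems(5) *(4) by simp
  with Suc.IH[of t s ds'] Suc.prems * obtain v where v: "sim i ds' (alt n t s @ v)" by auto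
  then have "good ?m (s # alt n t s @ v)" using * by (simp add: sim_def)
  then have "sim i (s # ds') (s # alt n t s @ v)"
    using sim_Cons[OF assms(1) *(1) v] by simp
  with ds' show ?case by (auto intro: sim_trans)
qed

text \<open>The key step of Matsumoto's theorem. If ds = s # u with s \<noteq> t, then s and t are
  both descents, and u can be rewritten to begin with the remaining n - 1 letters t, s, ... of the
  alternating word. So ds begins with one side of the braid relation for s and t, and the other side
  begins with t.\<close>

lemma exchange:
  assumes "i \<in> words" "dotless (length i) (t # ds)" "good (length i) ds"
    and "desc (length i) t (pt (length i) ds)"
  shows "\<exists>ds'. sim i ds (t # ds')"
  using assms(2-)
proof (induction "length ds" arbitrary: t ds rule: less_induct)
  case less
  let ?m = "length i"
  note exch = less.hyps
  show ?case
  proof (cases ds)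
    case Nil
    then show ?thesis using less.prems not_desc_base by simp
  next
    case (Cons s u)
    show ?thesis
    proof (cases "s = t")
      case True
      then show ?thesis using Cons less.prems sim_refl[of i ds] by auto
    next
      case False
      have st: "dotless ?m [s, t]" "dotless ?m [t, s]" "desc ?m s (pt ?m ds)" "desc ?m t (pt ?m ds)"
        using less.prems Cons by simp_all
      obtain n where n: "braid_pair i n s t"
        using braid_pair_exists[OF assms(1) st(1) False st(3,4)] by blast
      then obtain n' where n': "n = Suc n'" "1 \<le> n'" by (cases n) (auto simp: braid_pair_def)
      have D: "descs ?m n s t (pt ?m ds)" "descs ?m n t s (pt ?m ds)"
        using n st by (simp_all add: braid_pair_def)
      then have "descs ?m n' t s (pt ?m u)" using n' Cons by simp
      have "\<exists>v. sim i u (alt n' t s @ v)"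
      proof (rule peel_alternating[OF assms(1) st(2)])
        show "length u < length ds" "dotless ?m u" "good ?m u" using less.prems Cons by simp_all
        show "\<exists>ds''. sim i ds' (d # ds'')"
          if "length ds' < length ds" "dotless ?m (d # ds')" "good ?m ds'" "desc ?m d (pt ?m ds')" for ds' d
          using that by (rule exch)
      qed fact
      then obtain v where v: "sim i u (alt n' t s @ v)" by blast
      then have sv: "sim i ds (alt n s t @ v)"
        unfolding Cons n' alt.simps append_Cons using st(3) less.prems Cons assms(1)
        by (intro sim_Cons) (auto simp: sim_def)
      then have dv: "dotless ?m v" "good ?m v" "length ds = n + length v" "pt ?m ds = pt ?m (alt n s t @ v)"
        "tgt ds i = tgt (alt n s t @ v) i"
      proof -
        have "good ?m v" if "good ?m (ws @ v)" for ws using that by (induction ws) simp_all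
        with sv show "dotless ?m v" "good ?m v" "length ds = n + length v" "pt ?m ds = pt ?m (alt n s t @ v)"
          "tgt ds i = tgt (alt n s t @ v) i"
          by (auto simp: sim_def)
      qed
      have p: "pt ?m (alt n s t @ v) = pt ?m (alt n t s @ v)"
        using n by (simp add: braid_pair_def pt_append)
      have "tgt (alt n s t @ v) i = tgt (alt n t s @ v) i"
        using n dv(1) assms(1) dotless_fits[of ?m v] by (simp add: braid_pair_def targets_append)
      moreover have "filt i (length ds) (dia (alt n s t @ v) i - dia (alt n t s @ v) i)"
        using n dv by (simp add: braid_pair_def)
      moreover have "good ?m (alt n t s @ v)"
        using D(2) dv p by (intro good_alt) simp_all
      ultimately have "sim i (alt n s t @ v) (alt n t s @ v)"
        using p dv st by (simp add: sim_def dotless_alt)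
      with sv have "sim i ds (alt n t s @ v)" by (rule sim_trans)
      then show ?thesis unfolding n' by auto
    qed
  qed
qed

text \<open>The first letter of ds' is a descent of the common point, so \<open>exchange\<close>
  brings it to the front of ds; it is then stripped from both words.\<close>

lemma good_unique:
  assumes "i \<in> words" "dotless (length i) ds" "good (length i) ds"
    and "dotless (length i) ds'" "good (length i) ds'" "pt (length i) ds = pt (length i) ds'"
  shows "sim i ds ds'"
  using assms(2-)
proof (induction "length ds" arbitrary: ds ds' rule: less_induct)
  case less
  let ?m = "length i"
  show ?case
  proof (cases ds')
    case Nil
    \<comment> \<open>The base point has no descents, so no nonempty good word leads back to
      it.\<close>
    have "ds = []"
    proof (cases ds)
      case (Cons d ds1)
      with less.prems Nil have "desc ?m d (base ?m)" "fits d ?m" by simp_all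
      then show ?thesis using not_desc_base by blast
    qed
    then show ?thesis using Nil sim_refl by simp
  next
    case (Cons t v)
    then have "desc ?m t (pt ?m ds)" "dotless ?m (t # ds)" using less.prems by simp_all
    with exchange[OF assms(1)] less.prems obtain w where w: "sim i ds (t # w)" by blast
    then have "pt ?m w = pt ?m v"
      using less.prems(5) Cons by (simp add: sim_def) (metis pact_invol)
    moreover have "length w < length ds" "dotless ?m w" "good ?m w" using w by (simp_all add: sim_def)
    ultimately have "sim i w v" using less.hyps[of w v] less.prems Cons by simp
    moreover have "dotless ?m (t # w)" "good ?m (t # v)" using w less.prems(4) Cons by (simp_all add: sim_def)
    ultimately have "sim i (t # w) (t # v)" using assms(1) by (intro sim_Cons)
    with w Cons show ?thesis by (auto intro: sim_trans)
  qed
qed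

text \<open>The quadratic relations replace both letters t by a polynomial in the dots, which leaves
  at most \<open>length w\<close> letters.\<close>

lemma filt_square:
  assumes "i \<in> words" "dotless (length i) (t # w)"
  shows "filt i (Suc (length w)) (dia (t # t # w) i)"
proof -
  let ?j = "tgt w i"
  have w: "seq_fits w (length i)" "fits t (length i)" "\<not> is_dot t"
    using assms(2) dotless_fits[of "length i" w] by simp_all
  have j: "?j \<in> words" "length ?j = length i" using assms(1) w by simp_all
  obtain z where z: "dia [t, t] ?j \<approx> z" "z = 0 \<or> (\<exists>g. z = dots ?j g)"
  proof (cases t)
    case (Cross k)
    then have k: "1 \<le> k" "k < length ?j" using w by simp_all
    show ?thesis
      using rel_eqv[OF rel.cross_squared[OF j(1) refl k]] Cross that by (auto simp del: diag.simps split: if_splits)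
  next
    case Refl_L
    then have "1 \<le> length ?j" using w by simp
    from rel_eqv[OF rel.left_squared[OF j(1) refl this]] show ?thesis using Refl_L that by (auto simp del: diag.simps)
  next
    case Refl_R
    then have "1 \<le> length ?j" using w by simp
    from rel_eqv[OF rel.right_squared[OF j(1) refl this]] have "dia [t, t] ?j \<approx> dots ?j 1"
      unfolding Refl_R dots_1 diag.simps(1) .
    then show ?thesis using that by blast
  qed (use w in simp)
  have "dia ([t, t] @ w) i \<approx> dia [t, t] ?j * dia w i"
    using assms(1) w by (subst eqv_commute, intro diag_append) simp_all
  also have "\<dots> \<approx> z * dia w i" using z(1) assms(1) w by (intro eqv_mult_right) simp_all
  finally have "dia ([t, t] @ w) i \<approx> z * dia w i" .
  moreover have "filt i (Suc (length w)) (z * dia w i)"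
    using z(2) j assms by (auto intro!: filt_dots_left filt_diag)
  ultimately show ?thesis using filt_eqv by simp
qed

text \<open>Letters are added on the left of a reduced word v'. If t is not a descent, t # v' is
  reduced. Otherwise \<open>exchange\<close> gives a word t # w for v'; then t # t # w drops in the
  filtration by the quadratic relation, and w is a reduced word for the new point.\<close>

lemma reduce_word:
  assumes "i \<in> words" "dotless (length i) ds"
  shows "\<exists>ds'. dotless (length i) ds' \<and> good (length i) ds' \<and> pt (length i) ds' = pt (length i) ds \<and>
    length ds' \<le> length ds \<and> (sim i ds ds' \<or> filt i (length ds) (dia ds i))"
  using assms(2)
proof (induction ds)
  case Nil
  then show ?case using sim_refl[of i "[]"] by (intro exI[of _ "[]"]) simp
next
  case (Cons t v)
  let ?m = "length i"
  have t: "fits t ?m" "\<not> is_dot t" "dotless ?m v" using Cons.prems by simp_all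
  obtain v' where v': "dotless ?m v'" "good ?m v'" "pt ?m v' = pt ?m v" "length v' \<le> length v"
    and alts: "sim i v v' \<or> filt i (length v) (dia v i)"
    using Cons by auto
  have low: "filt i (Suc (length v)) (dia (t # v) i)" if "filt i (length v) (dia v i)"
    using that t assms(1) dotless_fits[of ?m v] by (simp add: filt_Gen_left)
  show ?case
  proof (cases "desc ?m t (pt ?m v')")
    case False
    have "generic ?m (pt ?m v')" using v' dotless_fits by (intro generic_pt) simp
    with False t have "good ?m (t # v')" using v' by (simp add: desc_pact)
    moreover from this have "sim i (t # v) (t # v')" if "sim i v v'"
      using that assms(1) Cons.prems by (intro sim_Cons)
    ultimately show ?thesis using alts low t v' by (intro exI[of _ "t # v'"]) auto
  next
    case True
    with exchange[OF assms(1), of t v'] t v' obtain w where w: "sim i v' (t # w)" by auto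
    have "filt i (Suc (length v)) (dia (t # v) i)" if "sim i v v'"
    proof -
      have s: "sim i v (t # w)" using that w by (rule sim_trans)
      then have "filt i (Suc (length v)) (dia (t # v) i - dia (t # t # w) i)"
        unfolding sim_def by (intro filt_Cons_diff[OF assms(1) Cons.prems]) blast+
      moreover have "filt i (Suc (length v)) (dia (t # t # w) i)"
        using s assms(1) by (intro filt_mono[OF filt_square]) (simp_all add: sim_def)
      ultimately show ?thesis
        using filt.add[of i "Suc (length v)" "dia (t # v) i - dia (t # t # w) i" "dia (t # t # w) i"]
        by (simp del: diag.simps)
    qed
    then have "filt i (length (t # v)) (dia (t # v) i)" using alts low by auto
    moreover have "pt ?m w = pt ?m (t # v)" using w v'(3) by (simp add: sim_def)
    ultimately show ?thesis using w v' by (intro exI[of _ w]) (auto simp: sim_def)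
  qed
qed

text \<open>Every word reduces to a good one that is not longer, and good words with the same point
  have equal length.\<close>

lemma length_good_le:
  assumes "i \<in> words" "dotless (length i) ds" "good (length i) ds"
    and "dotless (length i) ds'" "pt (length i) ds = pt (length i) ds'"
  shows "length ds \<le> length ds'"
proof -
  obtain ds'' where *: "dotless (length i) ds''" "good (length i) ds''" "pt (length i) ds'' = pt (length i) ds'"
    "length ds'' \<le> length ds'"
    using reduce_word[OF assms(1,4)] by auto
  then have "sim i ds ds''" using assms by (intro good_unique) simp_all
  with *(4) show ?thesis by (simp add: sim_def)
qed

end

section \<open>Leading terms and faithfulness\<close>

text \<open>The group element underlying each operator: \<open>elem_op\<close> without prefactors,
  denominators and lower terms.\<close>

fun aut :: "nat \<Rightarrow> elem_diag \<Rightarrow> mpol \<Rightarrow> mpol" where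
  "aut m (Dot k) g = g"
| "aut m (Cross k) g = swap_pol k g"
| "aut m Refl_L g = refl_left_pol g"
| "aut m Refl_R g = refl_right_pol m g"

lemma aut_simps [simp]:
  "aut m d 0 = 0" "aut m d 1 = 1" "aut m d (Const c) = Const c"
  "aut m d (g + h) = aut m d g + aut m d h" "aut m d (g * h) = aut m d g * aut m d h"
  "aut m d (aut m d g) = g"
  by (cases d; simp)+

definition auts :: "nat \<Rightarrow> elem_diag list \<Rightarrow> mpol \<Rightarrow> mpol" where
  "auts m ds g = foldr (aut m) ds g"

lemma auts_rec [simp]: "auts m [] g = g" "auts m (d # ds) g = aut m d (auts m ds g)"
  by (simp_all add: auts_def)

lemma auts_simps [simp]:
  "auts m ds 0 = 0" "auts m ds 1 = 1" "auts m ds (Const c) = Const c"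
  "auts m ds (g + h) = auts m ds g + auts m ds h" "auts m ds (g * h) = auts m ds g * auts m ds h"
  by (induction ds) simp_all

lemma aut_eq_0_iff [simp]: "aut m d g = 0 \<longleftrightarrow> g = 0"
  by (metis aut_simps(1,6))

lemma auts_eq_0_iff [simp]: "auts m ds g = 0 \<longleftrightarrow> g = 0"
  by (induction ds) simp_all

lemma auts_rev: "auts m ds (auts m (rev ds) g) = g"
proof (induction ds arbitrary: g)
  case (Cons d ds)
  have "auts m (rev (d # ds)) g = auts m (rev ds) (aut m d g)" by (simp add: auts_def)
  with Cons show ?case by simp
qed simp

lemma aut_sum: "aut m d (sum f A) = (\<Sum>a\<in>A. aut m d (f a))"
  by (induction A rule: infinite_finite_induct) simp_all

text \<open>Undoes the scaling of points: 2m + 2 corresponds to \<open>hbar\<close>, so the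
  reflection in m + 1 becomes X -> hbar - X.\<close>

definition pt_val :: "nat \<Rightarrow> int \<Rightarrow> complex poly" where
  "pt_val m z = smult (of_int z / of_nat (2 * m + 2)) hbar"

lemma pt_val_simps [simp]:
  "pt_val m (- z) = - pt_val m z" "pt_val m (2 * int m + 2 - z) = hbar - pt_val m z"
  "pt_val m z = pt_val m z' \<longleftrightarrow> z = z'"
proof -
  have N: "of_nat (2 * m + 2) \<noteq> (0 :: complex)"
    unfolding of_nat_eq_0_iff by simp
  show "pt_val m (- z) = - pt_val m z"
    unfolding pt_val_def of_int_minus minus_divide_left[symmetric] by simp
  have "of_int (2 * int m + 2 - z) = of_nat (2 * m + 2) - (of_int z :: complex)" by simp
  then show "pt_val m (2 * int m + 2 - z) = hbar - pt_val m z"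
    unfolding pt_val_def diff_divide_distrib using N
    by (simp only: diff_divide_distrib right_inverse_eq[THEN iffD2, OF N refl] smult_diff_left smult_1_left)
  show "pt_val m z = pt_val m z' \<longleftrightarrow> z = z'"
    using N by (simp add: pt_val_def hbar_def del: of_nat_add of_nat_mult)
qed

definition eval_pt :: "nat \<Rightarrow> (nat \<Rightarrow> int) \<Rightarrow> mpol \<Rightarrow> mpol" where
  "eval_pt m x = subst (\<lambda>k. Const (pt_val m (x k)))"

lemma eval_pt_aut: "eval_pt m x (aut m d g) = eval_pt m (pact m d x) g"
proof (induction g rule: mpol_induct)
  case (Var k)
  show ?case
    by (cases d) (auto simp: eval_pt_def subst_simps Const_uminus Const_diff)
qed (simp_all add: eval_pt_def subst_simps)

text \<open>So the automorphism of a word determines its point.\<close>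

lemma eval_pt_auts: "eval_pt m (pt m ds) (auts m ds g) = eval_pt m (base m) g"
  by (induction ds) (simp_all add: eval_pt_aut)

lemma auts_fix: "dotless m ds \<Longrightarrow> k \<notin> {1..m} \<Longrightarrow> auts m ds (Var k) = Var k"
proof (induction ds)
  case (Cons d ds)
  then show ?case by (cases d) auto
qed simp

text \<open>Used in contrapositive form: words with different points have automorphisms that differ
  already on polynomials in X_1, ..., X_m.\<close>

lemma pt_eqI:
  assumes "dotless m ds" "dotless m ds'"
    and "\<And>g. g \<in> vars_in {1..m} \<Longrightarrow> auts m ds g = auts m ds' g"
  shows "pt m ds = pt m ds'"
proof
  fix k
  have eq: "auts m ds g = auts m ds' g" for g
  proof (induction g rule: mpol_induct)
    case (Var k)
    show ?case using assms auts_fix[of m _ k] by (cases "k \<in> {1..m}") simp_all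
  qed simp_all
  \<comment> \<open>The reversed word gives the inverse automorphism, which expresses evaluation at
    the point of a word by evaluation at the base point. As ds and ds' have the same automorphism,
    they share this inverse.\<close>
  have "eval_pt m (pt m ds) g = eval_pt m (base m) (auts m (rev ds) g)"
    "eval_pt m (pt m ds') g = eval_pt m (base m) (auts m (rev ds) g)" for g
    using eval_pt_auts[of m ds "auts m (rev ds) g"] eval_pt_auts[of m ds' "auts m (rev ds) g"] eq
    by (simp_all add: auts_rev) (metis auts_rev eq)
  then have "eval_pt m (pt m ds) (Var k) = eval_pt m (pt m ds') (Var k)" by simp
  then show "pt m ds k = pt m ds' k" by (simp add: eval_pt_def)
qed

text \<open>Dedekind's argument, except that the maps other than the one at \<open>a\<^sub>0\<close> may coincide.\<close>

lemma dedekind_isolated: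
  fixes f :: "'i \<Rightarrow> 'a :: monoid_mult \<Rightarrow> 'b :: idom"
  assumes "finite B" "a\<^sub>0 \<notin> B"
    and S: "1 \<in> S" "\<And>g h. g \<in> S \<Longrightarrow> h \<in> S \<Longrightarrow> g * h \<in> S"
    and mult: "\<And>a g h. a \<in> insert a\<^sub>0 B \<Longrightarrow> g \<in> S \<Longrightarrow> h \<in> S \<Longrightarrow> f a (g * h) = f a g * f a h"
    and one: "f a\<^sub>0 1 = 1"
    and diff: "\<And>b. b \<in> B \<Longrightarrow> \<exists>h\<in>S. f b h \<noteq> f a\<^sub>0 h"
    and zero: "\<And>g. g \<in> S \<Longrightarrow> (\<Sum>a\<in>insert a\<^sub>0 B. c a * f a g) = 0"
  shows "c a\<^sub>0 = 0"
  using assms(1,2) mult diff zero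
proof (induction B arbitrary: c rule: finite_induct)
  case empty
  from empty(4)[OF S(1)] one show ?case by simp
next
  case (insert b B)
  obtain h where h: "h \<in> S" "f b h \<noteq> f a\<^sub>0 h" using insert.prems(3)[of b] by auto
  \<comment> \<open>The relation at h g minus f_b(h) times the relation at g loses its term at b,
    and every other coefficient c_a is multiplied by f_a(h) - f_b(h).\<close>
  have "c a\<^sub>0 * (f a\<^sub>0 h - f b h) = 0"
  proof (rule insert.IH[of "\<lambda>a. c a * (f a h - f b h)"])
    fix g assume g: "g \<in> S"
    let ?A = "insert a\<^sub>0 (insert b B)"
    have "(\<Sum>a\<in>insert a\<^sub>0 B. c a * (f a h - f b h) * f a g) = (\<Sum>a\<in>?A. c a * (f a h - f b h) * f a g)"
      using insert.hyps insert.prems(1) by (intro sum.mono_neutral_left) auto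
    also have "\<dots> = (\<Sum>a\<in>?A. c a * f a (h * g)) - f b h * (\<Sum>a\<in>?A. c a * f a g)"
      unfolding sum_distrib_left sum_subtractf[symmetric]
      using insert.prems(2) h g by (intro sum.cong refl) (simp add: algebra_simps)
    also have "\<dots> = 0" using insert.prems(4) S h g by simp
    finally show "(\<Sum>a\<in>insert a\<^sub>0 B. c a * (f a h - f b h) * f a g) = 0" .
  qed (use insert in auto)
  with h show ?case by simp
qed

text \<open>The factor \<open>D\<close> clears denominators: \<open>T\<close> is a combination of automorphisms over the fraction field.\<close>

definition combo :: "nat \<Rightarrow> elem_diag list set \<Rightarrow> (mpol \<Rightarrow> mpol) \<Rightarrow> bool" where
  "combo m A T \<longleftrightarrow> (\<exists>D U c. D \<noteq> 0 \<and> finite U \<and> U \<subseteq> A \<and>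
     (\<forall>g\<in>vars_in {1..m}. D * T g = (\<Sum>u\<in>U. c u * auts m u g)))"

lemma comboI:
  assumes "D \<noteq> 0" "finite U" "U \<subseteq> A"
    and "\<And>g. g \<in> vars_in {1..m} \<Longrightarrow> D * T g = (\<Sum>u\<in>U. c u * auts m u g)"
  shows "combo m A T"
  using assms unfolding combo_def by blast

lemma combo_cong:
  assumes "combo m A T" "\<And>g. g \<in> vars_in {1..m} \<Longrightarrow> T' g = T g"
  shows "combo m A T'"
  using assms unfolding combo_def by simp

lemma combo_mono: "combo m A T \<Longrightarrow> A \<subseteq> B \<Longrightarrow> combo m B T"
  unfolding combo_def by (meson subset_trans)

lemma combo_0 [simp]: "combo m A (\<lambda>g. 0)"
  by (rule comboI[of 1 "{}"]) simp_all

lemma combo_auts: "u \<in> A \<Longrightarrow> combo m A (auts m u)"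
  by (rule comboI[of 1 "{u}" _ _ _ "\<lambda>_. 1"]) simp_all

lemma combo_add:
  assumes "combo m A T" "combo m A T'"
  shows "combo m A (\<lambda>g. T g + T' g)"
proof -
  obtain D U c where 1: "D \<noteq> 0" "finite U" "U \<subseteq> A"
    "\<And>g. g \<in> vars_in {1..m} \<Longrightarrow> D * T g = (\<Sum>u\<in>U. c u * auts m u g)"
    using assms(1) unfolding combo_def by blast
  obtain D' U' c' where 2: "D' \<noteq> 0" "finite U'" "U' \<subseteq> A"
    "\<And>g. g \<in> vars_in {1..m} \<Longrightarrow> D' * T' g = (\<Sum>u\<in>U'. c' u * auts m u g)"
    using assms(2) unfolding combo_def by blast
  let ?c = "\<lambda>u. D' * (if u \<in> U then c u else 0) + D * (if u \<in> U' then c' u else 0)"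
  show ?thesis
  proof (rule comboI[of "D * D'" "U \<union> U'" A m _ ?c])
    fix g assume g: "g \<in> vars_in {1..m}"
    have "(\<Sum>u\<in>U. c u * auts m u g) = (\<Sum>u\<in>U \<union> U'. (if u \<in> U then c u else 0) * auts m u g)"
      "(\<Sum>u\<in>U'. c' u * auts m u g) = (\<Sum>u\<in>U \<union> U'. (if u \<in> U' then c' u else 0) * auts m u g)"
      using 1 2 by (intro sum.mono_neutral_cong_left; auto)+
    then have "D' * (D * T g) + D * (D' * T' g) = (\<Sum>u\<in>U \<union> U'. ?c u * auts m u g)"
      using 1(4)[OF g] 2(4)[OF g] by (simp add: sum_distrib_left sum.distrib distrib_right mult.assoc)
    then show "D * D' * (T g + T' g) = (\<Sum>u\<in>U \<union> U'. ?c u * auts m u g)"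
      by (simp add: algebra_simps)
  qed (use 1 2 in auto)
qed

lemma combo_mult:
  assumes "combo m A T"
  shows "combo m A (\<lambda>g. p * T g)"
proof -
  obtain D U c where *: "D \<noteq> 0" "finite U" "U \<subseteq> A"
    "\<And>g. g \<in> vars_in {1..m} \<Longrightarrow> D * T g = (\<Sum>u\<in>U. c u * auts m u g)"
    using assms unfolding combo_def by blast
  show ?thesis
  proof (rule comboI[OF *(1-3), of m _ "\<lambda>u. p * c u"])
    fix g assume "g \<in> vars_in {1..m}"
    from arg_cong[OF *(4)[OF this], of "\<lambda>x. p * x"]
    show "D * (p * T g) = (\<Sum>u\<in>U. p * c u * auts m u g)"
      by (simp add: sum_distrib_left mult_ac)
  qed
qed

lemma combo_uminus: "combo m A T \<Longrightarrow> combo m A (\<lambda>g. - T g)"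
  using combo_mult[of m A T "- 1"] by simp

lemma combo_sum:
  "(\<And>p. p \<in> P \<Longrightarrow> combo m A (T p)) \<Longrightarrow> combo m A (\<lambda>g. \<Sum>p\<in>P. T p g)"
  by (induction P rule: infinite_finite_induct) (simp_all add: combo_add)

lemma combo_divide:
  assumes "combo m A (\<lambda>g. q * T g)" "q \<noteq> 0"
  shows "combo m A T"
proof -
  obtain D U c where *: "D \<noteq> 0" "finite U" "U \<subseteq> A"
    "\<And>g. g \<in> vars_in {1..m} \<Longrightarrow> D * (q * T g) = (\<Sum>u\<in>U. c u * auts m u g)"
    using assms(1) unfolding combo_def by blast
  show ?thesis
    by (rule comboI[of "D * q", OF _ *(2,3)]) (use * assms(2) in \<open>simp_all add: mult.assoc\<close>)
qed

text \<open>Automorphisms are multiplicative, so the factor h moves into the coefficients.\<close>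

lemma combo_precompose:
  assumes "combo m A T" "h \<in> vars_in {1..m}"
  shows "combo m A (\<lambda>g. T (h * g))"
proof -
  obtain D U c where *: "D \<noteq> 0" "finite U" "U \<subseteq> A"
    "\<And>g. g \<in> vars_in {1..m} \<Longrightarrow> D * T g = (\<Sum>u\<in>U. c u * auts m u g)"
    using assms(1) unfolding combo_def by blast
  show ?thesis
    by (rule comboI[OF *(1-3), of m _ "\<lambda>u. c u * auts m u h"])
      (use *(4)[of "h * _"] assms(2) in \<open>simp add: mult.assoc\<close>)
qed

lemma combo_aut:
  assumes "combo m A T" "(#) d ` A \<subseteq> B"
  shows "combo m B (\<lambda>g. aut m d (T g))"
proof -
  obtain D U c where *: "D \<noteq> 0" "finite U" "U \<subseteq> A"
    "\<And>g. g \<in> vars_in {1..m} \<Longrightarrow> D * T g = (\<Sum>u\<in>U. c u * auts m u g)"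
    using assms(1) unfolding combo_def by blast
  show ?thesis
  \<comment> \<open>The new index w is d # u, and \<open>tl w\<close> recovers the index of the old
    coefficient.\<close>
  proof (rule comboI[of "aut m d D" "(#) d ` U" B m _ "\<lambda>w. aut m d (c (tl w))"])
    fix g assume "g \<in> vars_in {1..m}"
    from arg_cong[OF *(4)[OF this], of "aut m d"]
    show "aut m d D * aut m d (T g) = (\<Sum>w\<in>(#) d ` U. aut m d (c (tl w)) * auts m w g)"
      by (simp add: aut_sum sum.reindex)
  qed (use * assms(2) in auto)
qed

section \<open>Leading terms of the operators of words\<close>

definition shorter :: "nat \<Rightarrow> nat \<Rightarrow> elem_diag list set" where
  "shorter m L = {u. dotless m u \<and> length u < L}"

text \<open>Triangularity with D as common denominator. The shorter words need not be reduced and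
  may repeat group elements; for reduced ds none of them has the point of ds, so the leading term
  stands alone.\<close>

definition leading :: "nat \<Rightarrow> elem_diag list \<Rightarrow> (mpol \<Rightarrow> mpol) \<Rightarrow> bool" where
  "leading m ds T \<longleftrightarrow> (\<exists>D c T'. D \<noteq> 0 \<and> c \<noteq> 0 \<and> combo m (shorter m (length ds)) T' \<and>
     (\<forall>g\<in>vars_in {1..m}. D * T g = c * auts m ds g + T' g))"

lemma leading_aut:
  assumes "leading m ds T" "fits d m" "\<not> is_dot d" "p \<noteq> 0"
  shows "leading m (d # ds) (\<lambda>g. p * aut m d (T g))"
proof -
  obtain D c T' where *: "D \<noteq> 0" "c \<noteq> 0" "combo m (shorter m (length ds)) T'"
    "\<And>g. g \<in> vars_in {1..m} \<Longrightarrow> D * T g = c * auts m ds g + T' g"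
    using assms(1) unfolding leading_def by blast
  have "aut m d D * (p * aut m d (T g)) = p * aut m d c * auts m (d # ds) g + p * aut m d (T' g)"
    if "g \<in> vars_in {1..m}" for g
    using arg_cong[OF *(4)[OF that], of "\<lambda>x. p * aut m d x"] by (simp add: algebra_simps)
  moreover have "combo m (shorter m (length (d # ds))) (\<lambda>g. p * aut m d (T' g))"
    by (intro combo_mult combo_aut[OF *(3)]) (use assms in \<open>auto simp: shorter_def\<close>)
  ultimately show ?thesis
    unfolding leading_def using * assms(4)
    by (intro exI[of _ "aut m d D"] exI[of _ "p * aut m d c"] exI[of _ "\<lambda>g. p * aut m d (T' g)"]) simp
qed

text \<open>The case of a divided difference with denominator q. The subtracted copy of T joins the
  lower terms, because ds is itself shorter than d # ds.\<close>

lemma leading_difference: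
  assumes "leading m ds T" "dotless m (d # ds)" "q \<noteq> 0"
    and "\<And>g. q * T'' g = aut m d (T g) - T g"
  shows "leading m (d # ds) T''"
proof -
  obtain D c T' where *: "D \<noteq> 0" "c \<noteq> 0" "combo m (shorter m (length ds)) T'"
    "\<And>g. g \<in> vars_in {1..m} \<Longrightarrow> D * T g = c * auts m ds g + T' g"
    using assms(1) unfolding leading_def by blast
  let ?D = "aut m d D"
  let ?T = "\<lambda>g. D * aut m d (T' g) + (- (?D * c) * auts m ds g + - ?D * T' g)"
  \<comment> \<open>T occurs once under d and once untouched, so both denominators, D and its image
    under d, have to be cleared.\<close>
  have "D * ?D * q * T'' g = D * aut m d c * auts m (d # ds) g + ?T g" if "g \<in> vars_in {1..m}" for g
  proof -
    have "?D * aut m d (T g) = aut m d c * auts m (d # ds) g + aut m d (T' g)"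
      using arg_cong[OF *(4)[OF that], of "aut m d"] by simp
    moreover have "D * ?D * q * T'' g = D * (?D * aut m d (T g)) - ?D * (D * T g)"
      by (simp only: mult.assoc assms(4)) (simp add: algebra_simps)
    ultimately show ?thesis using *(4)[OF that] by (simp add: algebra_simps)
  qed
  moreover have "combo m (shorter m (length (d # ds))) ?T"
  proof (intro combo_add combo_mult combo_auts)
    show "combo m (shorter m (length (d # ds))) (\<lambda>g. aut m d (T' g))"
      by (rule combo_aut[OF *(3)]) (use assms in \<open>auto simp: shorter_def\<close>)
    show "combo m (shorter m (length (d # ds))) T'"
      by (rule combo_mono[OF *(3)]) (auto simp: shorter_def)
  qed (use assms in \<open>simp add: shorter_def\<close>)
  ultimately show ?thesis
    unfolding leading_def using * assms(3)
    by (intro exI[of _ "D * ?D * q"] exI[of _ "D * aut m d c"] exI[of _ ?T]) simp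
qed

lemma Var_neq_Const [simp]: "Var k \<noteq> Const c"
  by (metis vars_in_Var vars_in_Const empty_iff)

lemma p_pol_Var_neq_0: "p_pol R i (Var k) \<noteq> 0"
proof -
  have "(\<Prod>c\<in>#M. Var k - Const (smult c hbar)) \<noteq> 0" for M :: "complex multiset"
    by (induction M) simp_all
  then show ?thesis by (simp add: p_pol_def)
qed

lemma X_bar_Var_neq_0:
  assumes "k \<noteq> l"
  shows "X_bar Q p q (Var k) (Var l) \<noteq> 0"
proof -
  have "Var k - Var l - Const c \<noteq> 0" for c
  proof
    assume "Var k - Var l - Const c = 0"
    then have "Var k = Var l + Const c" by (simp add: algebra_simps)
    moreover have "Var l + Const c \<in> vars_in {l}" by simp
    ultimately show False using assms by (metis vars_in_Var singletonD)
  qed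
  then show ?thesis by (simp add: X_bar_def)
qed

text \<open>Forgets which word a component belongs to. The linear independence is proved for points,
  and good words with equal points have equal target words, so no information needed there is
  lost.\<close>

definition total :: "'q pol \<Rightarrow> mpol" where
  "total v = (\<Sum>j\<in>keys v. lookup v j)"

lemma total_add: "total (v + w) = total v + total w"
  unfolding total_def by (rule setsum_keys_plus_distrib[of "\<lambda>_ g. g"]) simp_all

lemma total_simps [simp]: "total 0 = 0" "total (single i g) = g"
  by (simp_all add: total_def)

lemma total_sum: "total (sum f A) = (\<Sum>a\<in>A. total (f a))"
  by (induction A rule: infinite_finite_induct) (simp_all add: total_add)

context iyangian_data
begin

text \<open>The arrow factors and the prefactors of the left mirror are nonzero polynomials, and a
  crossing of equal labels is a difference quotient whose lower part involves only shorter
  words.\<close>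

lemma leading_seq_op:
  assumes "dotless (length i) ds"
  shows "leading (length i) ds (seq_op ds i)"
  using assms
proof (induction ds)
  case Nil
  show ?case unfolding leading_def
    by (intro exI[of _ 1] exI[of _ "\<lambda>_. 0"]) (simp add: vars_in_def)
next
  case (Cons d ds)
  let ?m = "length i" and ?t = "tgt ds i"
  have lead: "leading ?m ds (seq_op ds i)" and d: "fits d ?m" "\<not> is_dot d"
    using Cons by simp_all
  note aut = leading_aut[OF lead d]
  show ?case
  proof (cases d)
    case (Cross k)
    show ?thesis
    proof (cases "?t ! (k - 1) = ?t ! k")
      case True
      have "(Var (Suc k) - Var k) * seq_op (d # ds) i g = aut ?m d (seq_op ds i g) - seq_op ds i g" for g
        using True Cross by (simp add: cross_op_def demazure_mult)
      from leading_difference[OF lead Cons.prems _ this] show ?thesis by simp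
    next
      case False
      let ?X = "X_bar Q (?t ! (k - 1)) (?t ! k) (Var (Suc k)) (Var k)"
      have eq: "seq_op (d # ds) i = (\<lambda>g. ?X * aut ?m d (seq_op ds i g))"
        using False Cross by (simp add: cross_op_def fun_eq_iff)
      show ?thesis unfolding eq by (intro aut X_bar_Var_neq_0) simp
    qed
  next
    case Refl_L
    let ?p = "p_pol R (\<tau> (?t ! 0)) (Var 1)"
    have eq: "seq_op (d # ds) i = (\<lambda>g. ?p * aut ?m d (seq_op ds i g))"
      using Refl_L by (simp add: fun_eq_iff)
    show ?thesis unfolding eq by (intro aut p_pol_Var_neq_0)
  next
    case Refl_R
    have eq: "seq_op (d # ds) i = (\<lambda>g. 1 * aut ?m d (seq_op ds i g))"
      using Refl_R by (simp add: fun_eq_iff)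
    show ?thesis unfolding eq by (rule aut) simp
  qed (use d in simp)
qed

lemma combo_seq_op:
  assumes "dotless (length i) ds"
  shows "combo (length i) (insert ds (shorter (length i) (length ds))) (seq_op ds i)"
proof -
  let ?m = "length i"
  obtain D c T' where *: "D \<noteq> 0" "combo ?m (shorter ?m (length ds)) T'"
    "\<And>g. g \<in> vars_in {1..?m} \<Longrightarrow> D * seq_op ds i g = c * auts ?m ds g + T' g"
    using leading_seq_op[OF assms] unfolding leading_def by blast
  have "combo ?m (insert ds (shorter ?m (length ds))) (\<lambda>g. c * auts ?m ds g + T' g)"
    by (intro combo_add combo_mult combo_auts combo_mono[OF *(2)]) auto
  then have "combo ?m (insert ds (shorter ?m (length ds))) (\<lambda>g. D * seq_op ds i g)"
    by (rule combo_cong) (use *(3) in simp)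
  then show ?thesis using *(1) by (rule combo_divide)
qed

section \<open>Operators of filtered elements\<close>

definition total_op :: "'q list \<Rightarrow> 'q gen free_alg \<Rightarrow> mpol \<Rightarrow> mpol" where
  "total_op i x g = total (alg_op x (single i g))"

lemma total_op_add: "total_op i (x + y) g = total_op i x g + total_op i y g"
  by (simp add: total_op_def alg_op_add total_add)

lemma total_op_sum: "total_op i (sum f A) g = (\<Sum>a\<in>A. total_op i (f a) g)"
  by (simp add: total_op_def alg_op_sum total_sum)

lemma total_op_I:
  assumes "i \<in> words" "x \<in> I" "g \<in> vars_in {1..length i}"
  shows "total_op i x g = 0"
proof -
  have "single i g \<in> Pol Q" using assms by (simp add: Pol_word_eq)
  then have "alg_op x (single i g) = 0"
    using rel_ideal_subset assms(2) unfolding op_kernel_def by blast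
  then show ?thesis by (simp add: total_op_def)
qed

lemma total_op_diag_dots:
  "h \<in> Pol_word i \<Longrightarrow> total_op i (dia ds i * dots i h) g = seq_op ds i (h * g)"
  by (simp add: total_op_def alg_op_mult alg_op_dots alg_op_diag)

lemma combo_filt:
  assumes "i \<in> words" "filt i L x"
  shows "combo (length i) (shorter (length i) L) (total_op i x)"
  using assms(2)
proof (induction rule: filt.induct)
  case (ideal x)
  show ?case by (rule combo_cong[OF combo_0]) (use total_op_I assms(1) ideal in simp)
next
  case (add x y)
  then have "combo (length i) (shorter (length i) L) (\<lambda>g. total_op i x g + total_op i y g)"
    by (intro combo_add)
  then show ?case by (rule combo_cong) (simp add: total_op_add)
next
  case (normal ds h)
  have "combo (length i) (shorter (length i) L) (seq_op ds i)"
    by (rule combo_mono[OF combo_seq_op]) (use normal in \<open>auto simp: shorter_def\<close>)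
  then have "combo (length i) (shorter (length i) L) (\<lambda>g. seq_op ds i (h * g))"
    using normal by (intro combo_precompose) (simp_all add: Pol_word_eq)
  then show ?case by (rule combo_cong) (simp add: total_op_diag_dots normal)
qed

text \<open>One reduced word for each group element, which is named by its point. The value is
  meaningful only for points that some good word reaches.\<close>

definition rep :: "nat \<Rightarrow> (nat \<Rightarrow> int) \<Rightarrow> elem_diag list" where
  "rep m p = (SOME ds. dotless m ds \<and> good m ds \<and> pt m ds = p)"

text \<open>P contains the support of G. With G zero elsewhere, two such sums can be added over the
  union of their index sets.\<close>

definition reduced_terms :: "'q list \<Rightarrow> nat \<Rightarrow> (nat \<Rightarrow> int) set \<Rightarrow> ((nat \<Rightarrow> int) \<Rightarrow> mpol) \<Rightarrow> bool" where
  "reduced_terms i L P G \<longleftrightarrow> finite P \<and> (\<forall>p\<in>P. dotless (length i) (rep (length i) p) \<and>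
     good (length i) (rep (length i) p) \<and> length (rep (length i) p) = L \<and>
     pt (length i) (rep (length i) p) = p) \<and> (\<forall>p. G p \<in> Pol_word i \<and> (p \<notin> P \<longrightarrow> G p = 0))"

abbreviation "reduced_sum i P G \<equiv> (\<Sum>p\<in>P. dia (rep (length i) p) i * dots i (G p))"

lemma reduced_sum_superset:
  assumes "reduced_terms i L P G" "P \<subseteq> P'" "finite P'"
  shows "reduced_sum i P G = reduced_sum i P' G"
  using assms by (intro sum.mono_neutral_left) (auto simp: reduced_terms_def)

text \<open>By \<open>reduce_word\<close>, a word of length L is congruent to the chosen reduced
  word of its point or falls into the lower step of the filtration.\<close>

lemma filt_Suc_reduced:
  assumes "i \<in> words" "filt i (Suc L) x"
  shows "\<exists>P G. reduced_terms i L P G \<and> filt i L (x - reduced_sum i P G)"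
  using assms(2)
proof (induction rule: filt.induct)
  case (ideal x)
  then show ?case
    by (intro exI[of _ "{}"] exI[of _ "\<lambda>_. 0"]) (simp add: reduced_terms_def Pol_word_eq filt.ideal)
next
  case (add x y)
  obtain P G P' G' where *: "reduced_terms i L P G" "filt i L (x - reduced_sum i P G)"
    "reduced_terms i L P' G'" "filt i L (y - reduced_sum i P' G')"
    using add.IH by blast
  let ?G = "\<lambda>p. G p + G' p"
  have fin: "finite (P \<union> P')" using *(1,3) by (simp add: reduced_terms_def)
  have "reduced_sum i (P \<union> P') ?G = reduced_sum i P G + reduced_sum i P' G'"
    using reduced_sum_superset[OF *(1) _ fin] reduced_sum_superset[OF *(3) _ fin]
    by (simp add: dots_add distrib_left sum.distrib)
  then have "filt i L (x + y - reduced_sum i (P \<union> P') ?G)"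
    using filt.add[OF *(2,4)] by (simp add: algebra_simps)
  moreover have "reduced_terms i L (P \<union> P') ?G"
    using *(1,3) by (auto simp: reduced_terms_def Pol_word_eq)
  ultimately show ?case by blast
next
  case (normal ds g)
  let ?m = "length i"
  have low: ?case if "filt i L (dia ds i * dots i g)"
    using that by (intro exI[of _ "{}"] exI[of _ "\<lambda>_. 0"]) (simp add: reduced_terms_def Pol_word_eq)
  show ?case
  proof (cases "length ds < L")
    case True
    then show ?thesis using normal by (intro low filt.normal)
  next
    case False
    then have L: "length ds = L" using normal by simp
    obtain ds' where ds': "dotless ?m ds'" "good ?m ds'" "pt ?m ds' = pt ?m ds"
      and alts: "sim i ds ds' \<or> filt i (length ds) (dia ds i)"
      using reduce_word[OF assms(1) normal(1)] by blast
    from alts show ?thesis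
    proof
      assume "filt i (length ds) (dia ds i)"
      then show ?thesis using L assms(1) normal by (intro low filt_dots_right) simp_all
    next
      assume s: "sim i ds ds'"
      let ?p = "pt ?m ds" and ?r = "rep ?m (pt ?m ds)"
      have "dotless ?m ?r \<and> good ?m ?r \<and> pt ?m ?r = ?p"
        unfolding rep_def by (rule someI[of _ ds']) (use ds' in simp)
      then have r: "dotless ?m ?r" "good ?m ?r" "pt ?m ?r = ?p" by simp_all
      then have "sim i ds' ?r" using ds' assms(1) by (intro good_unique) simp_all
      with s have "sim i ds ?r" by (rule sim_trans)
      then have "filt i (length ds) (dia ds i - dia ?r i)" and len: "length ds = length ?r"
        unfolding sim_def by blast+
      then have f: "filt i L (dia ds i - dia ?r i)" by (simp only: L)
      have "length ?r = L" using len L by simp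
      then have "reduced_terms i L {?p} (\<lambda>p. if p = ?p then g else 0)"
        using r normal by (simp add: reduced_terms_def Pol_word_eq)
      moreover have "filt i L (dia ds i * dots i g - reduced_sum i {?p} (\<lambda>p. if p = ?p then g else 0))"
        using filt_dots_right[OF assms(1) f normal(3)] by (simp add: left_diff_distrib)
      ultimately show ?thesis by blast
    qed
  qed
qed

text \<open>If G p were nonzero, the leading term at p could be isolated: the other reduced words of
  the sum have other points, and so do all words of length less than L, since a good word is the
  shortest one for its point. The automorphism of \<open>rep\<close> at p would then be a
  combination, over the fraction field, of automorphisms different from it.\<close>

lemma reduced_terms_vanish:
  assumes i: "i \<in> words" and red: "reduced_terms i L P G"
    and z: "filt i L z"
    and zero: "\<And>g. g \<in> vars_in {1..length i} \<Longrightarrow> total_op i (reduced_sum i P G + z) g = 0"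
  shows "G p = 0"
proof (rule ccontr)
  let ?m = "length i" and ?r = "rep (length i)"
  let ?V = "vars_in {1..?m}"
  assume Gp: "G p \<noteq> 0"
  have P: "finite P" "p \<in> P" and G: "\<And>p. G p \<in> Pol_word i"
    and r: "\<And>p. p \<in> P \<Longrightarrow> dotless ?m (?r p)" "\<And>p. p \<in> P \<Longrightarrow> good ?m (?r p)"
      "\<And>p. p \<in> P \<Longrightarrow> length (?r p) = L" "\<And>p. p \<in> P \<Longrightarrow> pt ?m (?r p) = p"
    using red Gp by (auto simp: reduced_terms_def)
  define B where "B = {u. dotless ?m u \<and> pt ?m u \<noteq> p}"
  have short: "shorter ?m L \<subseteq> B"
  proof
    fix u assume "u \<in> shorter ?m L"
    then have u: "dotless ?m u" "length u < L" by (simp_all add: shorter_def)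
    have "pt ?m u \<noteq> p"
      using length_good_le[OF i r(1,2)[OF P(2)] u(1)] r(3,4)[OF P(2)] u(2) by auto
    with u show "u \<in> B" by (simp add: B_def)
  qed
  define T where "T = (\<lambda>g. (\<Sum>q\<in>P - {p}. seq_op (?r q) i (G q * g)) + total_op i z g)"
  have "combo ?m B (\<lambda>g. seq_op (?r q) i (G q * g))" if "q \<in> P - {p}" for q
  proof (rule combo_precompose)
    show "combo ?m B (seq_op (?r q) i)"
      using that r[of q] short by (intro combo_mono[OF combo_seq_op]) (auto simp: B_def)
    show "G q \<in> ?V" using G by (simp add: Pol_word_eq)
  qed
  then have T: "combo ?m B T"
    unfolding T_def by (intro combo_add combo_sum combo_mono[OF combo_filt[OF i z] short])
  have sum0: "seq_op (?r p) i (G p * g) = - T g" if "g \<in> ?V" for g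
  proof -
    have "total_op i (reduced_sum i P G) g = (\<Sum>q\<in>P. seq_op (?r q) i (G q * g))"
      by (simp add: total_op_sum total_op_diag_dots G)
    also have "\<dots> = seq_op (?r p) i (G p * g) + (\<Sum>q\<in>P - {p}. seq_op (?r q) i (G q * g))"
      using P by (simp add: sum.remove)
    finally have "seq_op (?r p) i (G p * g) + T g = total_op i (reduced_sum i P G) g + total_op i z g"
      by (simp add: T_def add.assoc)
    also have "\<dots> = 0" using zero[OF that] by (simp only: total_op_add)
    finally show ?thesis by (simp only: eq_neg_iff_add_eq_0)
  qed
  obtain D c T' where lead: "D \<noteq> 0" "c \<noteq> 0" "combo ?m (shorter ?m L) T'"
    "\<And>g. g \<in> ?V \<Longrightarrow> D * seq_op (?r p) i g = c * auts ?m (?r p) g + T' g"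
    using leading_seq_op[OF r(1)[OF P(2)]] r(3)[OF P(2)] unfolding leading_def by auto
  \<comment> \<open>Precomposition with multiplication by G p puts the image of G p under an
    injective map into the leading coefficient, which therefore stays nonzero.\<close>
  define e where "e = c * auts ?m (?r p) (G p)"
  have "e \<noteq> 0" using lead(2) Gp by (simp add: e_def)
  have eq: "e * auts ?m (?r p) g = - D * T g + - T' (G p * g)" if "g \<in> ?V" for g
    using lead(4)[of "G p * g"] sum0[OF that] that G[of p]
    by (simp add: e_def Pol_word_eq mult.assoc algebra_simps)
  have "combo ?m B (\<lambda>g. - D * T g + - T' (G p * g))"
    using lead(3) G[of p] short
    by (intro combo_add combo_mult T combo_uminus combo_precompose combo_mono[OF lead(3)])
      (simp_all add: Pol_word_eq)
  then have "combo ?m B (\<lambda>g. e * auts ?m (?r p) g)"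
    by (rule combo_cong) (rule eq)
  then have "combo ?m B (auts ?m (?r p))" using \<open>e \<noteq> 0\<close> by (rule combo_divide)
  then obtain D' U c' where U: "D' \<noteq> 0" "finite U" "U \<subseteq> B"
    "\<And>g. g \<in> ?V \<Longrightarrow> D' * auts ?m (?r p) g = (\<Sum>u\<in>U. c' u * auts ?m u g)"
    unfolding combo_def by blast
  have rU: "?r p \<notin> U" using U(3) r(4)[OF P(2)] by (auto simp: B_def)
  \<comment> \<open>The equation is read as a linear relation in which the word \<open>?r p\<close>
    has coefficient - D'; Dedekind's argument forces this coefficient to vanish.\<close>
  have "(\<lambda>u. if u = ?r p then - D' else c' u) (?r p) = 0"
  proof (rule dedekind_isolated[OF U(2) rU, of ?V "auts ?m" "\<lambda>u. if u = ?r p then - D' else c' u"])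
    fix u assume "u \<in> U"
    then have "dotless ?m u" "pt ?m u \<noteq> pt ?m (?r p)" using U(3) r(4)[OF P(2)] by (auto simp: B_def)
    then show "\<exists>h\<in>?V. auts ?m u h \<noteq> auts ?m (?r p) h"
      using pt_eqI[of ?m u "?r p"] r(1)[OF P(2)] by blast
  next
    fix g assume g: "g \<in> ?V"
    have "(\<Sum>u\<in>U. (if u = ?r p then - D' else c' u) * auts ?m u g) = (\<Sum>u\<in>U. c' u * auts ?m u g)"
      using rU by (intro sum.cong) auto
    then show "(\<Sum>u\<in>insert (?r p) U. (if u = ?r p then - D' else c' u) * auts ?m u g) = 0"
      using U(2,4) rU g by simp
  qed simp_all
  then show False using U(1) by simp
qed

text \<open>The layers of the filtration are removed one at a time from the top. At L = 0 only the
  ideal is left, as no word has fewer than zero letters.\<close>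

lemma filt_faithful:
  assumes "i \<in> words" "filt i L x"
    and "\<And>g. g \<in> vars_in {1..length i} \<Longrightarrow> total_op i x g = 0"
  shows "x \<in> I"
  using assms(2,3)
proof (induction L arbitrary: x)
  case 0
  from 0(1) show ?case
    by (induction rule: filt.induct) simp_all
next
  case (Suc L)
  obtain P G where PG: "reduced_terms i L P G" "filt i L (x - reduced_sum i P G)"
    using filt_Suc_reduced[OF assms(1) Suc.prems(1)] by blast
  have "G p = 0" for p
    by (rule reduced_terms_vanish[OF assms(1) PG]) (simp add: Suc.prems(2))
  with PG(2) have "filt i L x" by simp
  then show ?case using Suc by blast
qed

section \<open>Decomposition of an algebra without unit into blocks\<close>

lemma diag_Ident:
  assumes "i \<in> words" "j \<in> words" "seq_fits ds (length j)"
  shows "dia ds j * free_gen (Ident i) \<approx> (if i = j then dia ds j else 0)"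
  using assms(3)
proof (induction ds)
  case Nil
  then show ?case using rel_eqv[OF rel.idem[OF assms(2,1)]] by auto
next
  case (Cons d ds)
  then have "free_gen (Gen d (tgt ds j)) * (dia ds j * free_gen (Ident i))
      \<approx> free_gen (Gen d (tgt ds j)) * (if i = j then dia ds j else 0)"
    using assms(2) by (intro eqv_mult_left) simp_all
  then show ?case by (auto simp: mult.assoc)
qed

text \<open>Mismatched neighbours meet two different orthogonal idempotents and give zero; a
  matching sequence is a diagram. The empty sequence would be the unit of the free algebra, which
  lies outside the augmentation ideal.\<close>

lemma gen_word_eqv:
  assumes "set gs \<subseteq> gens Q" "gs \<noteq> []"
  shows "single (Free_Word gs) 1 \<approx> 0 \<or>
    (\<exists>i ds. i \<in> words \<and> seq_fits ds (length i) \<and> single (Free_Word gs) 1 \<approx> dia ds i)"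
  using assms
proof (induction gs)
  case Nil
  then show ?case by simp
next
  case (Cons g gs)
  have g: "g \<in> gens Q" using Cons.prems by simp
  show ?case
  proof (cases "gs = []")
    case True
    show ?thesis
    proof (cases g)
      case (Ident i)
      with True g have "i \<in> words" "single (Free_Word (g # gs)) 1 \<approx> dia [] i"
        by (simp_all add: free_gen_def[symmetric])
      moreover have "seq_fits [] (length i)" by simp
      ultimately show ?thesis by blast
    next
      case (Gen d i)
      then have d: "i \<in> words" "fits d (length i)" using g by simp_all
      have "single (Free_Word (g # gs)) 1 \<approx> dia [d] i"
        using eqv_sym[OF rel_eqv[OF rel.idem_right[OF d]]] True Gen by (simp add: free_gen_def[symmetric])
      moreover have "seq_fits [d] (length i)" using d by simp
      ultimately show ?thesis using d(1) by blast
    qed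
  next
    case False
    let ?y = "single (Free_Word gs) (1 :: complex poly)"
    have gy: "single (Free_Word (g # gs)) 1 = free_gen g * ?y"
      by (simp add: free_gen_def mult_single plus_free_word_def)
    have gc: "free_gen g \<in> carrier FR" using g by simp
    from Cons.IH Cons.prems False consider "?y \<approx> 0"
      | i ds where "i \<in> words" "seq_fits ds (length i)" "?y \<approx> dia ds i"
      by auto
    then show ?thesis
    proof cases
      case 1
      from eqv_mult_left[OF this gc] show ?thesis unfolding gy by simp
    next
      case (2 i ds)
      note e = eqv_mult_left[OF 2(3) gc, folded gy]
      show ?thesis
      proof (cases g)
        case (Ident j)
        show ?thesis
        proof (cases "j = tgt ds i")
          case True
          from eqv_trans[OF e[unfolded Ident True] Ident_diag[OF 2(1,2)]] 2 show ?thesis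
            unfolding Ident True by blast
        next
          case False
          from eqv_trans[OF e[unfolded Ident] Ident_diag_neq[OF 2(1,2) _ False]] g Ident show ?thesis
            by simp
        qed
      next
        case (Gen d j)
        then have d: "j \<in> words" "fits d (length j)" using g by simp_all
        show ?thesis
        proof (cases "j = tgt ds i")
          case True
          have "seq_fits (d # ds) (length i)" using d True 2 by simp
          moreover have "single (Free_Word (g # gs)) 1 \<approx> dia (d # ds) i"
            using e Gen True by simp
          ultimately show ?thesis using 2(1) by blast
        next
          case False
          from eqv_trans[OF e[unfolded Gen] Gen_diag_neq[OF 2(1,2) d False]] Gen show ?thesis by simp
        qed
      qed
    qed
  qed
qed

lemma eqv_filt_iff: "x \<approx> y \<Longrightarrow> filt i L x \<longleftrightarrow> filt i L y"
  using filt_eqv eqv_sym by blast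

text \<open>The second condition is required for all large \<open>S\<close> in order to be additive in \<open>x\<close>.\<close>

definition block_sum :: "'q gen free_alg \<Rightarrow> bool" where
  "block_sum x \<longleftrightarrow> (\<forall>i\<in>words. \<exists>L. filt i L (x * free_gen (Ident i))) \<and>
    (\<exists>S\<^sub>0. finite S\<^sub>0 \<and> S\<^sub>0 \<subseteq> words \<and> (\<forall>S. finite S \<and> S\<^sub>0 \<subseteq> S \<and> S \<subseteq> words \<longrightarrow>
      x \<approx> (\<Sum>i\<in>S. x * free_gen (Ident i))))"

lemma block_sum_add:
  assumes "block_sum x" "block_sum y"
  shows "block_sum (x + y)"
  unfolding block_sum_def
proof (intro conjI ballI)
  fix i assume i: "i \<in> words"
  obtain L where L: "filt i L (x * free_gen (Ident i))"
    using assms(1) i unfolding block_sum_def by meson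
  obtain L' where L': "filt i L' (y * free_gen (Ident i))"
    using assms(2) i unfolding block_sum_def by meson
  have "filt i (max L L') (x * free_gen (Ident i) + y * free_gen (Ident i))"
    by (rule filt.add[OF filt_mono[OF L max.cobounded1] filt_mono[OF L' max.cobounded2]])
  then show "\<exists>L. filt i L ((x + y) * free_gen (Ident i))" unfolding distrib_right by (rule exI)
next
  obtain S where S: "finite S" "S \<subseteq> words"
    and "\<forall>T. finite T \<and> S \<subseteq> T \<and> T \<subseteq> words \<longrightarrow> x \<approx> (\<Sum>i\<in>T. x * free_gen (Ident i))"
    using assms(1) unfolding block_sum_def by meson
  moreover obtain S' where S': "finite S'" "S' \<subseteq> words"
    and "\<forall>T. finite T \<and> S' \<subseteq> T \<and> T \<subseteq> words \<longrightarrow> y \<approx> (\<Sum>i\<in>T. y * free_gen (Ident i))"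
    using assms(2) unfolding block_sum_def by meson
  ultimately have "x + y \<approx> (\<Sum>i\<in>T. (x + y) * free_gen (Ident i))"
    if "finite T" "S \<union> S' \<subseteq> T" "T \<subseteq> words" for T
    using that unfolding distrib_right sum.distrib by (intro eqv_add) auto
  with S S' show "\<exists>S\<^sub>0. finite S\<^sub>0 \<and> S\<^sub>0 \<subseteq> words \<and> (\<forall>S. finite S \<and> S\<^sub>0 \<subseteq> S \<and> S \<subseteq> words \<longrightarrow>
      x + y \<approx> (\<Sum>i\<in>S. (x + y) * free_gen (Ident i)))"
    by (intro exI[of _ "S \<union> S'"]) simp
qed

lemma block_sum_eqv:
  assumes "x \<approx> y" "block_sum y"
  shows "block_sum x"
proof -
  have e: "x * free_gen (Ident i) \<approx> y * free_gen (Ident i)" if "i \<in> words" for i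
    using assms(1) that by (intro eqv_mult_right) simp_all
  have "x \<approx> (\<Sum>i\<in>S. x * free_gen (Ident i))"
    if "finite S" "S \<subseteq> words" "y \<approx> (\<Sum>i\<in>S. y * free_gen (Ident i))" for S
  proof -
    have "(\<Sum>i\<in>S. x * free_gen (Ident i)) \<approx> (\<Sum>i\<in>S. y * free_gen (Ident i))"
      using that(1,2) by (induction S rule: finite_induct) (simp_all add: eqv_add e)
    with assms(1) that(3) show ?thesis using eqv_trans eqv_sym by blast
  qed
  with assms(2) eqv_filt_iff[OF e] show ?thesis unfolding block_sum_def by meson
qed

lemma block_sum_0: "block_sum 0"
  unfolding block_sum_def by (auto intro!: exI[of _ "{}"])

lemma block_sum_const_diag:
  assumes "j \<in> words" "seq_fits ds (length j)"
  shows "block_sum (free_const c * dia ds j)"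
  unfolding block_sum_def
proof
  have e: "free_const c * dia ds j * free_gen (Ident i)
      \<approx> (if i = j then free_const c * dia ds j else 0)" if "i \<in> words" for i
    using eqv_mult_left[OF diag_Ident[OF that assms], of "free_const c"] by (auto simp: mult.assoc)
  show "\<forall>i\<in>words. \<exists>L. filt i L (free_const c * dia ds j * free_gen (Ident i))"
  proof
    fix i assume i: "i \<in> words"
    obtain L where "filt j L (dia ds j)" using filt_any_diag[OF assms] by blast
    then have "filt j L (free_const c * dia ds j)" using assms(1) by (intro filt_const_left)
    then have "filt i L (if i = j then free_const c * dia ds j else 0)" by simp
    with e[OF i] show "\<exists>L. filt i L (free_const c * dia ds j * free_gen (Ident i))"
      using filt_eqv by blast
  qed
  have "free_const c * dia ds j \<approx> (\<Sum>i\<in>S. free_const c * dia ds j * free_gen (Ident i))"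
    if S: "finite S" "j \<in> S" "S \<subseteq> words" for S
  proof -
    have "(\<Sum>i\<in>S'. free_const c * dia ds j * free_gen (Ident i))
        \<approx> (\<Sum>i\<in>S'. if i = j then free_const c * dia ds j else 0)" if "S' \<subseteq> S" for S'
      using finite_subset[OF that S(1)] that
    proof (induction S' rule: finite_induct)
      case (insert i S')
      with S(3) have "i \<in> words" "S' \<subseteq> S" by blast+
      from eqv_add[OF e[OF this(1)] insert.IH[OF this(2)]] show ?case
        by (simp only: sum.insert[OF insert.hyps])
    qed simp
    from eqv_sym[OF this[OF order_refl]] S show ?thesis by simp
  qed
  with assms(1) show "\<exists>S\<^sub>0. finite S\<^sub>0 \<and> S\<^sub>0 \<subseteq> words \<and> (\<forall>S. finite S \<and> S\<^sub>0 \<subseteq> S \<and> S \<subseteq> words \<longrightarrow>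
      free_const c * dia ds j \<approx> (\<Sum>i\<in>S. free_const c * dia ds j * free_gen (Ident i)))"
    by (intro exI[of _ "{j}"]) simp
qed

lemma block_sum_augmentation:
  assumes "x \<in> augmentation_ideal (gens Q)"
  shows "block_sum x"
proof -
  have single: "block_sum (single w c)" if "set (letters w) \<subseteq> gens Q" "w \<noteq> 0" for w c
  proof -
    obtain gs where w: "w = Free_Word gs" by (cases w)
    then have gs: "set gs \<subseteq> gens Q" "gs \<noteq> []" using that by (auto simp: zero_free_word_def)
    let ?y = "single (Free_Word gs) (1 :: complex poly)"
    have y: "single w c = free_const c * ?y"
      by (simp add: w free_const_def mult_single)
    from gen_word_eqv[OF gs] show ?thesis
    proof
      assume "?y \<approx> 0"
      from eqv_mult_left[OF this, of "free_const c"] have "single w c \<approx> 0" by (simp add: y)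
      then show ?thesis using block_sum_0 by (rule block_sum_eqv)
    next
      assume "\<exists>i ds. i \<in> words \<and> seq_fits ds (length i) \<and> ?y \<approx> dia ds i"
      then obtain i ds where *: "i \<in> words" "seq_fits ds (length i)" "?y \<approx> dia ds i" by blast
      from eqv_mult_left[OF *(3), of "free_const c"]
      have "single w c \<approx> free_const c * dia ds i" by (simp add: y)
      then show ?thesis using block_sum_const_diag[OF *(1,2)] by (rule block_sum_eqv)
    qed
  qed
  have "block_sum (\<Sum>w\<in>W. single w (lookup x w))" if "finite W" "W \<subseteq> keys x" for W
    using that
  proof (induction W rule: finite_induct)
    case (insert w W)
    then have "w \<noteq> 0" "set (letters w) \<subseteq> gens Q"
      using assms by (auto simp: augmentation_ideal_def free_ring_def)
    with insert show ?case by (simp add: block_sum_add single)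
  qed (simp add: block_sum_0)
  from this[of "keys x"] show ?thesis using poly_mapping_sum_single[of x] by simp
qed

text \<open>As e(i) acts by the projection to one component, each block x e(i) acts by zero as well
  and lies in the ideal by \<open>filt_faithful\<close>. Modulo the ideal, x is the sum of finitely
  many of its blocks.\<close>

lemma augmentation_faithful:
  assumes "x \<in> augmentation_ideal (gens Q)" "\<And>v. v \<in> Pol Q \<Longrightarrow> alg_op x v = 0"
  shows "x \<in> I"
proof -
  have block: "x * free_gen (Ident i) \<in> I" if i: "i \<in> words" for i
  proof -
    obtain L where "filt i L (x * free_gen (Ident i))"
      using block_sum_augmentation[OF assms(1)] i unfolding block_sum_def by blast
    moreover have "total_op i (x * free_gen (Ident i)) g = 0" if "g \<in> vars_in {1..length i}" for g
      using assms(2)[of "single i g"] i that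
      by (simp add: total_op_def alg_op_mult alg_op_gen Pol_word_eq)
    ultimately show ?thesis using i filt_faithful by blast
  qed
  have sum: "(\<Sum>i\<in>S. x * free_gen (Ident i)) \<in> I" if "finite S" "S \<subseteq> words" for S
    using that by (induction S rule: finite_induct) (simp_all add: block)
  obtain S where "finite S" "S \<subseteq> words" "x \<approx> (\<Sum>i\<in>S. x * free_gen (Ident i))"
    using block_sum_augmentation[OF assms(1)] unfolding block_sum_def by blast
  with sum[of S] have "(\<Sum>i\<in>S. x * free_gen (Ident i)) \<approx> 0" by (simp add: eqv_0_iff)
  with \<open>x \<approx> _\<close> have "x \<approx> 0" by (rule eqv_trans)
  then show ?thesis by (simp add: eqv_0_iff)
qed

section \<open>The action of classes\<close>

abbreviation "cls \<equiv> free_class Q \<tau> R"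

text \<open>The representative is arbitrary; on \<open>Pol Q\<close> the result does not depend on
  it because the relation ideal acts by zero there.\<close>

definition act :: "'q gen free_alg set \<Rightarrow> 'q pol \<Rightarrow> 'q pol" where
  "act a v = alg_op (SOME x. x \<in> a) v"

lemma cls_iff: "y \<in> cls x \<longleftrightarrow> (\<exists>h\<in>I. y = h + x)"
  by (auto simp: free_class_def a_r_coset_def' )

lemma act_cls:
  assumes "v \<in> Pol Q"
  shows "act (cls x) v = alg_op x v"
proof -
  have "x \<in> cls x" using I_0 by (auto simp: cls_iff)
  then have "(SOME y. y \<in> cls x) \<in> cls x" by (rule someI)
  then obtain h where "h \<in> I" "(SOME y. y \<in> cls x) = h + x" by (auto simp: cls_iff)
  moreover have "alg_op h v = 0" using \<open>h \<in> I\<close> rel_ideal_subset assms by (auto simp: op_kernel_def)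
  ultimately show ?thesis by (simp add: act_def alg_op_add)
qed

lemma cls_mult: "x \<in> carrier FR \<Longrightarrow> y \<in> carrier FR \<Longrightarrow> cls x \<otimes>\<^bsub>iyangian Q \<tau> R\<^esub> cls y = cls (x * y)"
  using ideal.rcoset_mult_add[OF ideal_I] by (simp add: iyangian_def free_class_def FactRing_def)

lemma cls_add: "x \<in> carrier FR \<Longrightarrow> y \<in> carrier FR \<Longrightarrow> cls x \<oplus>\<^bsub>iyangian Q \<tau> R\<^esub> cls y = cls (x + y)"
  using abelian_subgroup.a_rcos_sum[OF abelian_subgroupI3[OF ideal.axioms(1)[OF ideal_I] ring.is_abelian_group[OF ring_free_ring]]] by (simp add: iyangian_def free_class_def FactRing_def)

lemma iyangian_zero: "\<zero>\<^bsub>iyangian Q \<tau> R\<^esub> = I"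
  by (simp add: iyangian_def FactRing_def)

lemma iyangian_carrierE:
  assumes "a \<in> carrier (iyangian Q \<tau> R)"
  obtains x where "a = cls x" "x \<in> augmentation_ideal (gens Q)" "x \<in> carrier FR"
  using assms by (auto simp: iyangian_def augmentation_ideal_def)

lemma iyangian_action_act: "iyangian_action Q \<tau> R act"
  unfolding iyangian_action_def
proof (intro ballI conjI allI)
  fix a assume "a \<in> carrier (iyangian Q \<tau> R)"
  then obtain x where a: "a = cls x" "x \<in> carrier FR" by (rule iyangian_carrierE)
  fix v assume v: "v \<in> Pol Q"
  show "act a v \<in> Pol Q" using a v by (simp add: act_cls alg_op_Pol)
  show "act a (v + w) = act a v + act a w" if "w \<in> Pol Q" for w
    using pol_linear_alg_op[of x] v that by (simp add: a act_cls pol_linear_def)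
  show "act a (pol_scale c v) = pol_scale c (act a v)" for c
    using pol_linear_alg_op[of x] v by (simp add: a act_cls pol_linear_def)
  show "act (iyangian_scale Q \<tau> R c a) v = pol_scale c (act a v)" for c
    using a v by (simp add: iyangian_scale_def cls_mult act_cls alg_op_mult alg_op_const)
  fix b assume "b \<in> carrier (iyangian Q \<tau> R)"
  then obtain y where b: "b = cls y" "y \<in> carrier FR" by (rule iyangian_carrierE)
  show "act (a \<oplus>\<^bsub>iyangian Q \<tau> R\<^esub> b) v = act a v + act b v"
    using a b v by (simp add: cls_add act_cls alg_op_add)
  show "act (a \<otimes>\<^bsub>iyangian Q \<tau> R\<^esub> b) v = act a (act b v)"
    using a b v by (simp add: cls_mult act_cls alg_op_mult alg_op_Pol)
qed

lemma faithful_act: "faithful Q \<tau> R act"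
  unfolding faithful_def
proof (intro ballI impI)
  fix a assume "a \<in> carrier (iyangian Q \<tau> R)" and zero: "\<forall>v\<in>Pol Q. act a v = 0"
  then obtain x where a: "a = cls x" "x \<in> augmentation_ideal (gens Q)" by (auto elim: iyangian_carrierE)
  have "x \<in> I" by (rule augmentation_faithful[OF a(2)]) (use zero a act_cls in auto)
  have "cls x = I"
  proof (intro equalityI subsetI)
    fix y assume "y \<in> cls x"
    then show "y \<in> I" using \<open>x \<in> I\<close> by (auto simp: cls_iff)
  next
    fix y assume "y \<in> I"
    then have "y + - x \<in> I" using \<open>x \<in> I\<close> by (intro I_add I_uminus)
    then show "y \<in> cls x" by (auto simp: cls_iff intro!: bexI[of _ "y + - x"])
  qed
  then show "a = \<zero>\<^bsub>iyangian Q \<tau> R\<^esub>" by (simp add: a iyangian_zero)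
qed

lemma act_generators:
  assumes "v \<in> Pol Q"
  shows "act (idem_e Q \<tau> R i) v = single i (lookup v i)"
    and "act (dot_y Q \<tau> R k i) v = single i (Var k * lookup v i)"
    and "act (cross_sigma Q \<tau> R k i) v = single (swap k i)
          (if i ! (k - 1) = i ! k
           then exact_quot (swap_pol k (lookup v i) - lookup v i) (Var (k + 1) - Var k)
           else swap_pol k (X_bar Q (i ! (k - 1)) (i ! k) (Var k) (Var (k + 1)) * lookup v i))"
    and "act (rho_L Q \<tau> R i) v = single (refl_left \<tau> i)
          (p_pol R (\<tau> (i ! 0)) (Var 1) * refl_left_pol (lookup v i))"
    and "act (rho_R Q \<tau> R i) v = single (refl_right \<tau> i)
          (refl_right_pol (length i) (lookup v i))"
  using assms
  by (simp_all add: idem_e_def dot_y_def cross_sigma_def rho_L_def rho_R_def act_cls alg_op_gen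
      cross_op_def demazure_def)

end

theorem theorem3p8:
  fixes Q :: "('q, 'h) pre_digraph"
    and \<tau> :: "'q \<Rightarrow> 'q" and \<tau>\<^sub>1 :: "'h \<Rightarrow> 'h"
    and lam :: "'q \<Rightarrow> nat" and R :: "'q \<Rightarrow> complex multiset"
  assumes "quiver_with_involution Q \<tau> \<tau>\<^sub>1"
    and "\<And>i. i \<in> verts Q \<Longrightarrow> size (R i) = lam i"
  shows "\<exists>act. iyangian_action Q \<tau> R act \<and> faithful Q \<tau> R act \<and>
    (\<forall>i \<in> lists (verts Q). \<forall>v \<in> Pol Q.
      act (idem_e Q \<tau> R i) v = Poly_Mapping.single i (lookup v i) \<and>
      (\<forall>k. 1 \<le> k \<and> k \<le> length i \<longrightarrow>
        act (dot_y Q \<tau> R k i) v = Poly_Mapping.single i (Var k * lookup v i)) \<and>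
      (\<forall>k. 1 \<le> k \<and> k < length i \<longrightarrow>
        act (cross_sigma Q \<tau> R k i) v = Poly_Mapping.single (swap k i)
          (if i ! (k - 1) = i ! k
           then exact_quot (swap_pol k (lookup v i) - lookup v i) (Var (k + 1) - Var k)
           else swap_pol k (X_bar Q (i ! (k - 1)) (i ! k) (Var k) (Var (k + 1)) * lookup v i))) \<and>
      (1 \<le> length i \<longrightarrow>
        act (rho_L Q \<tau> R i) v = Poly_Mapping.single (refl_left \<tau> i)
          (p_pol R (\<tau> (i ! 0)) (Var 1) * refl_left_pol (lookup v i))) \<and>
      (1 \<le> length i \<longrightarrow>
        act (rho_R Q \<tau> R i) v = Poly_Mapping.single (refl_right \<tau> i)
          (refl_right_pol (length i) (lookup v i))))"
proof -
  interpret iyangian_data Q \<tau> \<tau>\<^sub>1 R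
    using assms(1) by (simp add: iyangian_data_def)
  show ?thesis
    by (intro exI[of _ act] conjI ballI allI impI iyangian_action_act faithful_act act_generators)
qed

end
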